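(* Let $(N,\gamma)$ be a weak Riemannian manifold that is normalizable at a point $x\in N$, with associated open neighborhoods $U_x\subseteq T_xN$ of $0$ and $V_x\subseteq N$ of $x$. Suppose $y\in V_x$ with $\exp_x^{-1}(y)=v\in U_x$. Then the path $$\alpha:[0,1]\to V_x,\qquad \alpha(t)=\exp_x(t\cdot v)$$ is of minimal length among all paths in $V_x$ from $x$ to $y$. Furthermore, $\alpha$ is the unique minimal path (up to reparametrization) in $V_x$ from $x$ to $y$.
   Context: A Riemannian metric $\gamma$ on a Hilbert or Fréchet manifold $N$ is a smooth $(0,2)$-tensor inducing a bounded, positive-definite scalar product on each tangent space; it is called weak if the tangent spaces are not (required to be) complete with respect to this scalar product. Write $\|v\|_\gamma=\sqrt{\gamma(v,v)}$. Paths are piecewise continuously differentiable, and the length of a path $\eta$ on $[0,1]$ is $L(\eta)=\int_0^1\|\eta'(s)\|_\gamma\,ds$. A path $\eta$ is a reparametrization of $\alpha$ if $\eta=\alpha\circ\varphi$ with $\varphi:[0,1]\to[0,1]$ nondecreasing and surjective. Geodesics are those of the Levi-Civita connection of $\gamma$ (whose existence is understood as part of the existence of the exponential mapping). The exponential mapping $\exp_x$ sends $v\in T_xN$ to $c_v(1)$, where $c_v$ is the geodesic with $c_v(0)=x$, $c_v'(0)=v$; thus $\exp_x(tv)=c_v(t)$. $(N,\gamma)$ is called normalizable at $x$ if there are neighborhoods $U_x\subseteq T_xN$ of $0$ and $V_x\subseteq N$ of $x$, open in the manifold topologies (not necessarily in the topology induced by $\gamma$), such that (1) $U_x$ is convex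 and (2) the exponential mapping $\exp_x$ exists and is a $C^1$-diffeomorphism between $U_x$ and $V_x$. Here $\exp_x^{-1}$ denotes the inverse of $\exp_x|_{U_x}:U_x\to V_x$. *)

theory Defs
  imports "HOL-Analysis.Analysis" "HOL-Library.Function_Algebras"
begin

section \<open>Frechet spaces\<close>

text \<open>
  A Frechet space is a locally convex topological vector space whose topology is given by
  some complete translation-invariant metric.  The particular metric plays no role below; only
  the topology and the vector space structure are used.
\<close>

class frechet_space = real_vector + complete_space +
  assumes dist_translation: "dist (x + z) (y + z) = dist x y"
    and continuous_scaleR: "0 < e \<Longrightarrow>
      \<exists>d>0. \<forall>s y. \<bar>s - r\<bar> < d \<and> dist y x < d \<longrightarrow> dist (s *\<^sub>R y) (r *\<^sub>R x) < e"
    and locally_convex: "0 < e \<Longrightarrow>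
      \<exists>W. open W \<and> 0 \<in> W \<and> (\<forall>x\<in>W. dist 0 x < e) \<and>
        (\<forall>x\<in>W. \<forall>y\<in>W. \<forall>s\<ge>0. \<forall>t\<ge>0. s + t = 1 \<longrightarrow> s *\<^sub>R x + t *\<^sub>R y \<in> W)"

text \<open>In particular, all Banach spaces and hence all Hilbert spaces are covered.\<close>

instance banach \<subseteq> frechet_space
proof
  fix x y z :: 'a
  show "dist (x + z) (y + z) = dist x y"
    by simp
next
  fix e r :: real and x :: 'a
  assume "0 < e"
  have "isCont (\<lambda>p :: real \<times> 'a. fst p *\<^sub>R snd p) (r, x)"
    by (intro continuous_intros)
  then obtain d where "d > 0" and
    d: "\<And>p. dist p (r, x) < d \<Longrightarrow> dist (fst p *\<^sub>R snd p) (r *\<^sub>R x) < e"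
    using \<open>0 < e\<close> unfolding continuous_at_eps_delta by (metis fst_conv snd_conv)
  show "\<exists>d>0. \<forall>s y. \<bar>s - r\<bar> < d \<and> dist y x < d \<longrightarrow> dist (s *\<^sub>R y) (r *\<^sub>R x) < e"
  proof (intro exI[of _ "d / 2"] conjI allI impI)
    show "d / 2 > 0" using \<open>d > 0\<close> by simp
    fix s and y :: 'a
    assume "\<bar>s - r\<bar> < d / 2 \<and> dist y x < d / 2"
    moreover have "dist (s, y) (r, x) \<le> \<bar>s - r\<bar> + dist y x"
      using sqrt_sum_squares_le_sum_abs[of "dist s r" "dist y x"]
      by (simp add: dist_Pair_Pair dist_real_def)
    ultimately have "dist (s, y) (r, x) < d" by linarith
    then show "dist (s *\<^sub>R y) (r *\<^sub>R x) < e" using d by force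
  qed
next
  fix e :: real
  assume "0 < e"
  then show "\<exists>W. open W \<and> (0 :: 'a) \<in> W \<and> (\<forall>x\<in>W. dist 0 x < e) \<and>
      (\<forall>x\<in>W. \<forall>y\<in>W. \<forall>s\<ge>0. \<forall>t\<ge>0. s + t = 1 \<longrightarrow> s *\<^sub>R x + t *\<^sub>R y \<in> W)"
    using convex_ball[of "0 :: 'a" e] unfolding convex_def
    by (intro exI[of _ "ball 0 e"]) auto
qed

instantiation "fun" :: (type, real_vector) real_vector
begin

definition scaleR_fun :: "real \<Rightarrow> ('a \<Rightarrow> 'b) \<Rightarrow> 'a \<Rightarrow> 'b"
  where "scaleR_fun r f = (\<lambda>x. r *\<^sub>R f x)"

instance
  by standard (simp_all add: scaleR_fun_def plus_fun_def fun_eq_iff algebra_simps)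

end

section \<open>Differential calculus in topological vector spaces\<close>

definition dir_quotient ::
    "('a::real_vector \<Rightarrow> 'b::real_vector) \<Rightarrow> 'a \<Rightarrow> 'a \<Rightarrow> real \<Rightarrow> 'b"
  where "dir_quotient f x h t = (1 / t) *\<^sub>R (f (x + t *\<^sub>R h) - f x)"

definition dir_deriv ::
    "('a::real_vector \<Rightarrow> 'b::{real_vector,t2_space}) \<Rightarrow> 'a \<Rightarrow> 'a \<Rightarrow> 'b"
  where "dir_deriv f x h = Lim (at 0) (dir_quotient f x h)"

definition dir_differentiable ::
    "('a::real_vector \<Rightarrow> 'b::{real_vector,t2_space}) \<Rightarrow> 'a \<Rightarrow> 'a \<Rightarrow> bool"
  where "dir_differentiable f x h \<longleftrightarrow> (\<exists>l. (dir_quotient f x h \<longlongrightarrow> l) (at 0))"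

text \<open>
  \<open>iter_deriv k f x h\<close> is the iterated directional derivative
  $D^k f(x)\{h_0, \dots, h_{k-1}\}$.  The directions are passed as a sequence, of which only the
  first \<open>k\<close> entries matter, so that all orders live in the same type.
\<close>

primrec iter_deriv ::
    "nat \<Rightarrow> ('a::real_vector \<Rightarrow> 'b::{real_vector,t2_space}) \<Rightarrow> 'a \<Rightarrow> (nat \<Rightarrow> 'a) \<Rightarrow> 'b"
  where
    "iter_deriv 0 f x h = f x"
  | "iter_deriv (Suc k) f x h = dir_deriv (\<lambda>y. iter_deriv k f y h) x (h k)"

text \<open>
  \<open>C\<^sup>n\<close> maps on an open set in the usual sense for Frechet spaces (Michal, Bastiani, Hamilton):
  all directional derivatives up to order \<open>n\<close> exist and are jointly continuous in the point and
  the directions.  The type of sequences carries the product topology, hence continuity of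
  \<open>iter_deriv k f\<close> is continuity in \<open>(x, h 0, \<dots>, h (k - 1))\<close>.
\<close>

definition C_k_on ::
    "nat \<Rightarrow> 'a::{real_vector,topological_space} set \<Rightarrow> ('a \<Rightarrow> 'b::{real_vector,t2_space}) \<Rightarrow> bool"
  where "C_k_on n S f \<longleftrightarrow>
    (\<forall>k<n. \<forall>x\<in>S. \<forall>h. dir_differentiable (\<lambda>y. iter_deriv k f y h) x (h k)) \<and>
    (\<forall>k\<le>n. continuous_on (S \<times> UNIV) (\<lambda>(x, h). iter_deriv k f x h))"

definition smooth_on ::
    "'a::{real_vector,topological_space} set \<Rightarrow> ('a \<Rightarrow> 'b::{real_vector,t2_space}) \<Rightarrow> bool"
  where "smooth_on S f \<longleftrightarrow> (\<forall>n. C_k_on n S f)"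

definition curve_quotient :: "(real \<Rightarrow> 'a::real_vector) \<Rightarrow> real \<Rightarrow> real \<Rightarrow> 'a"
  where "curve_quotient f t s = (1 / (s - t)) *\<^sub>R (f s - f t)"

definition has_curve_deriv ::
    "(real \<Rightarrow> 'a::{real_vector,topological_space}) \<Rightarrow> 'a \<Rightarrow> real \<Rightarrow> real set \<Rightarrow> bool"
  where "has_curve_deriv f d t S \<longleftrightarrow> (curve_quotient f t \<longlongrightarrow> d) (at t within S)"

section \<open>Manifolds and tangent spaces\<close>

text \<open>A chart is a domain together with a coordinate map, relevant only on the domain.\<close>

type_synonym ('m, 'e) chart = "'m set \<times> ('m \<Rightarrow> 'e)"

definition is_chart :: "('m::topological_space, 'e::topological_space) chart \<Rightarrow> bool"
  where "is_chart c \<longleftrightarrow> open (fst c) \<and> open (snd c ` fst c) \<and>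
    homeomorphism (fst c) (snd c ` fst c) (snd c) (inv_into (fst c) (snd c))"

definition transition :: "('m, 'e) chart \<Rightarrow> ('m, 'e) chart \<Rightarrow> 'e \<Rightarrow> 'e"
  where "transition c d = snd d \<circ> inv_into (fst c) (snd c)"

definition frechet_manifold :: "('m::t2_space, 'e::frechet_space) chart set \<Rightarrow> bool"
  where "frechet_manifold A \<longleftrightarrow>
    (\<forall>c\<in>A. is_chart c) \<and> \<Union> (fst ` A) = UNIV \<and>
    (\<forall>c\<in>A. \<forall>d\<in>A. smooth_on (snd c ` (fst c \<inter> fst d)) (transition c d))"

definition charts_at :: "('m, 'e) chart set \<Rightarrow> 'm \<Rightarrow> ('m, 'e) chart set"
  where "charts_at A p = {c \<in> A. p \<in> fst c}"

text \<open>
  A tangent vector at \<open>p\<close> is the family of its coordinates in all charts around \<open>p\<close>, transforming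
  with the differentials of the coordinate changes (and set to \<open>0\<close> at all other arguments).
  With pointwise operations and the product topology, evaluation at any chart around \<open>p\<close> is a
  linear homeomorphism from the tangent space onto the model space.
\<close>

type_synonym ('m, 'e) tvec = "('m, 'e) chart \<Rightarrow> 'e"

definition tangent_space ::
    "('m, 'e::frechet_space) chart set \<Rightarrow> 'm \<Rightarrow> ('m, 'e) tvec set"
  where "tangent_space A p =
    {v. (\<forall>c\<in>charts_at A p. \<forall>d\<in>charts_at A p.
           v d = dir_deriv (transition c d) (snd c p) (v c)) \<and>
        (\<forall>c. c \<notin> charts_at A p \<longrightarrow> v c = 0)}"

text \<open>The tangent vector at \<open>p\<close> whose coordinate in the chart \<open>c\<close> is \<open>a\<close>.\<close>

definition tangent_of ::
    "('m, 'e::frechet_space) chart set \<Rightarrow> ('m, 'e) chart \<Rightarrow> 'm \<Rightarrow> 'e \<Rightarrow> ('m, 'e) tvec"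
  where "tangent_of A c p a =
    (\<lambda>d. if d \<in> charts_at A p then dir_deriv (transition c d) (snd c p) a else 0)"

section \<open>Weak Riemannian metrics\<close>

type_synonym ('m, 'e) tensor2 = "'m \<Rightarrow> ('m, 'e) tvec \<Rightarrow> ('m, 'e) tvec \<Rightarrow> real"

definition local_metric ::
    "('m, 'e::frechet_space) chart set \<Rightarrow> ('m, 'e) tensor2 \<Rightarrow> ('m, 'e) chart \<Rightarrow>
     'e \<Rightarrow> 'e \<Rightarrow> 'e \<Rightarrow> real"
  where "local_metric A \<gamma> c z a b =
    (let p = inv_into (fst c) (snd c) z in \<gamma> p (tangent_of A c p a) (tangent_of A c p b))"

definition scalar_product_on :: "'v::{real_vector,topological_space} set \<Rightarrow> ('v \<Rightarrow> 'v \<Rightarrow> real) \<Rightarrow> bool"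
  where "scalar_product_on T g \<longleftrightarrow>
    (\<forall>u\<in>T. \<forall>v\<in>T. \<forall>w\<in>T. g (u + v) w = g u w + g v w) \<and>
    (\<forall>r. \<forall>v\<in>T. \<forall>w\<in>T. g (r *\<^sub>R v) w = r * g v w) \<and>
    (\<forall>v\<in>T. \<forall>w\<in>T. g v w = g w v) \<and>
    (\<forall>v\<in>T. v \<noteq> 0 \<longrightarrow> 0 < g v v) \<and>
    continuous_on (T \<times> T) (\<lambda>(v, w). g v w)"

definition weak_riemannian_metric ::
    "('m, 'e::frechet_space) chart set \<Rightarrow> ('m, 'e) tensor2 \<Rightarrow> bool"
  where "weak_riemannian_metric A \<gamma> \<longleftrightarrow>
    (\<forall>p. scalar_product_on (tangent_space A p) (\<gamma> p)) \<and>
    (\<forall>c\<in>A. smooth_on ((snd c ` fst c) \<times> UNIV \<times> UNIV)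
       (\<lambda>(z, a, b). local_metric A \<gamma> c z a b))"

definition weak_riemannian_manifold ::
    "('m::t2_space, 'e::frechet_space) chart set \<Rightarrow> ('m, 'e) tensor2 \<Rightarrow> bool"
  where "weak_riemannian_manifold A \<gamma> \<longleftrightarrow> frechet_manifold A \<and> weak_riemannian_metric A \<gamma>"

definition metric_norm :: "('m, 'e) tensor2 \<Rightarrow> 'm \<Rightarrow> ('m, 'e) tvec \<Rightarrow> real"
  where "metric_norm \<gamma> p v = sqrt (\<gamma> p v v)"

section \<open>The Levi-Civita connection, geodesics and the exponential mapping\<close>

text \<open>
  On infinite-dimensional manifolds a linear connection is given by its local Christoffel maps
  \<open>\<Gamma> c\<close>, the covariant derivative being locally
  $\nabla_X Y = DY\{X\} + \Gamma_c(X, Y)$.  The last condition is the resulting transformation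
  rule under the coordinate change \<open>\<tau>\<close>.
\<close>

type_synonym ('m, 'e) christoffel = "('m, 'e) chart \<Rightarrow> 'e \<Rightarrow> 'e \<Rightarrow> 'e \<Rightarrow> 'e"

definition connection ::
    "('m, 'e::frechet_space) chart set \<Rightarrow> ('m, 'e) christoffel \<Rightarrow> bool"
  where "connection A \<Gamma> \<longleftrightarrow>
    (\<forall>c\<in>A. smooth_on ((snd c ` fst c) \<times> UNIV \<times> UNIV) (\<lambda>(z, a, b). \<Gamma> c z a b) \<and>
       (\<forall>z \<in> snd c ` fst c. bilinear (\<Gamma> c z))) \<and>
    (\<forall>c\<in>A. \<forall>d\<in>A. \<forall>z \<in> snd c ` (fst c \<inter> fst d). \<forall>a b.
       (let \<tau> = transition c d in
        dir_deriv \<tau> z (\<Gamma> c z a b) =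
          \<Gamma> d (\<tau> z) (dir_deriv \<tau> z a) (dir_deriv \<tau> z b)
          + dir_deriv (\<lambda>y. dir_deriv \<tau> y b) z a))"

definition torsion_free ::
    "('m, 'e::frechet_space) chart set \<Rightarrow> ('m, 'e) christoffel \<Rightarrow> bool"
  where "torsion_free A \<Gamma> \<longleftrightarrow>
    (\<forall>c\<in>A. \<forall>z \<in> snd c ` fst c. \<forall>a b. \<Gamma> c z a b = \<Gamma> c z b a)"

text \<open>
  The condition $X\,\gamma(Y, Z) = \gamma(\nabla_X Y, Z) + \gamma(Y, \nabla_X Z)$, evaluated on
  vector fields \<open>Y\<close>, \<open>Z\<close> that are constant in a chart.
\<close>

definition metric_compatible ::
    "('m, 'e::frechet_space) chart set \<Rightarrow> ('m, 'e) tensor2 \<Rightarrow> ('m, 'e) christoffel \<Rightarrow> bool"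
  where "metric_compatible A \<gamma> \<Gamma> \<longleftrightarrow>
    (\<forall>c\<in>A. \<forall>z \<in> snd c ` fst c. \<forall>k a b.
       dir_deriv (\<lambda>y. local_metric A \<gamma> c y a b) z k =
         local_metric A \<gamma> c z (\<Gamma> c z k a) b + local_metric A \<gamma> c z a (\<Gamma> c z k b))"

definition levi_civita ::
    "('m, 'e::frechet_space) chart set \<Rightarrow> ('m, 'e) tensor2 \<Rightarrow> ('m, 'e) christoffel \<Rightarrow> bool"
  where "levi_civita A \<gamma> \<Gamma> \<longleftrightarrow>
    connection A \<Gamma> \<and> torsion_free A \<Gamma> \<and> metric_compatible A \<gamma> \<Gamma>"

text \<open>
  A weak metric need not admit a Levi-Civita connection; if it does, then the connection is
  unique on the chart domains by the Koszul formula, so that the existential quantifier below is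
  unambiguous.  The differential equation is $\nabla_{c'} c' = 0$ in coordinates.
\<close>

definition geodesic ::
    "('m::t2_space, 'e::frechet_space) chart set \<Rightarrow> ('m, 'e) tensor2 \<Rightarrow> (real \<Rightarrow> 'm) \<Rightarrow> bool"
  where "geodesic A \<gamma> c \<longleftrightarrow> continuous_on {0..1} c \<and>
    (\<exists>\<Gamma>. levi_civita A \<gamma> \<Gamma> \<and>
      (\<forall>d\<in>A. \<exists>u'. \<forall>t\<in>{0..1}. c t \<in> fst d \<longrightarrow>
         has_curve_deriv (snd d \<circ> c) (u' t) t {0..1} \<and>
         has_curve_deriv u' (- \<Gamma> d (snd d (c t)) (u' t) (u' t)) t {0..1}))"

definition velocity ::
    "('m, 'e::frechet_space) chart set \<Rightarrow> (real \<Rightarrow> 'm) \<Rightarrow> real \<Rightarrow> ('m, 'e) tvec"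
  where "velocity A c t =
    (\<lambda>d. if d \<in> charts_at A (c t)
         then Lim (at t within {0..1}) (curve_quotient (snd d \<circ> c) t) else 0)"

definition geodesic_from ::
    "('m::t2_space, 'e::frechet_space) chart set \<Rightarrow> ('m, 'e) tensor2 \<Rightarrow>
     'm \<Rightarrow> ('m, 'e) tvec \<Rightarrow> (real \<Rightarrow> 'm) \<Rightarrow> bool"
  where "geodesic_from A \<gamma> x v c \<longleftrightarrow> geodesic A \<gamma> c \<and> c 0 = x \<and> velocity A c 0 = v"

text \<open>
  In Frechet spaces neither existence nor uniqueness of solutions of ordinary differential
  equations is automatic, so both are part of the existence of the exponential mapping.
\<close>

definition exp_exists ::
    "('m::t2_space, 'e::frechet_space) chart set \<Rightarrow> ('m, 'e) tensor2 \<Rightarrow>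
     'm \<Rightarrow> ('m, 'e) tvec \<Rightarrow> bool"
  where "exp_exists A \<gamma> x v \<longleftrightarrow>
    (\<exists>c. geodesic_from A \<gamma> x v c) \<and>
    (\<forall>c c'. geodesic_from A \<gamma> x v c \<and> geodesic_from A \<gamma> x v c' \<longrightarrow> (\<forall>t\<in>{0..1}. c t = c' t))"

definition exp_map ::
    "('m::t2_space, 'e::frechet_space) chart set \<Rightarrow> ('m, 'e) tensor2 \<Rightarrow>
     'm \<Rightarrow> ('m, 'e) tvec \<Rightarrow> 'm"
  where "exp_map A \<gamma> x v = (THE y. \<exists>c. geodesic_from A \<gamma> x v c \<and> c 1 = y)"

section \<open>Normalizability\<close>

text \<open>
  \<open>U\<close> is an open subset of the tangent space at \<open>x\<close> and \<open>V\<close> an open subset of the manifold.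
  The tangent space is read in a chart \<open>c\<close> around \<open>x\<close>, the manifold in a chart \<open>d\<close>.
\<close>

definition C1_diffeomorphism ::
    "('m::t2_space, 'e::frechet_space) chart set \<Rightarrow> 'm \<Rightarrow>
     ('m, 'e) tvec set \<Rightarrow> 'm set \<Rightarrow> (('m, 'e) tvec \<Rightarrow> 'm) \<Rightarrow> bool"
  where "C1_diffeomorphism A x U V f \<longleftrightarrow>
    homeomorphism U V f (the_inv_into U f) \<and>
    (\<forall>c\<in>charts_at A x. \<forall>d\<in>A.
       C_k_on 1 {a. tangent_of A c x a \<in> U \<and> f (tangent_of A c x a) \<in> fst d}
         (\<lambda>a. snd d (f (tangent_of A c x a))) \<and>
       C_k_on 1 (snd d ` (V \<inter> fst d))
         (\<lambda>z. the_inv_into U f (inv_into (fst d) (snd d) z) c))"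

definition normalizable_at ::
    "('m::t2_space, 'e::frechet_space) chart set \<Rightarrow> ('m, 'e) tensor2 \<Rightarrow> 'm \<Rightarrow>
     ('m, 'e) tvec set \<Rightarrow> 'm set \<Rightarrow> bool"
  where "normalizable_at A \<gamma> x U V \<longleftrightarrow>
    openin (top_of_set (tangent_space A x)) U \<and> 0 \<in> U \<and>
    open V \<and> x \<in> V \<and>
    convex U \<and>
    (\<forall>v\<in>U. exp_exists A \<gamma> x v) \<and>
    C1_diffeomorphism A x U V (exp_map A \<gamma> x)"

section \<open>Paths and lengths\<close>

definition C1_curve ::
    "('m, 'e::frechet_space) chart set \<Rightarrow> real \<Rightarrow> real \<Rightarrow> (real \<Rightarrow> 'm) \<Rightarrow> bool"
  where "C1_curve A a b \<eta> \<longleftrightarrow>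
    (\<forall>d\<in>A. \<exists>u'. continuous_on {t \<in> {a..b}. \<eta> t \<in> fst d} u' \<and>
       (\<forall>t\<in>{a..b}. \<eta> t \<in> fst d \<longrightarrow> has_curve_deriv (snd d \<circ> \<eta>) (u' t) t {a..b}))"

definition piecewise_C1_path ::
    "('m::t2_space, 'e::frechet_space) chart set \<Rightarrow> (real \<Rightarrow> 'm) \<Rightarrow> bool"
  where "piecewise_C1_path A \<eta> \<longleftrightarrow> path \<eta> \<and>
    (\<exists>n \<tau>. \<tau> 0 = 0 \<and> \<tau> n = 1 \<and>
       (\<forall>i<n. \<tau> i < \<tau> (Suc i) \<and> C1_curve A (\<tau> i) (\<tau> (Suc i)) \<eta>))"

text \<open>The integrand may be meaningless at the finitely many break points of the path.\<close>

definition path_length ::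
    "('m, 'e::frechet_space) chart set \<Rightarrow> ('m, 'e) tensor2 \<Rightarrow> (real \<Rightarrow> 'm) \<Rightarrow> real"
  where "path_length A \<gamma> \<eta> = integral {0..1} (\<lambda>s. metric_norm \<gamma> (\<eta> s) (velocity A \<eta> s))"

definition paths_in ::
    "('m::t2_space, 'e::frechet_space) chart set \<Rightarrow> 'm set \<Rightarrow> 'm \<Rightarrow> 'm \<Rightarrow> (real \<Rightarrow> 'm) set"
  where "paths_in A V x y =
    {\<eta>. piecewise_C1_path A \<eta> \<and> path_image \<eta> \<subseteq> V \<and> pathstart \<eta> = x \<and> pathfinish \<eta> = y}"

definition minimal_path ::
    "('m::t2_space, 'e::frechet_space) chart set \<Rightarrow> ('m, 'e) tensor2 \<Rightarrow> 'm set \<Rightarrow> 'm \<Rightarrow> 'm \<Rightarrow>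
     (real \<Rightarrow> 'm) \<Rightarrow> bool"
  where "minimal_path A \<gamma> V x y \<eta> \<longleftrightarrow>
    \<eta> \<in> paths_in A V x y \<and>
    (\<forall>\<zeta>\<in>paths_in A V x y. path_length A \<gamma> \<eta> \<le> path_length A \<gamma> \<zeta>)"

definition reparametrization :: "(real \<Rightarrow> 'm) \<Rightarrow> (real \<Rightarrow> 'm) \<Rightarrow> bool"
  where "reparametrization \<eta> \<alpha> \<longleftrightarrow>
    (\<exists>\<phi>. mono_on {0..1} \<phi> \<and> \<phi> ` {0..1} = {0..1} \<and> (\<forall>t\<in>{0..1}. \<eta> t = \<alpha> (\<phi> t)))"

end

theory Submission
  imports Defs
begin

text \<open>
  In normal coordinates around \<open>x\<close>, the Gauss lemma says that the radial vector at \<open>exp\<^sub>x w\<close> pairs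
  with the derivative of \<open>exp\<^sub>x \<circ> w\<close> to \<open>\<gamma>\<^sub>x(w, w')\<close>.  By Cauchy-Schwarz the radius
  \<open>\<parallel>w\<parallel>\<close> of a path therefore grows at most at the speed of the path, so the path is at least as long
  as the radius of its end point, which is the length of the radial geodesic.  In the case of
  equality \<open>w'\<close> is a multiple of \<open>w\<close>, and the path runs monotonically along the ray.
  As \<open>exp\<^sub>x\<close> is only \<open>C\<^sup>1\<close>, the Gauss lemma is proved by comparing finitely distant rays; the
  error term of second order has a sign, and varying the ray in both directions gives equality.
\<close>

section \<open>Differential calculus in Frechet spaces\<close>

text \<open>The model space has no norm, and the scalar products of \<gamma> do not control its
  topology: a sequence may be small for \<gamma> without converging. Hence limits and mean values
  are taken in the topology of the model space, where convex open sets replace norm balls, and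
  \<gamma> is used only through bilinear algebra, positivity and its differentiability in charts.
  Differential equations cannot be solved in general either; that rays are geodesics rests on the
  uniqueness contained in \<open>exp_exists\<close>. The radius need not be differentiable where the
  path meets x, and a path may return there, so \<open>sqrt (r\<^sup>2 + e)\<close> is
  differentiated instead and e tends to 0. For a minimal path the radius is an indefinite integral
  of the speed, which makes it differentiable outside finitely many break points.\<close>

lemma dist_add_frechet:
  fixes x y x' y' :: "'a::frechet_space"
  shows "dist (x + y) (x' + y') \<le> dist x x' + dist y y'"
proof -
  have "dist (x + y) (x' + y') \<le> dist (x + y) (x' + y) + dist (x' + y) (x' + y')"
    by (rule dist_triangle)
  also have "dist (x' + y) (x' + y') = dist y y'"
    using dist_translation[of y x' y'] by (simp add: add.commute)
  finally show ?thesis by (simp add: dist_translation)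
qed

lemma dist_uminus_frechet:
  fixes x y :: "'a::frechet_space"
  shows "dist (- x) (- y) = dist x y"
  using dist_translation[of "- x" "x + y" "- y"] by (simp add: dist_commute)

instance frechet_space \<subseteq> topological_ab_group_add
proof
  fix a b :: 'a
  show "((\<lambda>p. fst p + snd p) \<longlongrightarrow> a + b) (nhds a \<times>\<^sub>F nhds b)"
  proof (rule metric_tendsto_imp_tendsto)
    have "((\<lambda>p. dist (fst p) a + dist (snd p) b) \<longlongrightarrow> dist a a + dist b b) (nhds a \<times>\<^sub>F nhds b)"
      by (intro tendsto_intros filterlim_fst filterlim_snd)
    then show "((\<lambda>p. dist (fst p) a + dist (snd p) b) \<longlongrightarrow> 0) (nhds a \<times>\<^sub>F nhds b)"
      by simp
    show "\<forall>\<^sub>F p in nhds a \<times>\<^sub>F nhds b. dist (fst p + snd p) (a + b) \<le> dist (dist (fst p) a + dist (snd p) b) 0"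
      by (simp add: dist_add_frechet)
  qed
  show "(uminus \<longlongrightarrow> - a) (nhds a)"
  proof (rule metric_tendsto_imp_tendsto)
    show "((\<lambda>x. x) \<longlongrightarrow> a) (nhds a)" by (rule filterlim_ident)
  qed (simp add: dist_uminus_frechet)
qed

lemma tendsto_scaleR_frechet [tendsto_intros]:
  fixes f :: "'i \<Rightarrow> 'a::frechet_space"
  assumes "(r \<longlongrightarrow> r0) F" "(f \<longlongrightarrow> x0) F"
  shows "((\<lambda>i. r i *\<^sub>R f i) \<longlongrightarrow> r0 *\<^sub>R x0) F"
proof (rule tendstoI)
  fix e :: real assume "0 < e"
  then obtain d where "d > 0" and d: "\<And>s y. \<bar>s - r0\<bar> < d \<Longrightarrow> dist y x0 < d \<Longrightarrow> dist (s *\<^sub>R y) (r0 *\<^sub>R x0) < e"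
    using continuous_scaleR by blast
  show "\<forall>\<^sub>F i in F. dist (r i *\<^sub>R f i) (r0 *\<^sub>R x0) < e"
    using tendstoD[OF assms(1) \<open>d > 0\<close>] tendstoD[OF assms(2) \<open>d > 0\<close>]
    by eventually_elim (simp add: d dist_real_def)
qed

instance prod :: (topological_monoid_add, topological_monoid_add) topological_monoid_add
proof
  fix a b :: "'a \<times> 'b"
  have 1: "((\<lambda>x. fst (fst x)) \<longlongrightarrow> fst a) (nhds a \<times>\<^sub>F nhds b)" "((\<lambda>x. snd (fst x)) \<longlongrightarrow> snd a) (nhds a \<times>\<^sub>F nhds b)"
    "((\<lambda>x. fst (snd x)) \<longlongrightarrow> fst b) (nhds a \<times>\<^sub>F nhds b)" "((\<lambda>x. snd (snd x)) \<longlongrightarrow> snd b) (nhds a \<times>\<^sub>F nhds b)"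
    by (intro tendsto_intros filterlim_fst filterlim_snd)+
  have "((\<lambda>x. (fst (fst x) + fst (snd x), snd (fst x) + snd (snd x))) \<longlongrightarrow>
      (fst a + fst b, snd a + snd b)) (nhds a \<times>\<^sub>F nhds b)"
    by (intro tendsto_Pair tendsto_add 1)
  then show "((\<lambda>x. fst x + snd x) \<longlongrightarrow> a + b) (nhds a \<times>\<^sub>F nhds b)"
    by (simp add: plus_prod_def)
qed

instance prod :: (topological_group_add, topological_group_add) topological_group_add
proof
  fix a :: "'a \<times> 'b"
  have "((\<lambda>x. (- fst x, - snd x)) \<longlongrightarrow> (- fst a, - snd a)) (nhds a)"
    by (intro tendsto_intros filterlim_ident)
  moreover have "uminus = (\<lambda>x :: 'a \<times> 'b. (- fst x, - snd x))"
    by (simp add: fun_eq_iff uminus_prod_def)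
  ultimately show "(uminus \<longlongrightarrow> - a) (nhds a)"
    by (simp add: uminus_prod_def[of a])
qed

instance prod :: (topological_ab_group_add, topological_ab_group_add) topological_ab_group_add ..

text \<open>In a chart the metric is a function of a point and two vectors. Since products are again
  Frechet spaces, the calculus below applies to it jointly in all three arguments.\<close>

instance prod :: (frechet_space, frechet_space) frechet_space
proof
  fix x y z :: "'a \<times> 'b"
  show "dist (x + z) (y + z) = dist x y"
    by (simp add: dist_prod_def dist_translation)
next
  fix e r :: real and x :: "'a \<times> 'b"
  assume "0 < e"
  have "((\<lambda>p. (fst p *\<^sub>R fst (snd p), fst p *\<^sub>R snd (snd p))) \<longlongrightarrow> (r *\<^sub>R fst x, r *\<^sub>R snd x)) (nhds r \<times>\<^sub>F nhds x)"
    by (intro tendsto_intros filterlim_fst filterlim_snd)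
  then have "\<forall>\<^sub>F p in nhds r \<times>\<^sub>F nhds x. dist (fst p *\<^sub>R snd p) (r *\<^sub>R x) < e"
    using \<open>0 < e\<close> by (auto simp: scaleR_prod_def dest: tendstoD)
  then obtain P Q where P: "eventually P (nhds r)" and Q: "eventually Q (nhds x)"
    and PQ: "\<And>s y. P s \<Longrightarrow> Q y \<Longrightarrow> dist (s *\<^sub>R y) (r *\<^sub>R x) < e"
    unfolding eventually_prod_filter by auto
  obtain d1 where d1: "d1 > 0" "\<And>s. dist s r < d1 \<Longrightarrow> P s"
    using P unfolding eventually_nhds_metric by blast
  obtain d2 where d2: "d2 > 0" "\<And>y. dist y x < d2 \<Longrightarrow> Q y"
    using Q unfolding eventually_nhds_metric by blast
  show "\<exists>d>0. \<forall>s y. \<bar>s - r\<bar> < d \<and> dist y x < d \<longrightarrow> dist (s *\<^sub>R y) (r *\<^sub>R x) < e"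
    using d1 d2 PQ by (intro exI[of _ "min d1 d2"]) (auto simp: dist_real_def)
next
  fix e :: real
  assume "0 < e"
  then obtain V where V: "open V" "0 \<in> V" "\<forall>x\<in>V. dist 0 x < e / 2"
      "\<forall>x\<in>V. \<forall>y\<in>V. \<forall>s\<ge>0. \<forall>t\<ge>0. s + t = 1 \<longrightarrow> s *\<^sub>R x + t *\<^sub>R (y :: 'a) \<in> V"
    using locally_convex[of "e / 2"] by auto
  obtain W where W: "open W" "0 \<in> W" "\<forall>x\<in>W. dist 0 x < e / 2"
      "\<forall>x\<in>W. \<forall>y\<in>W. \<forall>s\<ge>0. \<forall>t\<ge>0. s + t = 1 \<longrightarrow> s *\<^sub>R x + t *\<^sub>R (y :: 'b) \<in> W"
    using locally_convex[of "e / 2"] \<open>0 < e\<close> by auto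
  have "dist 0 p < e" if "p \<in> V \<times> W" for p
  proof -
    have "dist 0 p \<le> dist 0 (fst p) + dist 0 (snd p)"
      using sqrt_sum_squares_le_sum_abs[of "dist 0 (fst p)" "dist 0 (snd p)"]
      by (simp add: dist_prod_def)
    also have "\<dots> < e" using V(3) W(3) that by fastforce
    finally show ?thesis .
  qed
  then show "\<exists>W. open W \<and> (0 :: 'a \<times> 'b) \<in> W \<and> (\<forall>x\<in>W. dist 0 x < e) \<and>
      (\<forall>x\<in>W. \<forall>y\<in>W. \<forall>s\<ge>0. \<forall>t\<ge>0. s + t = 1 \<longrightarrow> s *\<^sub>R x + t *\<^sub>R y \<in> W)"
    using V W by (intro exI[of _ "V \<times> W"] conjI) (auto simp: open_Times zero_prod_def)
qed

text \<open>Local convexity is assumed at 0 only; translation invariance of the distance moves the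
  neighborhood to p.\<close>

lemma convex_nhd:
  fixes p :: "'a::frechet_space"
  assumes "open T" "p \<in> T"
  obtains W where "open W" "convex W" "p \<in> W" "W \<subseteq> T"
proof -
  obtain e where e: "0 < e" "\<And>y. dist y p < e \<Longrightarrow> y \<in> T"
    using assms open_dist by blast
  obtain W where W: "open W" "0 \<in> W" "\<forall>x\<in>W. dist 0 x < e"
      "\<forall>x\<in>W. \<forall>y\<in>W. \<forall>s\<ge>0. \<forall>t\<ge>0. s + t = 1 \<longrightarrow> s *\<^sub>R x + t *\<^sub>R (y :: 'a) \<in> W"
    using locally_convex[OF e(1), where 'a = 'a] by auto
  let ?W = "(\<lambda>x. x - p) -` W"
  have "convex W" using W(4) by (simp add: convex_def)
  show ?thesis
  proof
    show "open ?W"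
      using W(1) by (intro open_vimage continuous_intros)
    show "convex ?W"
      unfolding convex_def
    proof (intro ballI allI impI)
      fix x y and u v :: real
      assume *: "x \<in> ?W" "y \<in> ?W" "0 \<le> u" "0 \<le> v" "u + v = 1"
      then have "u *\<^sub>R (x - p) + v *\<^sub>R (y - p) \<in> W"
        using convexD[OF \<open>convex W\<close>] by simp
      moreover have "u *\<^sub>R (x - p) + v *\<^sub>R (y - p) = u *\<^sub>R x + v *\<^sub>R y - (u + v) *\<^sub>R p"
        by (simp add: algebra_simps)
      ultimately show "u *\<^sub>R x + v *\<^sub>R y \<in> ?W" using * by simp
    qed
    show "p \<in> ?W" using W(2) by simp
    show "?W \<subseteq> T"
    proof
      fix x assume "x \<in> ?W"
      then have "dist 0 (x - p) < e" using W(3) by simp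
      then have "dist x p < e"
        using dist_translation[of 0 p "x - p"] by (simp add: dist_commute)
      then show "x \<in> T" by (rule e(2))
    qed
  qed
qed

text \<open>The mean value inequality, with a convex open set in place of a norm bound.\<close>

lemma curve_deriv_in_convex:
  fixes g :: "real \<Rightarrow> 'a::frechet_space"
  assumes "open W" "convex W"
    and deriv: "\<And>t. t \<in> {0..1} \<Longrightarrow> has_curve_deriv g (g' t) t {0..1} \<and> g' t \<in> W"
  shows "g 1 - g 0 \<in> W"
proof -
  \<comment> \<open>\<open>P a b\<close> says that the mean slope over \<open>{a..b}\<close> lies in
    W. The slope over two adjacent intervals is a convex combination of both slopes, weighted by the
    lengths, so P is additive; differentiability and openness of W give P on short intervals around
    each point.\<close>
  define P where "P a b \<longleftrightarrow> (0 \<le> a \<and> a < b \<and> b \<le> 1 \<longrightarrow> (1 / (b - a)) *\<^sub>R (g b - g a) \<in> W)" for a b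
  have trans: "P a c" if "P a b" "P b c" "a \<le> b" "b \<le> c" for a b c
  proof (cases "a = b \<or> b = c")
    case False
    with that have *: "a < b" "b < c" by auto
    show ?thesis
      unfolding P_def
    proof
      assume ac: "0 \<le> a \<and> a < c \<and> c \<le> 1"
      define q1 where "q1 = (1 / (b - a)) *\<^sub>R (g b - g a)"
      define q2 where "q2 = (1 / (c - b)) *\<^sub>R (g c - g b)"
      have "((b - a) / (c - a)) *\<^sub>R q1 + ((c - b) / (c - a)) *\<^sub>R q2 \<in> W"
        using * ac that unfolding P_def q1_def q2_def
        by (intro convexD[OF assms(2)]) (auto simp: divide_simps)
      also have "((b - a) / (c - a)) *\<^sub>R q1 + ((c - b) / (c - a)) *\<^sub>R q2 = (1 / (c - a)) *\<^sub>R (g c - g a)"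
        using * by (simp add: q1_def q2_def flip: scaleR_add_right)
      finally show "(1 / (c - a)) *\<^sub>R (g c - g a) \<in> W" .
    qed
  qed (use that in auto)
  have "P 0 1"
  proof (rule Bolzano[where P = P])
    fix x :: real
    assume x: "0 \<le> x" "x \<le> 1"
    have "(curve_quotient g x \<longlongrightarrow> g' x) (at x within {0..1})" "g' x \<in> W"
      using deriv[of x] x by (auto simp: has_curve_deriv_def)
    then have "\<forall>\<^sub>F s in at x within {0..1}. curve_quotient g x s \<in> W"
      using assms(1) topological_tendstoD by blast
    then obtain d where d: "d > 0" "\<And>s. s \<in> {0..1} \<Longrightarrow> s \<noteq> x \<Longrightarrow> dist s x < d \<Longrightarrow> curve_quotient g x s \<in> W"
      unfolding eventually_at by auto
    have left: "P a x" if "a \<le> x" "x - a < d" for a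
    proof -
      have "1 / (a - x) = - (1 / (x - a))"
        by (metis minus_diff_eq minus_divide_right)
      then have "(1 / (a - x)) *\<^sub>R (g a - g x) = (1 / (x - a)) *\<^sub>R (g x - g a)"
        by (metis minus_diff_eq scaleR_minus_left scaleR_minus_right)
      then show ?thesis
        using that d(2)[of a] x by (auto simp: P_def curve_quotient_def dist_real_def)
    qed
    have right: "P x b" if "x \<le> b" "b - x < d" for b
      using that d(2)[of b] x by (auto simp: P_def curve_quotient_def dist_real_def)
    show "\<exists>d>0. \<forall>a b. a \<le> x \<and> x \<le> b \<and> b - a < d \<longrightarrow> P a b"
      using d(1) left right trans by (intro exI[of _ d]) (smt (verit, best))
  qed (use trans in auto)
  then show ?thesis by (simp add: P_def)
qed

section \<open>Derivatives of curves\<close>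

lemma has_curve_deriv_tendsto:
  "has_curve_deriv f d t S \<Longrightarrow> (curve_quotient f t \<longlongrightarrow> d) (at t within S)"
  by (simp add: has_curve_deriv_def)

lemma has_curve_deriv_unique:
  fixes f :: "real \<Rightarrow> 'a::{real_vector,t2_space}"
  assumes "has_curve_deriv f d t S" "has_curve_deriv f d' t S" "at t within S \<noteq> bot"
  shows "d = d'"
  using assms tendsto_unique unfolding has_curve_deriv_def by blast

lemma has_curve_deriv_real:
  "has_curve_deriv f d t S \<longleftrightarrow> (f has_real_derivative d) (at t within S)"
  by (simp add: has_curve_deriv_def has_field_derivative_iff curve_quotient_def[abs_def])

lemma has_curve_deriv_cong:
  assumes "\<forall>\<^sub>F s in at t within S. f s = g s" "f t = g t"
  shows "has_curve_deriv f d t S \<longleftrightarrow> has_curve_deriv g d t S"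
proof -
  have "\<forall>\<^sub>F s in at t within S. curve_quotient f t s = curve_quotient g t s"
    using assms(1) by eventually_elim (simp add: curve_quotient_def assms(2))
  then show ?thesis
    unfolding has_curve_deriv_def by (rule tendsto_cong)
qed

lemma has_curve_deriv_continuous:
  fixes f :: "real \<Rightarrow> 'a::frechet_space"
  assumes "has_curve_deriv f d t S"
  shows "(f \<longlongrightarrow> f t) (at t within S)"
proof -
  have "((\<lambda>s. f t + (s - t) *\<^sub>R curve_quotient f t s) \<longlongrightarrow> f t + (t - t) *\<^sub>R d) (at t within S)"
    by (intro tendsto_intros has_curve_deriv_tendsto assms)
  moreover have "\<forall>\<^sub>F s in at t within S. f t + (s - t) *\<^sub>R curve_quotient f t s = f s"
    unfolding eventually_at_filter by (simp add: curve_quotient_def)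
  ultimately show ?thesis
    by (simp add: tendsto_cong)
qed

section \<open>Directional derivatives of C1 maps\<close>

lemma C1_dir_quotient:
  assumes "C_k_on 1 S f" "x \<in> S"
  shows "(dir_quotient f x h \<longlongrightarrow> dir_deriv f x h) (at 0)"
proof -
  have "dir_differentiable f x h"
    using assms by (auto simp: C_k_on_def)
  then show ?thesis
    unfolding dir_differentiable_def dir_deriv_def by (metis tendsto_Lim trivial_limit_at)
qed

lemma C1_continuous_on:
  fixes f :: "'a::{real_vector,topological_space} \<Rightarrow> 'b::{real_vector,t2_space}"
  shows "C_k_on 1 S f \<Longrightarrow> continuous_on S f"
proof -
  assume "C_k_on 1 S f"
  then have "continuous_on (S \<times> UNIV) (\<lambda>(x, h). iter_deriv 0 f x h)"
    unfolding C_k_on_def by blast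
  then have "continuous_on (S \<times> UNIV) (\<lambda>p :: 'a \<times> (nat \<Rightarrow> 'a). f (fst p))"
    by (simp add: case_prod_beta)
  then have "continuous_on S (\<lambda>x. f (fst (x, \<lambda>i :: nat. 0 :: 'a)))"
    by (rule continuous_on_compose2[where f = "\<lambda>x. (x, \<lambda>i. 0)"]) (auto intro!: continuous_intros)
  then show ?thesis by simp
qed

text \<open>In \<open>C_k_on\<close> a single direction is the entry 0 of a sequence; the constant
  sequence depends continuously on it.\<close>

lemma C1_dir_deriv_continuous_on:
  assumes "C_k_on 1 S f"
  shows "continuous_on (S \<times> UNIV) (\<lambda>p. dir_deriv f (fst p) (snd p))"
proof -
  have "continuous_on (S \<times> UNIV) (\<lambda>(x, h). iter_deriv 1 f x h)"
    using assms unfolding C_k_on_def by blast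
  then have "continuous_on (S \<times> UNIV) (\<lambda>p. dir_deriv f (fst p) (snd p (0 :: nat)))"
    by (simp add: case_prod_beta)
  then have "continuous_on (S \<times> UNIV)
      (\<lambda>p. dir_deriv f (fst (fst p, \<lambda>i::nat. snd p)) (snd (fst p, \<lambda>i::nat. snd p) 0))"
    by (rule continuous_on_compose2) (auto intro!: continuous_intros continuous_on_coordinatewise_then_product)
  then show ?thesis by simp
qed

lemma tendsto_C1_dir_deriv:
  fixes f :: "'a::{real_vector,t2_space} \<Rightarrow> 'b::{real_vector,t2_space}"
  assumes "C_k_on 1 S f" "open S" "x0 \<in> S" "(X \<longlongrightarrow> x0) F" "(H \<longlongrightarrow> h0) F"
  shows "((\<lambda>i. dir_deriv f (X i) (H i)) \<longlongrightarrow> dir_deriv f x0 h0) F"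
proof -
  have "isCont (\<lambda>p. dir_deriv f (fst p) (snd p)) (x0, h0)"
    using C1_dir_deriv_continuous_on[OF assms(1)] assms(2,3)
    by (simp add: continuous_on_eq_continuous_at open_Times)
  then have "((\<lambda>i. dir_deriv f (fst (X i, H i)) (snd (X i, H i))) \<longlongrightarrow>
      dir_deriv f (fst (x0, h0)) (snd (x0, h0))) F"
    by (rule isCont_tendsto_compose) (intro tendsto_intros assms)
  then show ?thesis by simp
qed

lemma tendsto_C1:
  fixes f :: "'a::{real_vector,t2_space} \<Rightarrow> 'b::{real_vector,t2_space}"
  assumes "C_k_on 1 S f" "open S" "x0 \<in> S" "(X \<longlongrightarrow> x0) F"
  shows "((\<lambda>i. f (X i)) \<longlongrightarrow> f x0) F"
proof -
  have "isCont f x0"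
    using C1_continuous_on[OF assms(1)] assms(2,3) by (simp add: continuous_on_eq_continuous_at)
  then show ?thesis
    using assms(4) by (rule isCont_tendsto_compose)
qed

text \<open>
  Joint continuity of the differential makes the difference quotients converge even when the base
  point and the direction vary; this strict form of differentiability yields the linearity of the
  differential, all chain rules, and the error estimates in the Gauss lemma.
\<close>

lemma tendsto_dir_quotient_strict:
  fixes f :: "'a::frechet_space \<Rightarrow> 'b::frechet_space"
  assumes f: "C_k_on 1 S f" and S: "open S" "x0 \<in> S"
    and X: "(X \<longlongrightarrow> x0) F" and H: "(H \<longlongrightarrow> h0) F" and R: "(R \<longlongrightarrow> 0) F"
    and R0: "\<forall>\<^sub>F i in F. R i \<noteq> (0::real)"
  shows "((\<lambda>i. dir_quotient f (X i) (H i) (R i)) \<longlongrightarrow> dir_deriv f x0 h0) F"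
proof (rule topological_tendstoI)
  fix T assume T: "open T" "dir_deriv f x0 h0 \<in> T"
  then obtain W where W: "open W" "convex W" "dir_deriv f x0 h0 \<in> W" "W \<subseteq> T"
    using convex_nhd by blast
  have "((\<lambda>p. dir_deriv f (fst p) (snd p)) \<longlongrightarrow> dir_deriv f x0 h0) (nhds x0 \<times>\<^sub>F nhds h0)"
    using filterlim_fst filterlim_snd by (intro tendsto_C1_dir_deriv[OF f S])
  then have "\<forall>\<^sub>F p in nhds x0 \<times>\<^sub>F nhds h0. dir_deriv f (fst p) (snd p) \<in> W"
    using W(1,3) by (rule topological_tendstoD)
  then obtain P Q where P: "eventually P (nhds x0)" and Q: "eventually Q (nhds h0)"
    and PQ: "\<And>x h. P x \<Longrightarrow> Q h \<Longrightarrow> dir_deriv f x h \<in> W"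
    unfolding eventually_prod_filter by auto
  have "\<forall>\<^sub>F x in nhds x0. P x \<and> x \<in> S"
    using P eventually_nhds_in_open[OF S] by (rule eventually_conj)
  then obtain e where e: "0 < e" "\<And>x. dist x x0 < e \<Longrightarrow> P x \<and> x \<in> S"
    unfolding eventually_nhds_metric by blast
  \<comment> \<open>Continuity of the scalar multiplication at \<open>(0, h0)\<close>: short
    multiples of directions near h0 are near 0, so the whole segment from \<open>X i\<close> to
    \<open>X i + R i *\<^sub>R H i\<close> stays in the neighborhood of x0.\<close>
  obtain d where d: "0 < d" "\<And>s y. \<bar>s\<bar> < d \<Longrightarrow> dist y h0 < d \<Longrightarrow> dist (s *\<^sub>R y) 0 < e / 2"
    using continuous_scaleR[of "e / 2" 0 h0] e(1) by auto
  have "\<forall>\<^sub>F i in F. dist (X i) x0 < e / 2" "\<forall>\<^sub>F i in F. dist (H i) h0 < d"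
    "\<forall>\<^sub>F i in F. \<bar>R i\<bar> < d" "\<forall>\<^sub>F i in F. Q (H i)"
    using tendstoD[OF X, of "e / 2"] tendstoD[OF H \<open>0 < d\<close>] tendstoD[OF R \<open>0 < d\<close>] e(1) filterlim_iff H Q
    by (auto simp: filterlim_iff)
  then show "\<forall>\<^sub>F i in F. dir_quotient f (X i) (H i) (R i) \<in> T"
    using R0
  proof eventually_elim
    case (elim i)
    let ?x = "\<lambda>\<theta>. X i + (\<theta> * R i) *\<^sub>R H i"
    have x: "P (?x \<theta>) \<and> ?x \<theta> \<in> S" if "\<theta> \<in> {0..1}" for \<theta>
    proof (rule e(2))
      have "\<bar>\<theta> * R i\<bar> < d"
        using that elim(3) by (auto simp: abs_mult intro: le_less_trans[OF mult_left_le_one_le])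
      then have "dist ((\<theta> * R i) *\<^sub>R H i) 0 < e / 2"
        using d(2) elim(2) by blast
      then show "dist (?x \<theta>) x0 < e"
        using dist_add_frechet[of "X i" "(\<theta> * R i) *\<^sub>R H i" x0 0] elim(1) by simp
    qed
    \<comment> \<open>Scaled so that the derivative of g along the segment is the directional
      derivative of f itself, and the increment of g is the quotient in question.\<close>
    define g where "g \<theta> = (1 / R i) *\<^sub>R f (?x \<theta>)" for \<theta>
    have "g 1 - g 0 \<in> W"
    proof (rule curve_deriv_in_convex[OF W(1,2)])
      fix \<theta> :: real assume \<theta>: "\<theta> \<in> {0..1}"
      have lim: "filterlim (\<lambda>s. (s - \<theta>) * R i) (at 0) (at \<theta> within {0..1})"
        unfolding filterlim_at
      proof
        show "((\<lambda>s. (s - \<theta>) * R i) \<longlongrightarrow> 0) (at \<theta> within {0..1})"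
          by (rule tendsto_eq_intros refl | simp)+
        show "\<forall>\<^sub>F s in at \<theta> within {0..1}. (s - \<theta>) * R i \<in> UNIV \<and> (s - \<theta>) * R i \<noteq> 0"
          using elim(5) by (auto simp: eventually_at_filter)
      qed
      have "((\<lambda>s. dir_quotient f (?x \<theta>) (H i) ((s - \<theta>) * R i)) \<longlongrightarrow> dir_deriv f (?x \<theta>) (H i))
          (at \<theta> within {0..1})"
        using C1_dir_quotient[OF f] x[OF \<theta>] by (intro filterlim_compose[OF _ lim]) auto
      moreover have "dir_quotient f (?x \<theta>) (H i) ((s - \<theta>) * R i) = curve_quotient g \<theta> s" for s
      proof -
        have "?x \<theta> + ((s - \<theta>) * R i) *\<^sub>R H i = ?x s"
          by (simp add: left_diff_distrib scaleR_diff_left)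
        then show ?thesis
          by (simp only: dir_quotient_def curve_quotient_def g_def) (simp add: scaleR_diff_right)
      qed
      ultimately show "has_curve_deriv g (dir_deriv f (?x \<theta>) (H i)) \<theta> {0..1} \<and> dir_deriv f (?x \<theta>) (H i) \<in> W"
        using PQ x[OF \<theta>] elim(4) by (simp add: has_curve_deriv_def)
    qed
    also have "g 1 - g 0 = dir_quotient f (X i) (H i) (R i)"
      by (simp add: g_def dir_quotient_def scaleR_diff_right)
    finally show ?case using W(4) by auto
  qed
qed

lemma dir_deriv_scaleR:
  fixes f :: "'a::frechet_space \<Rightarrow> 'b::frechet_space"
  assumes f: "C_k_on 1 S f" "open S" "x \<in> S"
  shows "dir_deriv f x (r *\<^sub>R h) = r *\<^sub>R dir_deriv f x h"
proof (rule tendsto_unique[OF _ C1_dir_quotient[OF f(1,3)]])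
  show "(dir_quotient f x (r *\<^sub>R h) \<longlongrightarrow> r *\<^sub>R dir_deriv f x h) (at 0)"
  proof (cases "r = 0")
    case True
    then show ?thesis by (simp add: dir_quotient_def[abs_def])
  next
    case False
    have "((\<lambda>t. r *\<^sub>R dir_quotient f x h (r * t)) \<longlongrightarrow> r *\<^sub>R dir_deriv f x h) (at 0)"
      using False
      by (intro tendsto_intros tendsto_dir_quotient_strict[OF f])
        (auto intro!: tendsto_eq_intros simp: eventually_at_filter)
    moreover have "r *\<^sub>R dir_quotient f x h (r * t) = dir_quotient f x (r *\<^sub>R h) t" for t
      using False by (simp add: dir_quotient_def mult.commute)
    ultimately show ?thesis by simp
  qed
qed simp

text \<open>The increment along \<open>h + k\<close> is taken in two legs. The second leg starts at
  the moving point \<open>x + t *\<^sub>R h\<close>, which is why the strict form of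
  differentiability is required.\<close>

lemma dir_deriv_add:
  fixes f :: "'a::frechet_space \<Rightarrow> 'b::frechet_space"
  assumes f: "C_k_on 1 S f" "open S" "x \<in> S"
  shows "dir_deriv f x (h + k) = dir_deriv f x h + dir_deriv f x k"
proof (rule tendsto_unique[OF _ C1_dir_quotient[OF f(1,3)]])
  have "((\<lambda>t. dir_quotient f x h t + dir_quotient f (x + t *\<^sub>R h) k t) \<longlongrightarrow>
      dir_deriv f x h + dir_deriv f x k) (at 0)"
    by (intro tendsto_add tendsto_dir_quotient_strict[OF f])
      (auto intro!: tendsto_eq_intros simp: eventually_at_filter)
  moreover have "dir_quotient f x h t + dir_quotient f (x + t *\<^sub>R h) k t = dir_quotient f x (h + k) t" for t
    by (simp add: dir_quotient_def algebra_simps flip: scaleR_add_right)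
  ultimately show "(dir_quotient f x (h + k) \<longlongrightarrow> dir_deriv f x h + dir_deriv f x k) (at 0)"
    by simp
qed simp

lemma linear_dir_deriv:
  fixes f :: "'a::frechet_space \<Rightarrow> 'b::frechet_space"
  assumes "C_k_on 1 S f" "open S" "x \<in> S"
  shows "linear (dir_deriv f x)"
  by (intro linearI dir_deriv_add[OF assms] dir_deriv_scaleR[OF assms])

text \<open>The increment of f along the curve is an increment from the fixed point
  \<open>z t\<close> in the varying direction \<open>curve_quotient z t s\<close>, with step
  \<open>s - t\<close>; the strict form allows the direction to vary.\<close>

lemma has_curve_deriv_compose:
  fixes f :: "'a::frechet_space \<Rightarrow> 'b::frechet_space"
  assumes f: "C_k_on 1 S f" "open S" "z t \<in> S" and z: "has_curve_deriv z d t T"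
  shows "has_curve_deriv (f \<circ> z) (dir_deriv f (z t) d) t T"
proof -
  have "((\<lambda>s. dir_quotient f (z t) (curve_quotient z t s) (s - t)) \<longlongrightarrow> dir_deriv f (z t) d) (at t within T)"
    by (intro tendsto_dir_quotient_strict[OF f] tendsto_const has_curve_deriv_tendsto[OF z])
      (auto intro!: tendsto_eq_intros simp: eventually_at_filter)
  moreover have "\<forall>\<^sub>F s in at t within T.
      dir_quotient f (z t) (curve_quotient z t s) (s - t) = curve_quotient (f \<circ> z) t s"
    by (simp add: eventually_at_filter dir_quotient_def curve_quotient_def)
  ultimately show ?thesis
    unfolding has_curve_deriv_def by (simp add: tendsto_cong)
qed

lemma dir_deriv_eqI:
  fixes f :: "'a::real_vector \<Rightarrow> 'b::{real_vector,t2_space}"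
  assumes "(dir_quotient f x h \<longlongrightarrow> l) (at 0)"
  shows "dir_deriv f x h = l"
  unfolding dir_deriv_def by (rule tendsto_Lim[OF _ assms]) simp

lemma dir_deriv_compose:
  fixes f :: "'a::frechet_space \<Rightarrow> 'b::frechet_space" and g :: "'b \<Rightarrow> 'c::frechet_space"
  assumes f: "C_k_on 1 S f" "x \<in> S" and g: "C_k_on 1 T g" "open T" "f x \<in> T"
  shows "dir_deriv (\<lambda>x. g (f x)) x h = dir_deriv g (f x) (dir_deriv f x h)"
proof (rule dir_deriv_eqI)
  have "((\<lambda>s. dir_quotient g (f x) (dir_quotient f x h s) s) \<longlongrightarrow> dir_deriv g (f x) (dir_deriv f x h)) (at 0)"
    by (intro tendsto_dir_quotient_strict[OF g] tendsto_const C1_dir_quotient[OF f])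
      (auto simp: eventually_at_filter)
  moreover have "\<forall>\<^sub>F s in at 0. dir_quotient g (f x) (dir_quotient f x h s) s = dir_quotient (\<lambda>x. g (f x)) x h s"
    by (simp add: eventually_at_filter dir_quotient_def)
  ultimately show "(dir_quotient (\<lambda>x. g (f x)) x h \<longlongrightarrow> dir_deriv g (f x) (dir_deriv f x h)) (at 0)"
    by (simp add: tendsto_cong)
qed

lemma eventually_add_scaleR_in_open:
  fixes x h :: "'a::frechet_space"
  assumes "open S" "x \<in> S"
  shows "\<forall>\<^sub>F s in at 0. x + s *\<^sub>R h \<in> S"
proof -
  have "((\<lambda>s. x + s *\<^sub>R h) \<longlongrightarrow> x + 0 *\<^sub>R h) (at 0)"
    by (intro tendsto_intros)
  then show ?thesis
    using topological_tendstoD assms by fastforce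
qed

lemma dir_deriv_cong:
  fixes f g :: "'a::frechet_space \<Rightarrow> 'b::{real_vector,t2_space}"
  assumes "open S" "x \<in> S" "\<And>y. y \<in> S \<Longrightarrow> f y = g y"
  shows "dir_deriv f x h = dir_deriv g x h"
  unfolding dir_deriv_def
proof (rule Lim_cong)
  show "\<forall>\<^sub>F s in at 0. dir_quotient f x h s = dir_quotient g x h s"
    using eventually_add_scaleR_in_open[OF assms(1,2), of h]
    by eventually_elim (simp add: dir_quotient_def assms(2,3))
qed simp

section \<open>Charts, tangent vectors and the metric in coordinates\<close>

abbreviation chart_inv :: "('m, 'e) chart \<Rightarrow> 'e \<Rightarrow> 'm"
  where "chart_inv c \<equiv> inv_into (fst c) (snd c)"

text \<open>Unlike \<open>velocity\<close>, which always has some value, this asserts that the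
  derivative exists, in all charts at once. The set S may be one piece of the parameter interval,
  whereas \<open>velocity\<close> is always taken within \<open>{0..1}\<close>.\<close>

definition has_velocity ::
    "('m, 'e::frechet_space) chart set \<Rightarrow> (real \<Rightarrow> 'm) \<Rightarrow> ('m, 'e) tvec \<Rightarrow> real \<Rightarrow> real set \<Rightarrow> bool"
  where "has_velocity A \<eta> v t S \<longleftrightarrow> v \<in> tangent_space A (\<eta> t) \<and>
    (\<forall>d\<in>charts_at A (\<eta> t). has_curve_deriv (snd d \<circ> \<eta>) (v d) t S)"

locale weak_riemannian =
  fixes A :: "('m::t2_space, 'e::frechet_space) chart set" and \<gamma> :: "('m, 'e) tensor2"
  assumes weak_riemannian: "weak_riemannian_manifold A \<gamma>"
begin

lemma frechet_manifold: "frechet_manifold A"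
  and weak_riemannian_metric: "weak_riemannian_metric A \<gamma>"
  using weak_riemannian by (auto simp: weak_riemannian_manifold_def)

lemma chart_exists: obtains c where "c \<in> charts_at A p"
proof -
  have "p \<in> \<Union> (fst ` A)"
    using frechet_manifold by (simp add: frechet_manifold_def)
  then show ?thesis using that by (auto simp: charts_at_def)
qed

lemma is_chart: "c \<in> A \<Longrightarrow> is_chart c"
  using frechet_manifold by (auto simp: frechet_manifold_def)

lemma open_chart: "c \<in> A \<Longrightarrow> open (fst c)"
  using is_chart by (auto simp: is_chart_def)

lemma chart_inv_left [simp]: "c \<in> A \<Longrightarrow> p \<in> fst c \<Longrightarrow> chart_inv c (snd c p) = p"
  using is_chart unfolding is_chart_def by (meson homeomorphism_apply1)

lemma open_chart_image:
  assumes "c \<in> A" "open W"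
  shows "open (snd c ` (W \<inter> fst c))"
proof -
  have "homeomorphism (fst c) (snd c ` fst c) (snd c) (chart_inv c)" "open (snd c ` fst c)"
    using is_chart[OF assms(1)] by (auto simp: is_chart_def)
  moreover have "openin (top_of_set (fst c)) (W \<inter> fst c)"
    using assms(2) by (auto simp: openin_open)
  ultimately show ?thesis
    using homeomorphism_imp_open_map openin_open_trans by blast
qed

lemma open_chart_range: "c \<in> A \<Longrightarrow> open (snd c ` fst c)"
  using is_chart by (auto simp: is_chart_def)

lemma chart_tendsto:
  assumes "c \<in> charts_at A p" "(\<eta> \<longlongrightarrow> p) F"
  shows "((\<lambda>t. snd c (\<eta> t)) \<longlongrightarrow> snd c p) F"
proof -
  have "isCont (snd c) p"
    using assms(1) is_chart open_chart
    by (auto simp: charts_at_def is_chart_def homeomorphism_def continuous_on_eq_continuous_at)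
  then show ?thesis using assms(2) by (rule isCont_tendsto_compose)
qed

lemma eventually_in_chart:
  assumes "c \<in> charts_at A p" "(\<eta> \<longlongrightarrow> p) F"
  shows "\<forall>\<^sub>F t in F. c \<in> charts_at A (\<eta> t)"
  using assms open_chart topological_tendstoD[OF assms(2), of "fst c"] by (auto simp: charts_at_def)

lemma transition_chart [simp]: "c \<in> A \<Longrightarrow> p \<in> fst c \<Longrightarrow> transition c d (snd c p) = snd d p"
  by (simp add: transition_def)

lemma transition_C1:
  assumes "c \<in> A" "d \<in> A"
  shows "C_k_on 1 (snd c ` (fst c \<inter> fst d)) (transition c d)" "open (snd c ` (fst c \<inter> fst d))"
  using assms frechet_manifold open_chart_image[of c "fst d"] open_chart
  by (auto simp: frechet_manifold_def smooth_on_def Int_commute)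

lemma transition_at:
  assumes "c \<in> charts_at A p" "d \<in> charts_at A p"
  shows "C_k_on 1 (snd c ` (fst c \<inter> fst d)) (transition c d)" "open (snd c ` (fst c \<inter> fst d))"
    "snd c p \<in> snd c ` (fst c \<inter> fst d)"
  using assms transition_C1 by (auto simp: charts_at_def)

lemma linear_transition:
  assumes "c \<in> charts_at A p" "d \<in> charts_at A p"
  shows "linear (dir_deriv (transition c d) (snd c p))"
  using linear_dir_deriv transition_at[OF assms] by blast

lemma dir_deriv_transition_same:
  assumes "c \<in> charts_at A p"
  shows "dir_deriv (transition c c) (snd c p) a = a"
proof -
  have c: "c \<in> A" using assms by (simp add: charts_at_def)
  have "dir_deriv (transition c c) (snd c p) a = dir_deriv (\<lambda>z. z) (snd c p) a"
    by (rule dir_deriv_cong[OF transition_at(2,3)[OF assms assms]]) (auto simp: c)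
  also have "\<dots> = a"
    by (rule dir_deriv_eqI, rule tendsto_eventually) (auto simp: eventually_at_filter dir_quotient_def)
  finally show ?thesis .
qed

text \<open>Chain rule for the coordinate change from c to e, factored through d on the common
  overlap of the three charts. It is what puts \<open>tangent_of\<close> into
  \<open>tangent_space\<close>.\<close>

lemma dir_deriv_transition_cocycle:
  assumes "c \<in> charts_at A p" "d \<in> charts_at A p" "e \<in> charts_at A p"
  shows "dir_deriv (transition d e) (snd d p) (dir_deriv (transition c d) (snd c p) a) =
    dir_deriv (transition c e) (snd c p) a"
proof -
  have A: "c \<in> A" "d \<in> A" "e \<in> A" and p: "p \<in> fst c" "p \<in> fst d" "p \<in> fst e"
    using assms by (auto simp: charts_at_def)
  have "dir_deriv (transition c e) (snd c p) a = dir_deriv (\<lambda>z. transition d e (transition c d z)) (snd c p) a"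
  proof (rule dir_deriv_cong)
    show "open (snd c ` ((fst d \<inter> fst e) \<inter> fst c))"
      using A by (intro open_chart_image open_Int open_chart)
  qed (use A p in auto)
  also have "\<dots> = dir_deriv (transition d e) (transition c d (snd c p)) (dir_deriv (transition c d) (snd c p) a)"
    using A p
    by (intro dir_deriv_compose[OF transition_at(1,3)[OF assms(1,2)] transition_at(1,2)[OF assms(2,3)]]) auto
  finally show ?thesis using A p by simp
qed

lemma tangent_of_in_tangent_space:
  assumes "c \<in> charts_at A p"
  shows "tangent_of A c p a \<in> tangent_space A p"
  using assms by (simp add: tangent_space_def tangent_of_def dir_deriv_transition_cocycle)

lemma tangent_of_chart [simp]: "c \<in> charts_at A p \<Longrightarrow> tangent_of A c p a c = a"
  by (simp add: tangent_of_def dir_deriv_transition_same)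

lemma tangent_space_transition:
  assumes "v \<in> tangent_space A p" "c \<in> charts_at A p" "d \<in> charts_at A p"
  shows "v d = dir_deriv (transition c d) (snd c p) (v c)"
  using assms unfolding tangent_space_def by blast

lemma tangent_space_outside:
  assumes "v \<in> tangent_space A p" "d \<notin> charts_at A p"
  shows "v d = 0"
  using assms unfolding tangent_space_def by blast

lemma tangent_of_coordinate:
  assumes "c \<in> charts_at A p" "v \<in> tangent_space A p"
  shows "tangent_of A c p (v c) = v"
proof
  fix d
  show "tangent_of A c p (v c) d = v d"
    using tangent_space_transition[OF assms(2,1), of d] tangent_space_outside[OF assms(2), of d]
    by (auto simp: tangent_of_def)
qed

lemma tangent_space_eqI:
  assumes "c \<in> charts_at A p" "v \<in> tangent_space A p" "w \<in> tangent_space A p" "v c = w c"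
  shows "v = w"
  using assms tangent_of_coordinate by metis

lemma linear_tangent_of:
  assumes "c \<in> charts_at A p"
  shows "linear (tangent_of A c p)"
proof (rule linearI)
  fix a b and r :: real
  show "tangent_of A c p (a + b) = tangent_of A c p a + tangent_of A c p b"
    by (auto simp: tangent_of_def fun_eq_iff plus_fun_def linear_add[OF linear_transition[OF assms]])
  show "tangent_of A c p (r *\<^sub>R a) = r *\<^sub>R tangent_of A c p a"
    by (auto simp: tangent_of_def fun_eq_iff scaleR_fun_def linear_scale[OF linear_transition[OF assms]])
qed

lemma continuous_on_tangent_of:
  assumes "c \<in> charts_at A p"
  shows "continuous_on UNIV (tangent_of A c p)"
proof (rule continuous_on_coordinatewise_then_product)
  fix d
  show "continuous_on UNIV (\<lambda>a. tangent_of A c p a d)"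
  proof (cases "d \<in> charts_at A p")
    case True
    have "((\<lambda>b. dir_deriv (transition c d) (snd c p) b) \<longlongrightarrow> dir_deriv (transition c d) (snd c p) a) (at a)" for a
      using transition_at[OF assms True] by (intro tendsto_C1_dir_deriv tendsto_intros)
    then show ?thesis
      using True by (simp add: tangent_of_def continuous_on_def)
  qed (simp add: tangent_of_def)
qed

section \<open>The metric in a chart\<close>

lemma scalar_product: "scalar_product_on (tangent_space A p) (\<gamma> p)"
  using weak_riemannian_metric by (simp add: weak_riemannian_metric_def)

abbreviation lm :: "('m, 'e) chart \<Rightarrow> 'e \<Rightarrow> 'e \<Rightarrow> 'e \<Rightarrow> real"
  where "lm \<equiv> local_metric A \<gamma>"

lemma metric_eq_lm:
  assumes "c \<in> charts_at A p" "v \<in> tangent_space A p" "w \<in> tangent_space A p"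
  shows "\<gamma> p v w = lm c (snd c p) (v c) (w c)"
  using assms tangent_of_coordinate[OF assms(1)] by (simp add: local_metric_def charts_at_def)

lemma lm_eq_metric:
  "c \<in> charts_at A p \<Longrightarrow> lm c (snd c p) a b = \<gamma> p (tangent_of A c p a) (tangent_of A c p b)"
  by (simp add: local_metric_def charts_at_def)

lemma lm_commute:
  assumes "c \<in> charts_at A p"
  shows "lm c (snd c p) a b = lm c (snd c p) b a"
  using scalar_product[of p] tangent_of_in_tangent_space[OF assms]
  by (auto simp: lm_eq_metric[OF assms] scalar_product_on_def)

lemma bilinear_lm:
  assumes "c \<in> charts_at A p"
  shows "bilinear (lm c (snd c p))"
proof -
  have lin: "linear (\<lambda>a. lm c (snd c p) a b)" for b
    using scalar_product[of p] tangent_of_in_tangent_space[OF assms] linear_tangent_of[OF assms]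
    by (intro linearI) (auto simp: lm_eq_metric[OF assms] scalar_product_on_def linear_add linear_scale)
  then show ?thesis
    unfolding bilinear_def using lm_commute[OF assms] by simp
qed

lemma lm_pos:
  assumes "c \<in> charts_at A p" "a \<noteq> 0"
  shows "0 < lm c (snd c p) a a"
proof -
  have "tangent_of A c p a \<noteq> 0"
    using assms(2) tangent_of_chart[OF assms(1), of a] by (metis zero_fun_def)
  then show ?thesis
    using scalar_product[of p] tangent_of_in_tangent_space[OF assms(1)]
    by (auto simp: lm_eq_metric[OF assms(1)] scalar_product_on_def)
qed

lemma lm_nonneg:
  assumes "c \<in> charts_at A p"
  shows "0 \<le> lm c (snd c p) a a"
  using lm_pos[OF assms, of a] bilinear_lzero[OF bilinear_lm[OF assms]] by (cases "a = 0") auto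

lemma lm_C1:
  assumes "c \<in> A"
  shows "C_k_on 1 ((snd c ` fst c) \<times> UNIV \<times> UNIV) (\<lambda>(z, a, b). lm c z a b)"
  using weak_riemannian_metric assms unfolding weak_riemannian_metric_def smooth_on_def by blast

lemma open_lm_domain: "c \<in> A \<Longrightarrow> open ((snd c ` fst c) \<times> (UNIV :: 'e set) \<times> (UNIV :: 'e set))"
  by (intro open_Times open_chart_range open_UNIV)

lemma lm_dir_quotient:
  "dir_quotient (\<lambda>(z, a, b). lm c z a b) (z, a, b) (k, 0, 0) t = dir_quotient (\<lambda>y. lm c y a b) z k t"
  by (simp add: dir_quotient_def)

lemma lm_dir_deriv_point:
  "dir_deriv (\<lambda>(z, a, b). lm c z a b) (z, a, b) (k, 0, 0) = dir_deriv (\<lambda>y. lm c y a b) z k"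
  by (simp add: dir_deriv_def lm_dir_quotient[abs_def])

lemma tendsto_lm:
  assumes "c \<in> charts_at A p" "(X \<longlongrightarrow> snd c p) F" "(Y \<longlongrightarrow> a) F" "(Z \<longlongrightarrow> b) F"
  shows "((\<lambda>i. lm c (X i) (Y i) (Z i)) \<longlongrightarrow> lm c (snd c p) a b) F"
proof -
  have c: "c \<in> A" "p \<in> fst c" using assms(1) by (auto simp: charts_at_def)
  have "((\<lambda>i. (\<lambda>(z, a, b). lm c z a b) (X i, Y i, Z i)) \<longlongrightarrow> (\<lambda>(z, a, b). lm c z a b) (snd c p, a, b)) F"
    using c by (intro tendsto_C1[OF lm_C1 open_lm_domain] tendsto_Pair assms) auto
  then show ?thesis by simp
qed

lemma tendsto_lm_dir_deriv:
  assumes "c \<in> charts_at A p" "(X \<longlongrightarrow> snd c p) F" "(Y \<longlongrightarrow> a) F" "(Z \<longlongrightarrow> b) F" "(K \<longlongrightarrow> k) F"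
  shows "((\<lambda>i. dir_deriv (\<lambda>y. lm c y (Y i) (Z i)) (X i) (K i)) \<longlongrightarrow> dir_deriv (\<lambda>y. lm c y a b) (snd c p) k) F"
proof -
  have c: "c \<in> A" "p \<in> fst c" using assms(1) by (auto simp: charts_at_def)
  have "((\<lambda>i. dir_deriv (\<lambda>(z, a, b). lm c z a b) (X i, Y i, Z i) (K i, 0, 0)) \<longlongrightarrow>
      dir_deriv (\<lambda>(z, a, b). lm c z a b) (snd c p, a, b) (k, 0, 0)) F"
    using c by (intro tendsto_C1_dir_deriv[OF lm_C1 open_lm_domain] tendsto_Pair tendsto_const assms) auto
  then show ?thesis by (simp add: lm_dir_deriv_point)
qed

lemma tendsto_lm_dir_quotient:
  assumes "c \<in> charts_at A p" "(X \<longlongrightarrow> snd c p) F" "(Y \<longlongrightarrow> a) F" "(Z \<longlongrightarrow> b) F" "(K \<longlongrightarrow> k) F"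
    and "(R \<longlongrightarrow> 0) F" "\<forall>\<^sub>F i in F. R i \<noteq> 0"
  shows "((\<lambda>i. dir_quotient (\<lambda>y. lm c y (Y i) (Z i)) (X i) (K i) (R i)) \<longlongrightarrow>
    dir_deriv (\<lambda>y. lm c y a b) (snd c p) k) F"
proof -
  have c: "c \<in> A" "p \<in> fst c" using assms(1) by (auto simp: charts_at_def)
  have "((\<lambda>i. dir_quotient (\<lambda>(z, a, b). lm c z a b) (X i, Y i, Z i) (K i, 0, 0) (R i)) \<longlongrightarrow>
      dir_deriv (\<lambda>(z, a, b). lm c z a b) (snd c p, a, b) (k, 0, 0)) F"
    using c by (intro tendsto_dir_quotient_strict[OF lm_C1 open_lm_domain] tendsto_Pair tendsto_const assms) auto
  then show ?thesis by (simp add: lm_dir_deriv_point lm_dir_quotient)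
qed

text \<open>The joint differential is linear, so \<open>(k, h, l)\<close> splits into its three
  slots; in the two vector slots the metric is linear and the difference quotients are
  constant.\<close>

lemma lm_dir_deriv_total:
  assumes "c \<in> charts_at A p"
  shows "dir_deriv (\<lambda>(z, a, b). lm c z a b) (snd c p, a, b) (k, h, l) =
    dir_deriv (\<lambda>y. lm c y a b) (snd c p) k + lm c (snd c p) h b + lm c (snd c p) a l"
proof -
  let ?M = "\<lambda>(z, a, b). lm c z a b" and ?p = "(snd c p, a, b)"
  have c: "c \<in> A" "p \<in> fst c" using assms(1) by (auto simp: charts_at_def)
  have lin: "linear (dir_deriv ?M ?p)"
    using c by (intro linear_dir_deriv[OF lm_C1 open_lm_domain]) auto
  note bil = bilinear_lm[OF assms]
  have "dir_deriv ?M ?p (0, h, 0) = lm c (snd c p) h b"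
    by (rule dir_deriv_eqI, rule tendsto_eventually)
      (auto simp: eventually_at_filter dir_quotient_def bilinear_ladd[OF bil] bilinear_lmul[OF bil])
  moreover have "dir_deriv ?M ?p (0, 0, l) = lm c (snd c p) a l"
    by (rule dir_deriv_eqI, rule tendsto_eventually)
      (auto simp: eventually_at_filter dir_quotient_def bilinear_radd[OF bil] bilinear_rmul[OF bil])
  moreover have "(k, h, l) = (k, 0, 0) + (0, h, 0) + (0, 0, l)"
    by simp
  ultimately show ?thesis
    by (simp only: linear_add[OF lin] lm_dir_deriv_point)
qed

text \<open>Evaluates the limit of an error term in which the second vector tends to 0. The
  quotients vanish only while the base point stays in the range of the chart, where
  \<open>lm\<close> is bilinear.\<close>

lemma lm_dir_deriv_zero_direction:
  assumes "c \<in> charts_at A p"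
  shows "dir_deriv (\<lambda>y. lm c y a 0) (snd c p) k = 0"
proof (rule dir_deriv_eqI, rule tendsto_eventually)
  have c: "c \<in> A" "p \<in> fst c" using assms(1) by (auto simp: charts_at_def)
  have "\<forall>\<^sub>F s in at 0. snd c p + s *\<^sub>R k \<in> snd c ` fst c"
    using c by (intro eventually_add_scaleR_in_open open_chart_range) auto
  then show "\<forall>\<^sub>F s in at 0. dir_quotient (\<lambda>y. lm c y a 0) (snd c p) k s = 0"
  proof eventually_elim
    case (elim s)
    then obtain q where "snd c p + s *\<^sub>R k = snd c q" "c \<in> charts_at A q"
      using c by (auto simp: charts_at_def)
    then show ?case
      using assms by (simp add: dir_quotient_def bilinear_rzero[OF bilinear_lm])
  qed
qed

lemma has_curve_deriv_lm:
  assumes "c \<in> charts_at A p" "z t = snd c p"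
    and "has_curve_deriv z z' t S" "has_curve_deriv a a' t S" "has_curve_deriv b b' t S"
  shows "((\<lambda>t. lm c (z t) (a t) (b t)) has_real_derivative
    dir_deriv (\<lambda>y. lm c y (a t) (b t)) (z t) z' + lm c (z t) a' (b t) + lm c (z t) (a t) b') (at t within S)"
proof -
  let ?w = "\<lambda>t. (z t, a t, b t)"
  have c: "c \<in> A" "p \<in> fst c" using assms(1) by (auto simp: charts_at_def)
  have "curve_quotient ?w t = (\<lambda>s. (curve_quotient z t s, curve_quotient a t s, curve_quotient b t s))"
    by (simp add: fun_eq_iff curve_quotient_def)
  then have "has_curve_deriv ?w (z', a', b') t S"
    using assms(3-5) unfolding has_curve_deriv_def by (auto intro!: tendsto_intros)
  then have "has_curve_deriv ((\<lambda>(z, a, b). lm c z a b) \<circ> ?w)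
      (dir_deriv (\<lambda>(z, a, b). lm c z a b) (?w t) (z', a', b')) t S"
    using c assms(2) by (intro has_curve_deriv_compose[OF lm_C1 open_lm_domain]) auto
  then show ?thesis
    using lm_dir_deriv_total[OF assms(1)] assms(2) by (simp add: has_curve_deriv_real comp_def)
qed

text \<open>The chain rule for coordinate changes carries the derivative from one chart to all
  others. Continuity is a separate assumption because coordinates of points outside a chart carry no
  information: it keeps nearby points inside.\<close>

lemma has_velocityI:
  assumes c: "c \<in> charts_at A (\<eta> t)" and u: "has_curve_deriv (snd c \<circ> \<eta>) u t S"
    and cont: "(\<eta> \<longlongrightarrow> \<eta> t) (at t within S)"
  shows "has_velocity A \<eta> (tangent_of A c (\<eta> t) u) t S"
  unfolding has_velocity_def
proof (intro conjI ballI tangent_of_in_tangent_space[OF c])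
  fix d assume d: "d \<in> charts_at A (\<eta> t)"
  have cA: "c \<in> A" using c by (simp add: charts_at_def)
  have "has_curve_deriv (transition c d \<circ> (snd c \<circ> \<eta>)) (dir_deriv (transition c d) ((snd c \<circ> \<eta>) t) u) t S"
    using transition_at[OF c d] by (intro has_curve_deriv_compose u) auto
  moreover have "\<forall>\<^sub>F s in at t within S. (transition c d \<circ> (snd c \<circ> \<eta>)) s = (snd d \<circ> \<eta>) s"
    using eventually_in_chart[OF c cont] by eventually_elim (auto simp: charts_at_def cA)
  moreover have "(transition c d \<circ> (snd c \<circ> \<eta>)) t = (snd d \<circ> \<eta>) t"
    using c by (simp add: charts_at_def)
  ultimately have "has_curve_deriv (snd d \<circ> \<eta>) (dir_deriv (transition c d) ((snd c \<circ> \<eta>) t) u) t S"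
    by (simp only: has_curve_deriv_cong)
  then show "has_curve_deriv (snd d \<circ> \<eta>) (tangent_of A c (\<eta> t) u d) t S"
    using d by (simp add: tangent_of_def comp_def)
qed

lemma at_within_Icc_not_bot: "a < b \<Longrightarrow> t \<in> {a..b} \<Longrightarrow> at t within {a..b} \<noteq> bot" for a b t :: real
  by (simp add: trivial_limit_within)

lemma velocity_eq:
  assumes "has_velocity A \<eta> v t {0..1}" "t \<in> {0..1}"
  shows "velocity A \<eta> t = v"
proof
  fix d
  have nontriv: "at t within {0..1} \<noteq> bot" using assms(2) by (intro at_within_Icc_not_bot) auto
  show "velocity A \<eta> t d = v d"
  proof (cases "d \<in> charts_at A (\<eta> t)")
    case True
    then have "(curve_quotient (snd d \<circ> \<eta>) t \<longlongrightarrow> v d) (at t within {0..1})"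
      using assms(1) by (simp add: has_velocity_def has_curve_deriv_def)
    from tendsto_Lim[OF nontriv this] show ?thesis
      using True by (simp add: velocity_def)
  next
    case False
    have "v \<in> tangent_space A (\<eta> t)" using assms(1) by (simp add: has_velocity_def)
    from tangent_space_outside[OF this False] show ?thesis
      using False by (simp add: velocity_def)
  qed
qed

end

section \<open>Geodesics\<close>

lemma has_curve_deriv_transform:
  assumes "has_curve_deriv f d t S" "\<And>s. s \<in> S \<Longrightarrow> f s = g s" "t \<in> S"
  shows "has_curve_deriv g d t S"
proof -
  have "\<forall>\<^sub>F s in at t within S. f s = g s"
    using assms(2) by (simp add: eventually_at_filter)
  then show ?thesis
    using assms has_curve_deriv_cong by blast
qed

lemma has_curve_deriv_rescale:
  fixes f :: "real \<Rightarrow> 'a::frechet_space"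
  assumes f: "has_curve_deriv f d (r * t) {0..1}" and r: "r \<in> {0..1}"
  shows "has_curve_deriv (\<lambda>s. f (r * s)) (r *\<^sub>R d) t {0..1}"
proof (cases "r = 0")
  case True
  then show ?thesis by (simp add: has_curve_deriv_def curve_quotient_def[abs_def])
next
  case False
  have lim: "filterlim (\<lambda>s. r * s) (at (r * t) within {0..1}) (at t within {0..1})"
    unfolding filterlim_at
  proof
    show "((\<lambda>s. r * s) \<longlongrightarrow> r * t) (at t within {0..1})"
      by (intro tendsto_intros)
    show "\<forall>\<^sub>F s in at t within {0..1}. r * s \<in> {0..1} \<and> r * s \<noteq> r * t"
      using False r by (auto simp: eventually_at_filter mult_le_one)
  qed
  have "((\<lambda>s. r *\<^sub>R curve_quotient f (r * t) (r * s)) \<longlongrightarrow> r *\<^sub>R d) (at t within {0..1})"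
    by (intro tendsto_intros filterlim_compose[OF _ lim] has_curve_deriv_tendsto[OF f])
  moreover have "r *\<^sub>R curve_quotient f (r * t) (r * s) = curve_quotient (\<lambda>s. f (r * s)) t s" for s
  proof -
    have "r * (1 / (r * s - r * t)) = 1 / (s - t)"
      using False by (simp flip: right_diff_distrib)
    then show ?thesis by (simp add: curve_quotient_def)
  qed
  ultimately show ?thesis
    by (simp add: has_curve_deriv_def)
qed

text \<open>The curve of exponentials is identified with a geodesic on \<open>{0..1}\<close> only,
  so the property must not depend on values elsewhere.\<close>

lemma geodesic_transform:
  assumes "geodesic A \<gamma> c" "\<And>t. t \<in> {0..1} \<Longrightarrow> c t = c' t"
  shows "geodesic A \<gamma> c'"
proof -
  obtain \<Gamma> where \<Gamma>: "levi_civita A \<gamma> \<Gamma>" "\<And>d. d \<in> A \<Longrightarrow> \<exists>u'. \<forall>t\<in>{0..1}. c t \<in> fst d \<longrightarrow>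
      has_curve_deriv (snd d \<circ> c) (u' t) t {0..1} \<and>
      has_curve_deriv u' (- \<Gamma> d (snd d (c t)) (u' t) (u' t)) t {0..1}"
    using assms(1) unfolding geodesic_def by blast
  have "\<exists>u'. \<forall>t\<in>{0..1}. c' t \<in> fst d \<longrightarrow>
      has_curve_deriv (snd d \<circ> c') (u' t) t {0..1} \<and>
      has_curve_deriv u' (- \<Gamma> d (snd d (c' t)) (u' t) (u' t)) t {0..1}" if d: "d \<in> A" for d
  proof -
    have "has_curve_deriv (snd d \<circ> c') u t {0..1}" if "has_curve_deriv (snd d \<circ> c) u t {0..1}" "t \<in> {0..1}" for u t
      using has_curve_deriv_transform[OF that(1) _ that(2), of "snd d \<circ> c'"] assms(2) by simp
    then show ?thesis using \<Gamma>(2)[OF d] assms(2) by metis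
  qed
  moreover have "continuous_on {0..1} c'"
    using assms continuous_on_cong unfolding geodesic_def by metis
  ultimately show ?thesis
    unfolding geodesic_def using \<Gamma>(1) by blast
qed

lemma velocity_transform:
  fixes A :: "('m::t2_space, 'e::frechet_space) chart set"
  assumes "\<And>t. t \<in> {0..1} \<Longrightarrow> c t = c' t" "t \<in> {0..1}"
  shows "velocity A c t = velocity A c' t"
proof
  fix d :: "('m, 'e) chart"
  have "Lim (at t within {0..1}) (curve_quotient (snd d \<circ> c) t) = Lim (at t within {0..1}) (curve_quotient (snd d \<circ> c') t)"
    using assms by (intro Lim_cong) (auto simp: eventually_at_filter curve_quotient_def)
  then show "velocity A c t d = velocity A c' t d"
    using assms by (simp add: velocity_def)
qed

lemma exp_map_eq:
  assumes "exp_exists A \<gamma> x v" "geodesic_from A \<gamma> x v c"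
  shows "exp_map A \<gamma> x v = c 1"
  unfolding exp_map_def
proof (rule the_equality)
  show "\<And>y. \<exists>c. geodesic_from A \<gamma> x v c \<and> c 1 = y \<Longrightarrow> y = c 1"
    using assms by (auto simp: exp_exists_def)
qed (use assms in blast)

context weak_riemannian
begin

lemma metric_compatible_lm:
  assumes "levi_civita A \<gamma> \<Gamma>" "c \<in> charts_at A p"
  shows "dir_deriv (\<lambda>y. lm c y a b) (snd c p) k =
    lm c (snd c p) (\<Gamma> c (snd c p) k a) b + lm c (snd c p) a (\<Gamma> c (snd c p) k b)"
  using assms by (auto simp: levi_civita_def metric_compatible_def charts_at_def)

lemma torsion_free_sym:
  assumes "levi_civita A \<gamma> \<Gamma>" "c \<in> charts_at A p"
  shows "\<Gamma> c (snd c p) a b = \<Gamma> c (snd c p) b a"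
  using assms by (auto simp: levi_civita_def torsion_free_def charts_at_def)

lemma bilinear_christoffel:
  assumes "levi_civita A \<gamma> \<Gamma>" "c \<in> charts_at A p"
  shows "bilinear (\<Gamma> c (snd c p))"
  using assms by (auto simp: levi_civita_def connection_def charts_at_def)

text \<open>In \<open>geodesic\<close> each chart comes with its own \<open>u'\<close>. As limits of
  difference quotients these are the coordinates of one tangent vector, \<open>velocity\<close>,
  which therefore satisfies the geodesic equation in every chart.\<close>

lemma geodesic_velocity:
  assumes "geodesic A \<gamma> c"
  obtains \<Gamma> where "levi_civita A \<gamma> \<Gamma>"
    and "\<And>t. t \<in> {0..1} \<Longrightarrow> has_velocity A c (velocity A c t) t {0..1}"
    and "\<And>t d. t \<in> {0..1} \<Longrightarrow> d \<in> charts_at A (c t) \<Longrightarrow>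
      has_curve_deriv (\<lambda>s. velocity A c s d)
        (- \<Gamma> d (snd d (c t)) (velocity A c t d) (velocity A c t d)) t {0..1}"
proof -
  obtain \<Gamma> where \<Gamma>: "levi_civita A \<gamma> \<Gamma>" "\<And>d. d \<in> A \<Longrightarrow> \<exists>u'. \<forall>t\<in>{0..1}. c t \<in> fst d \<longrightarrow>
      has_curve_deriv (snd d \<circ> c) (u' t) t {0..1} \<and>
      has_curve_deriv u' (- \<Gamma> d (snd d (c t)) (u' t) (u' t)) t {0..1}"
    using assms unfolding geodesic_def by blast
  have cont: "(c \<longlongrightarrow> c t) (at t within {0..1})" if "t \<in> {0..1}" for t
    using assms that by (auto simp: geodesic_def continuous_on_def)
  have vel: "has_velocity A c (velocity A c t) t {0..1} \<and> velocity A c t d = u"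
    if "t \<in> {0..1}" "d \<in> charts_at A (c t)" "has_curve_deriv (snd d \<circ> c) u t {0..1}" for t d u
  proof -
    have "has_velocity A c (tangent_of A d (c t) u) t {0..1}"
      using that cont by (intro has_velocityI)
    moreover from velocity_eq[OF this that(1)] have "velocity A c t = tangent_of A d (c t) u" .
    ultimately show ?thesis using that(2) by simp
  qed
  show ?thesis
  proof (rule that[OF \<Gamma>(1)])
    fix t :: real assume t: "t \<in> {0..1}"
    obtain d where d: "d \<in> charts_at A (c t)" by (rule chart_exists)
    then show "has_velocity A c (velocity A c t) t {0..1}"
      using \<Gamma>(2)[of d] vel[OF t d] t by (auto simp: charts_at_def)
  next
    fix t :: real and d assume t: "t \<in> {0..1}" and d: "d \<in> charts_at A (c t)"
    obtain u' where u': "\<And>t. t \<in> {0..1} \<Longrightarrow> c t \<in> fst d \<Longrightarrow> has_curve_deriv (snd d \<circ> c) (u' t) t {0..1} \<and>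
        has_curve_deriv u' (- \<Gamma> d (snd d (c t)) (u' t) (u' t)) t {0..1}"
      using \<Gamma>(2)[of d] d unfolding charts_at_def by blast
    have eq: "velocity A c s d = u' s" if "s \<in> {0..1}" "d \<in> charts_at A (c s)" for s
      using vel[OF that] u'[OF that(1)] that(2) by (auto simp: charts_at_def)
    have "\<forall>\<^sub>F s in at t within {0..1}. d \<in> charts_at A (c s)"
      by (rule eventually_in_chart[OF d cont[OF t]])
    then have "\<forall>\<^sub>F s in at t within {0..1}. u' s = velocity A c s d"
      unfolding eventually_at_filter by eventually_elim (simp add: eq)
    moreover have "has_curve_deriv u' (- \<Gamma> d (snd d (c t)) (u' t) (u' t)) t {0..1}"
      using u'[OF t] d by (simp add: charts_at_def)
    ultimately show "has_curve_deriv (\<lambda>s. velocity A c s d)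
        (- \<Gamma> d (snd d (c t)) (velocity A c t d) (velocity A c t d)) t {0..1}"
      using has_curve_deriv_cong[of u' "\<lambda>s. velocity A c s d" t "{0..1}"] eq[OF t d] by simp
  qed
qed

text \<open>Metric compatibility and the geodesic equation cancel in the derivative of the squared
  speed, computed at each time in a chart around the point reached; a function with derivative 0 on
  \<open>{0..1}\<close> is constant.\<close>

lemma geodesic_constant_speed:
  assumes "geodesic A \<gamma> c" "t \<in> {0..1}"
  shows "\<gamma> (c t) (velocity A c t) (velocity A c t) = \<gamma> (c 0) (velocity A c 0) (velocity A c 0)"
proof -
  let ?V = "velocity A c" and ?f = "\<lambda>t. \<gamma> (c t) (velocity A c t) (velocity A c t)"
  obtain \<Gamma> where \<Gamma>: "levi_civita A \<gamma> \<Gamma>"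
    and V: "\<And>t. t \<in> {0..1} \<Longrightarrow> has_velocity A c (?V t) t {0..1}"
    and V': "\<And>t d. t \<in> {0..1} \<Longrightarrow> d \<in> charts_at A (c t) \<Longrightarrow>
      has_curve_deriv (\<lambda>s. ?V s d) (- \<Gamma> d (snd d (c t)) (?V t d) (?V t d)) t {0..1}"
    using geodesic_velocity[OF assms(1)] by blast
  have "(?f has_real_derivative 0) (at t within {0..1})" if t: "t \<in> {0..1}" for t
  proof -
    obtain d where d: "d \<in> charts_at A (c t)" by (rule chart_exists)
    let ?z = "snd d (c t)" and ?u = "?V t d"
    have "has_curve_deriv (snd d \<circ> c) ?u t {0..1}"
      using V[OF t] d by (simp add: has_velocity_def)
    then have "((\<lambda>s. lm d ((snd d \<circ> c) s) (?V s d) (?V s d)) has_real_derivative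
        dir_deriv (\<lambda>y. lm d y ?u ?u) ((snd d \<circ> c) t) ?u +
        lm d ((snd d \<circ> c) t) (- \<Gamma> d ?z ?u ?u) ?u + lm d ((snd d \<circ> c) t) ?u (- \<Gamma> d ?z ?u ?u)) (at t within {0..1})"
      using V'[OF t d] by (intro has_curve_deriv_lm[OF d]) simp
    moreover have "dir_deriv (\<lambda>y. lm d y ?u ?u) ((snd d \<circ> c) t) ?u +
        lm d ((snd d \<circ> c) t) (- \<Gamma> d ?z ?u ?u) ?u + lm d ((snd d \<circ> c) t) ?u (- \<Gamma> d ?z ?u ?u) = 0"
      using metric_compatible_lm[OF \<Gamma> d] bilinear_lneg[OF bilinear_lm[OF d]] bilinear_rneg[OF bilinear_lm[OF d]]
      by simp
    ultimately have "((\<lambda>s. lm d (snd d (c s)) (?V s d) (?V s d)) has_real_derivative 0) (at t within {0..1})"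
      by simp
    moreover have "\<forall>\<^sub>F s in at t within {0..1}. lm d (snd d (c s)) (?V s d) (?V s d) = ?f s"
    proof -
      have "(c \<longlongrightarrow> c t) (at t within {0..1})"
        using assms(1) t by (auto simp: geodesic_def continuous_on_def)
      from eventually_in_chart[OF d this] have "\<forall>\<^sub>F s in at t within {0..1}. d \<in> charts_at A (c s)" .
      then show ?thesis
        unfolding eventually_at_filter
      proof eventually_elim
        case (elim s)
        then show ?case
          using V[of s] metric_eq_lm[of d "c s" "?V s" "?V s"] by (simp add: has_velocity_def)
      qed
    qed
    moreover have "lm d (snd d (c t)) (?V t d) (?V t d) = ?f t"
      using V[OF t] metric_eq_lm[OF d] by (simp add: has_velocity_def)
    ultimately show ?thesis
      using t by (subst (asm) has_field_derivative_cong_eventually) auto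
  qed
  then obtain k where "\<And>t. t \<in> {0..1} \<Longrightarrow> ?f t = k"
    using has_field_derivative_zero_constant[of "{0..1}" ?f] by auto
  then show ?thesis using assms(2) by simp
qed

text \<open>Under the time change the velocity scales with r and its derivative with the square of
  r, as does the Christoffel term by bilinearity. Confining r to \<open>{0..1}\<close> keeps the
  parameter where c is a geodesic.\<close>

lemma geodesic_rescale:
  assumes c: "geodesic_from A \<gamma> x v c" and r: "r \<in> {0..1}"
  shows "geodesic_from A \<gamma> x (r *\<^sub>R v) (\<lambda>t. c (r * t))"
proof -
  have geo: "geodesic A \<gamma> c" and c0: "c 0 = x" "velocity A c 0 = v"
    using c by (auto simp: geodesic_from_def)
  have rt: "r * t \<in> {0..1}" if "t \<in> {0..1}" for t
    using that r by (auto simp: mult_le_one)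
  obtain \<Gamma> where \<Gamma>: "levi_civita A \<gamma> \<Gamma>" and \<Gamma>_ex: "\<And>d. d \<in> A \<Longrightarrow> \<exists>u'. \<forall>t\<in>{0..1}. c t \<in> fst d \<longrightarrow>
      has_curve_deriv (snd d \<circ> c) (u' t) t {0..1} \<and>
      has_curve_deriv u' (- \<Gamma> d (snd d (c t)) (u' t) (u' t)) t {0..1}"
    using geo unfolding geodesic_def by blast
  have "\<exists>u'. \<forall>t\<in>{0..1}. c (r * t) \<in> fst d \<longrightarrow>
      has_curve_deriv (snd d \<circ> (\<lambda>t. c (r * t))) (u' t) t {0..1} \<and>
      has_curve_deriv u' (- \<Gamma> d (snd d (c (r * t))) (u' t) (u' t)) t {0..1}" if d: "d \<in> A" for d
  proof -
    obtain u' where u': "\<And>t. t \<in> {0..1} \<Longrightarrow> c t \<in> fst d \<Longrightarrow> has_curve_deriv (snd d \<circ> c) (u' t) t {0..1} \<and>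
        has_curve_deriv u' (- \<Gamma> d (snd d (c t)) (u' t) (u' t)) t {0..1}"
      using \<Gamma>_ex[OF d] by blast
    have "has_curve_deriv (snd d \<circ> (\<lambda>t. c (r * t))) (r *\<^sub>R u' (r * t)) t {0..1} \<and>
        has_curve_deriv (\<lambda>t. r *\<^sub>R u' (r * t))
          (- \<Gamma> d (snd d (c (r * t))) (r *\<^sub>R u' (r * t)) (r *\<^sub>R u' (r * t))) t {0..1}"
      if t: "t \<in> {0..1}" "c (r * t) \<in> fst d" for t
    proof
      note * = u'[OF rt[OF t(1)] t(2)]
      have dc: "d \<in> charts_at A (c (r * t))" using t d by (simp add: charts_at_def)
      show "has_curve_deriv (snd d \<circ> (\<lambda>t. c (r * t))) (r *\<^sub>R u' (r * t)) t {0..1}"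
        using has_curve_deriv_rescale[OF conjunct1[OF *] r] by (simp add: comp_def)
      have "has_curve_deriv (\<lambda>s. u' (r * s)) (r *\<^sub>R (- \<Gamma> d (snd d (c (r * t))) (u' (r * t)) (u' (r * t)))) t {0..1}"
        using has_curve_deriv_rescale[OF conjunct2[OF *] r] .
      then have "((\<lambda>s. r *\<^sub>R curve_quotient (\<lambda>s. u' (r * s)) t s) \<longlongrightarrow>
          r *\<^sub>R (r *\<^sub>R (- \<Gamma> d (snd d (c (r * t))) (u' (r * t)) (u' (r * t))))) (at t within {0..1})"
        by (intro tendsto_intros has_curve_deriv_tendsto)
      moreover have "r *\<^sub>R curve_quotient (\<lambda>s. u' (r * s)) t s = curve_quotient (\<lambda>s. r *\<^sub>R u' (r * s)) t s" for s
        by (simp add: curve_quotient_def scaleR_diff_right mult.commute)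
      moreover have "r *\<^sub>R (r *\<^sub>R (- \<Gamma> d (snd d (c (r * t))) (u' (r * t)) (u' (r * t)))) =
          - \<Gamma> d (snd d (c (r * t))) (r *\<^sub>R u' (r * t)) (r *\<^sub>R u' (r * t))"
        by (simp add: bilinear_lmul[OF bilinear_christoffel[OF \<Gamma> dc]] bilinear_rmul[OF bilinear_christoffel[OF \<Gamma> dc]])
      ultimately show "has_curve_deriv (\<lambda>t. r *\<^sub>R u' (r * t))
          (- \<Gamma> d (snd d (c (r * t))) (r *\<^sub>R u' (r * t)) (r *\<^sub>R u' (r * t))) t {0..1}"
        by (simp add: has_curve_deriv_def)
    qed
    then show ?thesis by (intro exI[of _ "\<lambda>t. r *\<^sub>R u' (r * t)"]) blast
  qed
  moreover have "continuous_on {0..1} (\<lambda>t. c (r * t))"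
    using geo rt unfolding geodesic_def
    by (intro continuous_on_compose2[of "{0..1}" c "{0..1}" "\<lambda>t. r * t"] continuous_intros) auto
  ultimately have geo': "geodesic A \<gamma> (\<lambda>t. c (r * t))"
    unfolding geodesic_def using \<Gamma> by blast
  have "velocity A (\<lambda>t. c (r * t)) 0 = r *\<^sub>R v"
  proof -
    obtain d where d: "d \<in> charts_at A x" by (rule chart_exists)
    have vc: "has_velocity A c v 0 {0..1}"
      using geodesic_velocity[OF geo] c0 by (metis atLeastAtMost_iff order_refl zero_le_one)
    have v: "v \<in> tangent_space A x" "has_curve_deriv (snd d \<circ> c) (v d) (r * 0) {0..1}"
      using vc d c0 by (auto simp: has_velocity_def)
    have "has_curve_deriv (\<lambda>s. (snd d \<circ> c) (r * s)) (r *\<^sub>R v d) 0 {0..1}"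
      by (rule has_curve_deriv_rescale[OF v(2) r])
    moreover have "((\<lambda>t. c (r * t)) \<longlongrightarrow> c (r * 0)) (at 0 within {0..1})"
      using geo' unfolding geodesic_def continuous_on_def by (metis atLeastAtMost_iff order_refl zero_le_one)
    ultimately have "has_velocity A (\<lambda>t. c (r * t)) (tangent_of A d (c (r * 0)) (r *\<^sub>R v d)) 0 {0..1}"
      using d c0 by (intro has_velocityI) (auto simp: comp_def)
    from velocity_eq[OF this] show ?thesis
      using c0 linear_scale[OF linear_tangent_of[OF d]] tangent_of_coordinate[OF d v(1)] by simp
  qed
  then show ?thesis
    using geo' c0 by (simp add: geodesic_from_def)
qed

text \<open>The geodesic for \<open>t *\<^sub>R v\<close> is the one for v rescaled by t, so its end
  point is the point of the latter at time t. Uniqueness for each of these vectors turns this into a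
  statement about \<open>exp_map\<close>.\<close>

lemma radial_geodesic:
  assumes "\<And>r. r \<in> {0..1} \<Longrightarrow> exp_exists A \<gamma> x (r *\<^sub>R v)"
  shows "geodesic_from A \<gamma> x v (\<lambda>t. exp_map A \<gamma> x (t *\<^sub>R v))"
proof -
  obtain c where c: "geodesic_from A \<gamma> x v c"
    using assms[of 1] by (auto simp: exp_exists_def)
  have eq: "c t = exp_map A \<gamma> x (t *\<^sub>R v)" if "t \<in> {0..1}" for t
    using exp_map_eq[OF assms[OF that] geodesic_rescale[OF c that]] by simp
  have "geodesic A \<gamma> c" "c 0 = x" "velocity A c 0 = v"
    using c by (auto simp: geodesic_from_def)
  then show ?thesis
    using geodesic_transform[of A \<gamma> c "\<lambda>t. exp_map A \<gamma> x (t *\<^sub>R v)"] eq[of 0]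
      velocity_transform[of c "\<lambda>t. exp_map A \<gamma> x (t *\<^sub>R v)" 0 A] eq
    unfolding geodesic_from_def by (metis atLeastAtMost_iff order_refl zero_le_one)
qed

end

section \<open>The Gauss lemma\<close>

text \<open>
  The exponential mapping is read as a map on an open subset of the model space, via the chart
  \<open>c\<^sub>0\<close> around \<open>x\<close>.
\<close>

locale normal_neighborhood = weak_riemannian A \<gamma>
  for A :: "('m::t2_space, 'e::frechet_space) chart set" and \<gamma> :: "('m, 'e) tensor2" +
  fixes x :: 'm and U :: "('m, 'e) tvec set" and V :: "'m set" and c0 :: "('m, 'e) chart"
  assumes normalizable: "normalizable_at A \<gamma> x U V"
    and c0: "c0 \<in> charts_at A x"
begin

abbreviation tan :: "'e \<Rightarrow> ('m, 'e) tvec"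
  where "tan \<equiv> tangent_of A c0 x"

definition Uc :: "'e set"
  where "Uc = {a. tan a \<in> U}"

definition ex :: "'e \<Rightarrow> 'm"
  where "ex a = exp_map A \<gamma> x (tan a)"

definition lg :: "'m \<Rightarrow> 'e"
  where "lg p = the_inv_into U (exp_map A \<gamma> x) p c0"

text \<open>The differential of \<open>ex\<close> as a tangent vector at \<open>ex a\<close>, given
  by all its coordinates so that linearity can be read off chart by chart.\<close>

definition Tex :: "'e \<Rightarrow> 'e \<Rightarrow> ('m, 'e) tvec"
  where "Tex a k = (\<lambda>d. if d \<in> charts_at A (ex a) then dir_deriv (\<lambda>b. snd d (ex b)) a k else 0)"

text \<open>A fixed form on the model space, the scalar product at x read in \<open>c0\<close>; it
  measures radii everywhere in \<open>Uc\<close>, in contrast to the metric at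
  \<open>ex a\<close>.\<close>

abbreviation mx :: "'e \<Rightarrow> 'e \<Rightarrow> real"
  where "mx \<equiv> lm c0 (snd c0 x)"

section \<open>The exponential mapping in coordinates\<close>

lemma U_subset: "U \<subseteq> tangent_space A x"
  using normalizable openin_imp_subset unfolding normalizable_at_def by blast

lemma open_V: "open V"
  using normalizable by (simp add: normalizable_at_def)

lemma tan_coordinate: "v \<in> U \<Longrightarrow> tan (v c0) = v"
  using U_subset tangent_of_coordinate[OF c0] by blast

lemma homeomorphism_exp: "homeomorphism U V (exp_map A \<gamma> x) (the_inv_into U (exp_map A \<gamma> x))"
  using normalizable by (simp add: normalizable_at_def C1_diffeomorphism_def)

lemma open_Uc: "open Uc"
proof -
  have "openin (top_of_set (tangent_space A x)) U"
    using normalizable by (simp add: normalizable_at_def)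
  then obtain T where T: "open T" "U = tangent_space A x \<inter> T"
    unfolding openin_open by blast
  then have "Uc = tan -` T"
    using tangent_of_in_tangent_space[OF c0] unfolding Uc_def by auto
  then show ?thesis
    using T(1) continuous_on_tangent_of[OF c0] by (simp add: open_vimage)
qed

lemma convex_Uc: "convex Uc"
proof -
  have "convex (tan -` U)"
    using normalizable linear_tangent_of[OF c0] by (intro convex_linear_vimage) (simp_all add: normalizable_at_def)
  then show ?thesis by (simp add: Uc_def vimage_def)
qed

lemma zero_in_Uc: "0 \<in> Uc"
  using normalizable linear_0[OF linear_tangent_of[OF c0]] by (simp add: Uc_def normalizable_at_def)

lemma scaleR_in_Uc:
  assumes "a \<in> Uc" "t \<in> {0..1}"
  shows "t *\<^sub>R a \<in> Uc"
  using convexD[OF convex_Uc assms(1) zero_in_Uc, of t "1 - t"] assms(2) by simp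

lemma ex_in_V: "a \<in> Uc \<Longrightarrow> ex a \<in> V"
  using homeomorphism_image1[OF homeomorphism_exp] by (auto simp: Uc_def ex_def)

lemma the_inv_exp_in_U: "p \<in> V \<Longrightarrow> the_inv_into U (exp_map A \<gamma> x) p \<in> U"
  using homeomorphism_image2[OF homeomorphism_exp] by auto

lemma lg_in_Uc: "p \<in> V \<Longrightarrow> lg p \<in> Uc"
  using the_inv_exp_in_U by (simp add: Uc_def lg_def tan_coordinate)

lemma ex_lg: "p \<in> V \<Longrightarrow> ex (lg p) = p"
  using the_inv_exp_in_U homeomorphism_apply2[OF homeomorphism_exp] by (simp add: ex_def lg_def tan_coordinate)

lemma lg_ex: "a \<in> Uc \<Longrightarrow> lg (ex a) = a"
  using homeomorphism_apply1[OF homeomorphism_exp] c0 by (simp add: ex_def lg_def Uc_def)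

lemma tendsto_ex:
  assumes "a \<in> Uc" "(X \<longlongrightarrow> a) F"
  shows "((\<lambda>i. ex (X i)) \<longlongrightarrow> ex a) F"
proof -
  have "continuous_on Uc (\<lambda>a. exp_map A \<gamma> x (tan a))"
    using homeomorphism_cont1[OF homeomorphism_exp] continuous_on_tangent_of[OF c0]
    by (intro continuous_on_compose2[of U "exp_map A \<gamma> x" Uc tan]) (auto simp: Uc_def intro: continuous_on_subset)
  then have "isCont ex a"
    using assms(1) open_Uc by (simp add: ex_def[abs_def] continuous_on_eq_continuous_at)
  then show ?thesis using assms(2) by (rule isCont_tendsto_compose)
qed

lemma continuous_on_lg: "continuous_on V lg"
  unfolding lg_def
  by (rule continuous_on_product_then_coordinatewise) (rule homeomorphism_cont2[OF homeomorphism_exp])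

lemma ex_C1:
  assumes "d \<in> A"
  shows "C_k_on 1 {a \<in> Uc. ex a \<in> fst d} (\<lambda>a. snd d (ex a))" "open {a \<in> Uc. ex a \<in> fst d}"
proof -
  show "C_k_on 1 {a \<in> Uc. ex a \<in> fst d} (\<lambda>a. snd d (ex a))"
    using normalizable assms c0 by (simp add: normalizable_at_def C1_diffeomorphism_def Uc_def ex_def)
  show "open {a \<in> Uc. ex a \<in> fst d}"
  proof (rule Topological_Spaces.openI)
    fix a assume "a \<in> {a \<in> Uc. ex a \<in> fst d}"
    then have a: "a \<in> Uc" "ex a \<in> fst d" by auto
    have "\<forall>\<^sub>F b in nhds a. b \<in> Uc" "\<forall>\<^sub>F b in nhds a. ex b \<in> fst d"
      using eventually_nhds_in_open[OF open_Uc a(1)]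
        topological_tendstoD[OF tendsto_ex[OF a(1) filterlim_ident] open_chart[OF assms] a(2)] by auto
    then have "\<forall>\<^sub>F b in nhds a. b \<in> {a \<in> Uc. ex a \<in> fst d}"
      by eventually_elim simp
    then show "\<exists>T. open T \<and> a \<in> T \<and> T \<subseteq> {a \<in> Uc. ex a \<in> fst d}"
      unfolding eventually_nhds by blast
  qed
qed

lemma lg_C1:
  assumes "d \<in> A"
  shows "C_k_on 1 (snd d ` (V \<inter> fst d)) (\<lambda>z. lg (chart_inv d z))" "open (snd d ` (V \<inter> fst d))"
  using normalizable assms c0 open_chart_image[OF assms open_V]
  by (auto simp: normalizable_at_def C1_diffeomorphism_def lg_def)

lemma ex_C1_at:
  assumes "a \<in> Uc" "d \<in> charts_at A (ex a)"
  shows "C_k_on 1 {a \<in> Uc. ex a \<in> fst d} (\<lambda>a. snd d (ex a))" "open {a \<in> Uc. ex a \<in> fst d}"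
    "a \<in> {a \<in> Uc. ex a \<in> fst d}"
  using assms ex_C1[of d] by (auto simp: charts_at_def)

lemma Tex_chart: "d \<in> charts_at A (ex a) \<Longrightarrow> Tex a k d = dir_deriv (\<lambda>b. snd d (ex b)) a k"
  by (simp add: Tex_def)

lemma linear_Tex_chart:
  assumes "a \<in> Uc" "d \<in> charts_at A (ex a)"
  shows "linear (\<lambda>k. Tex a k d)"
  using linear_dir_deriv[OF ex_C1_at[OF assms]] assms(2) by (simp add: Tex_chart)

lemma Tex_eq_tangent_of:
  assumes "a \<in> Uc" "d \<in> charts_at A (ex a)"
  shows "Tex a k = tangent_of A d (ex a) (dir_deriv (\<lambda>b. snd d (ex b)) a k)"
proof
  fix e
  show "Tex a k e = tangent_of A d (ex a) (dir_deriv (\<lambda>b. snd d (ex b)) a k) e"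
  proof (cases "e \<in> charts_at A (ex a)")
    case True
    have A: "d \<in> A" "e \<in> A" and p: "ex a \<in> fst d" "ex a \<in> fst e"
      using True assms(2) by (auto simp: charts_at_def)
    have "dir_deriv (\<lambda>b. snd e (ex b)) a k = dir_deriv (\<lambda>b. transition d e (snd d (ex b))) a k"
    proof (rule dir_deriv_cong)
      show "open ({a \<in> Uc. ex a \<in> fst d} \<inter> {a \<in> Uc. ex a \<in> fst e})"
        using ex_C1(2) A by (intro open_Int)
    qed (use A p assms(1) in auto)
    also have "\<dots> = dir_deriv (transition d e) (snd d (ex a)) (dir_deriv (\<lambda>b. snd d (ex b)) a k)"
      using transition_at[OF assms(2) True] by (intro dir_deriv_compose[OF ex_C1_at(1,3)[OF assms]]) auto
    finally show ?thesis using True by (simp add: Tex_def tangent_of_def)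
  qed (simp add: Tex_def tangent_of_def)
qed

lemma Tex_in_tangent_space:
  assumes "a \<in> Uc"
  shows "Tex a k \<in> tangent_space A (ex a)"
proof -
  obtain d where d: "d \<in> charts_at A (ex a)" by (rule chart_exists)
  then show ?thesis
    using Tex_eq_tangent_of[OF assms d] tangent_of_in_tangent_space[OF d] by simp
qed

lemma linear_Tex:
  assumes "a \<in> Uc"
  shows "linear (Tex a)"
proof (rule linearI)
  fix h k and r :: real
  show "Tex a (h + k) = Tex a h + Tex a k"
  proof
    fix d
    show "Tex a (h + k) d = (Tex a h + Tex a k) d"
      using linear_add[OF linear_Tex_chart[OF assms]]
      by (cases "d \<in> charts_at A (ex a)") (simp_all add: plus_fun_def, simp add: Tex_def)
  qed
  show "Tex a (r *\<^sub>R h) = r *\<^sub>R Tex a h"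
  proof
    fix d
    show "Tex a (r *\<^sub>R h) d = (r *\<^sub>R Tex a h) d"
      using linear_scale[OF linear_Tex_chart[OF assms]]
      by (cases "d \<in> charts_at A (ex a)") (simp_all add: scaleR_fun_def, simp add: Tex_def)
  qed
qed

text \<open>Chain rule for \<open>lg\<close> after \<open>ex\<close>: since the inverse is C1 as
  well, its differential is a left inverse of the differential of \<open>ex\<close>.\<close>

lemma inj_Tex:
  assumes "a \<in> Uc" "Tex a h = Tex a k"
  shows "h = k"
proof -
  obtain d where d: "d \<in> charts_at A (ex a)" by (rule chart_exists)
  have dA: "d \<in> A" "ex a \<in> fst d" using d by (auto simp: charts_at_def)
  have left_inverse: "dir_deriv (\<lambda>z. lg (chart_inv d z)) (snd d (ex a)) (Tex a l d) = l" for l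
  proof -
    have "dir_deriv (\<lambda>b. lg (chart_inv d (snd d (ex b)))) a l =
        dir_deriv (\<lambda>z. lg (chart_inv d z)) (snd d (ex a)) (dir_deriv (\<lambda>b. snd d (ex b)) a l)"
      using dA assms(1) ex_in_V
      by (intro dir_deriv_compose[OF ex_C1_at(1,3)[OF assms(1) d] lg_C1[OF dA(1)]]) auto
    moreover have "dir_deriv (\<lambda>b. lg (chart_inv d (snd d (ex b)))) a l = dir_deriv (\<lambda>b. b) a l"
      using dA by (intro dir_deriv_cong[OF ex_C1_at(2,3)[OF assms(1) d]]) (auto simp: lg_ex)
    moreover have "dir_deriv (\<lambda>b. b) a l = l"
      by (rule dir_deriv_eqI, rule tendsto_eventually) (auto simp: eventually_at_filter dir_quotient_def)
    ultimately show ?thesis using d by (simp add: Tex_chart)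
  qed
  show ?thesis
    by (rule trans[OF left_inverse[of h, symmetric]]) (unfold assms(2), rule left_inverse)
qed

lemma has_velocity_ex:
  assumes w: "has_curve_deriv w k t S" and wt: "w t \<in> Uc"
  shows "has_velocity A (\<lambda>s. ex (w s)) (Tex (w t) k) t S"
proof -
  obtain d where d: "d \<in> charts_at A (ex (w t))" by (rule chart_exists)
  have "has_curve_deriv ((\<lambda>a. snd d (ex a)) \<circ> w) (dir_deriv (\<lambda>a. snd d (ex a)) (w t) k) t S"
    by (rule has_curve_deriv_compose[OF ex_C1_at[OF wt d] w])
  then show ?thesis
    unfolding Tex_eq_tangent_of[OF wt d] comp_def
    by (intro has_velocityI d tendsto_ex[OF wt has_curve_deriv_continuous[OF w]]) (simp add: comp_def)
qed

lemma bilinear_mx: "bilinear mx"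
  by (rule bilinear_lm[OF c0])

lemma mx_eq_metric: "mx a b = \<gamma> x (tan a) (tan b)"
  by (rule lm_eq_metric[OF c0])

section \<open>Radial geodesics in coordinates\<close>

lemma ray_has_curve_deriv: "has_curve_deriv (\<lambda>t. t *\<^sub>R a) a t S" for a :: 'e
proof -
  have "\<forall>\<^sub>F s in at t within S. curve_quotient (\<lambda>t. t *\<^sub>R a) t s = a"
    by (simp add: eventually_at_filter curve_quotient_def flip: scaleR_diff_left)
  then show ?thesis unfolding has_curve_deriv_def by (rule tendsto_eventually)
qed

lemma ray_geodesic:
  assumes "a \<in> Uc"
  shows "geodesic_from A \<gamma> x (tan a) (\<lambda>t. ex (t *\<^sub>R a))"
proof -
  have "exp_exists A \<gamma> x (t *\<^sub>R tan a)" if "t \<in> {0..1}" for t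
    using normalizable scaleR_in_Uc[OF assms that] linear_scale[OF linear_tangent_of[OF c0]]
    by (simp add: normalizable_at_def Uc_def)
  from radial_geodesic[OF this] show ?thesis
    by (simp add: ex_def linear_scale[OF linear_tangent_of[OF c0]])
qed

lemma ray_velocity:
  assumes "a \<in> Uc" "t \<in> {0..1}"
  shows "velocity A (\<lambda>t. ex (t *\<^sub>R a)) t = Tex (t *\<^sub>R a) a"
  using assms by (intro velocity_eq has_velocity_ex ray_has_curve_deriv scaleR_in_Uc)

lemma ex_0: "ex 0 = x"
  using ray_geodesic[OF zero_in_Uc] by (simp add: geodesic_from_def)

text \<open>Constancy of the speed, evaluated at time 0, where the ray leaves x with velocity
  \<open>tan a\<close>.\<close>

lemma ray_speed:
  assumes "a \<in> Uc" "t \<in> {0..1}"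
  shows "\<gamma> (ex (t *\<^sub>R a)) (Tex (t *\<^sub>R a) a) (Tex (t *\<^sub>R a) a) = mx a a"
  using geodesic_constant_speed[of "\<lambda>t. ex (t *\<^sub>R a)" t] ray_geodesic[OF assms(1)] assms ray_velocity
  by (simp add: geodesic_from_def mx_eq_metric)

lemma ray_geodesic_equation:
  assumes "a \<in> Uc"
  obtains \<Gamma> where "levi_civita A \<gamma> \<Gamma>"
    and "\<And>t d. t \<in> {0..1} \<Longrightarrow> d \<in> charts_at A (ex (t *\<^sub>R a)) \<Longrightarrow>
      has_curve_deriv (\<lambda>s. Tex (s *\<^sub>R a) a d)
        (- \<Gamma> d (snd d (ex (t *\<^sub>R a))) (Tex (t *\<^sub>R a) a d) (Tex (t *\<^sub>R a) a d)) t {0..1}"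
proof -
  have "geodesic A \<gamma> (\<lambda>t. ex (t *\<^sub>R a))"
    using ray_geodesic[OF assms] by (simp add: geodesic_from_def)
  from geodesic_velocity[OF this] obtain \<Gamma> where \<Gamma>: "levi_civita A \<gamma> \<Gamma>" and
    eq: "\<And>t d. t \<in> {0..1} \<Longrightarrow> d \<in> charts_at A (ex (t *\<^sub>R a)) \<Longrightarrow>
      has_curve_deriv (\<lambda>s. velocity A (\<lambda>t. ex (t *\<^sub>R a)) s d)
        (- \<Gamma> d (snd d (ex (t *\<^sub>R a))) (velocity A (\<lambda>t. ex (t *\<^sub>R a)) t d) (velocity A (\<lambda>t. ex (t *\<^sub>R a)) t d)) t {0..1}"
    by metis
  show ?thesis
  proof (rule that[OF \<Gamma>])
    fix t :: real and d assume *: "t \<in> {0..1}" "d \<in> charts_at A (ex (t *\<^sub>R a))"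
    show "has_curve_deriv (\<lambda>s. Tex (s *\<^sub>R a) a d)
        (- \<Gamma> d (snd d (ex (t *\<^sub>R a))) (Tex (t *\<^sub>R a) a d) (Tex (t *\<^sub>R a) a d)) t {0..1}"
      using has_curve_deriv_transform[OF eq[OF *] _ *(1), of "\<lambda>s. Tex (s *\<^sub>R a) a d"]
      by (simp only: ray_velocity[OF assms] ray_velocity[OF assms *(1)])
  qed
qed

text \<open>
  The exponential mapping is only \<open>C\<^sup>1\<close>, so the mixed second derivatives of
  \<open>ex (t *\<^sub>R (a + s *\<^sub>R w))\<close> used in the classical proof need not exist.  Instead \<open>s\<close> is kept finite:
  \<open>Q t s\<close> is the difference quotient of the variation and \<open>\<partial>t\<close> of \<open>lm d (Z t 0) (T t 0) (Q t s)\<close>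
  is computed exactly.  Constancy of the speed of the rays expresses it as \<open>mx a w\<close> plus small
  terms plus the term \<open>- (s / 2) * lm d (Z t s) (K t s) (K t s)\<close>, which need not be small but has
  a sign.  Taking \<open>s > 0\<close> gives one inequality and \<open>s < 0\<close> the other.
\<close>

lemma gauss_local:
  fixes a w :: 'e
  assumes a: "a \<in> Uc" and t0: "t0 \<in> {0..1}" and e: "0 < (e::real)"
  defines "G \<equiv> \<lambda>t. \<gamma> (ex (t *\<^sub>R a)) (Tex (t *\<^sub>R a) a) (Tex (t *\<^sub>R a) (t *\<^sub>R w))"
  shows "\<exists>\<delta>>0. \<forall>t1\<in>{0..1}. \<forall>t2\<in>{0..1}. \<bar>t1 - t0\<bar> < \<delta> \<and> \<bar>t2 - t0\<bar> < \<delta> \<and> t1 \<le> t2 \<longrightarrow>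
    \<bar>G t2 - G t1 - (t2 - t1) * mx a w\<bar> \<le> e * (t2 - t1)"
proof -
  obtain d where d: "d \<in> charts_at A (ex (t0 *\<^sub>R a))" by (rule chart_exists)
  \<comment> \<open>The geodesic equation is used on the central ray only; of the neighboring rays,
    only the velocity and the constancy of its length enter.\<close>
  obtain \<Gamma> where \<Gamma>: "levi_civita A \<gamma> \<Gamma>" and
    geo: "\<And>t d. t \<in> {0..1} \<Longrightarrow> d \<in> charts_at A (ex (t *\<^sub>R a)) \<Longrightarrow>
      has_curve_deriv (\<lambda>s. Tex (s *\<^sub>R a) a d)
        (- \<Gamma> d (snd d (ex (t *\<^sub>R a))) (Tex (t *\<^sub>R a) a d) (Tex (t *\<^sub>R a) a d)) t {0..1}"
    using ray_geodesic_equation[OF a] by blast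
  \<comment> \<open>The parameter s labels the ray with initial vector
    \<open>a + s *\<^sub>R w\<close>, the central ray being s = 0. In the chart d, Z is the position
    on it and T the velocity; Q and K are the difference quotients of Z and T in s.\<close>
  define E where "E b = snd d (ex b)" for b
  define Z where "Z t s = E (t *\<^sub>R (a + s *\<^sub>R w))" for t s
  define T where "T t s = Tex (t *\<^sub>R (a + s *\<^sub>R w)) (a + s *\<^sub>R w) d" for t s
  define Q where "Q t s = dir_quotient E (t *\<^sub>R a) (t *\<^sub>R w) s" for t s
  define K where "K t s = (1 / s) *\<^sub>R (T t s - T t 0)" for t s
  define D where "D t s = dir_deriv (\<lambda>y. lm d y (T t 0) (T t 0)) (Z t 0) (Q t s)" for t s
  \<comment> \<open>Found by solving the speed identity in \<open>Gs_deriv_eq\<close> for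
    \<open>lm d (Z t 0) (T t 0) (K t s)\<close>; B collects what tends to 0. The second quotient
    contains \<open>T t s - T t 0\<close>, which tends to 0, and not \<open>K t s\<close>, which
    need not have a limit: the factor s between them is absorbed by the quotient.\<close>
  define B where "B t s = (1/2) * (D t s - dir_quotient (\<lambda>y. lm d y (T t 0) (T t 0)) (Z t 0) (Q t s) s)
      - dir_quotient (\<lambda>y. lm d y (T t 0) (T t s - T t 0)) (Z t 0) (Q t s) s + (s / 2) * mx w w" for t s
  define Gs where "Gs s t = lm d (Z t 0) (T t 0) (Q t s)" for s t
  define good where "good t s \<longleftrightarrow> a + s *\<^sub>R w \<in> Uc \<and> d \<in> charts_at A (ex (t *\<^sub>R (a + s *\<^sub>R w)))" for t s
  note a0 = scaleR_in_Uc[OF a t0]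

  have ZQ: "Z t s = Z t 0 + s *\<^sub>R Q t s" if "s \<noteq> 0" for t s
    using that by (simp add: Z_def Q_def dir_quotient_def algebra_simps)
  have TK: "T t s = T t 0 + s *\<^sub>R K t s" if "s \<noteq> 0" for t s
    using that by (simp add: K_def)
  have good0: "good t 0 \<longleftrightarrow> d \<in> charts_at A (ex (t *\<^sub>R a))" for t
    using a by (simp add: good_def)
  have Z_at: "Z t s = snd d (ex (t *\<^sub>R (a + s *\<^sub>R w)))" for t s
    by (simp add: Z_def E_def)
  have speed: "lm d (Z t s) (T t s) (T t s) = mx (a + s *\<^sub>R w) (a + s *\<^sub>R w)"
    if "t \<in> {0..1}" "good t s" for t s
  proof -
    have *: "a + s *\<^sub>R w \<in> Uc" "d \<in> charts_at A (ex (t *\<^sub>R (a + s *\<^sub>R w)))"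
      using that(2) by (auto simp: good_def)
    show ?thesis
      using ray_speed[OF *(1) that(1)] metric_eq_lm[OF *(2)] Tex_in_tangent_space[OF scaleR_in_Uc[OF *(1) that(1)]]
      by (simp add: Z_at T_def)
  qed
  have Z_deriv: "has_curve_deriv (\<lambda>t. Z t s) (T t s) t {0..1}" if "t \<in> {0..1}" "good t s" for t s
  proof -
    have *: "a + s *\<^sub>R w \<in> Uc" "d \<in> charts_at A (ex (t *\<^sub>R (a + s *\<^sub>R w)))"
      using that(2) by (auto simp: good_def)
    have "has_velocity A (\<lambda>t. ex (t *\<^sub>R (a + s *\<^sub>R w))) (Tex (t *\<^sub>R (a + s *\<^sub>R w)) (a + s *\<^sub>R w)) t {0..1}"
      by (intro has_velocity_ex ray_has_curve_deriv scaleR_in_Uc that(1) *)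
    then show ?thesis
      using *(2) by (simp add: has_velocity_def Z_def E_def T_def comp_def)
  qed

  have Gs_deriv: "(Gs s has_real_derivative (1/2) * D t s + lm d (Z t 0) (T t 0) (K t s)) (at t within {0..1})"
    if t: "t \<in> {0..1}" and s: "s \<noteq> 0" "good t s" "good t 0" for t s
  proof -
    note dt = s(3)[unfolded good0]
    note bil = bilinear_lm[OF dt]
    have Z0: "Z t 0 = snd d (ex (t *\<^sub>R a))" by (simp add: Z_at)
    \<comment> \<open>For a fixed s the quotient Q is a linear combination of two rays, so its
      t-derivative is K without any exchange of limits.\<close>
    have "((\<lambda>t'. (1 / s) *\<^sub>R (curve_quotient (\<lambda>t. Z t s) t t' - curve_quotient (\<lambda>t. Z t 0) t t')) \<longlongrightarrow> K t s)
        (at t within {0..1})"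
      unfolding K_def using t s by (intro tendsto_intros has_curve_deriv_tendsto Z_deriv)
    moreover have "(1 / s) *\<^sub>R (curve_quotient (\<lambda>t. Z t s) t t' - curve_quotient (\<lambda>t. Z t 0) t t') =
        curve_quotient (\<lambda>t. Q t s) t t'" for t'
    proof -
      have Q: "Q t s = (1 / s) *\<^sub>R (Z t s - Z t 0)" for t
        using ZQ[OF s(1), of t] s(1) by simp
      show ?thesis by (simp add: curve_quotient_def Q algebra_simps)
    qed
    ultimately have Q': "has_curve_deriv (\<lambda>t. Q t s) (K t s) t {0..1}"
      by (simp add: has_curve_deriv_def)
    have T': "has_curve_deriv (\<lambda>t. T t 0) (- \<Gamma> d (Z t 0) (T t 0) (T t 0)) t {0..1}"
      using geo[OF t dt] by (simp add: T_def Z_at)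
    have "(Gs s has_real_derivative
        dir_deriv (\<lambda>y. lm d y (T t 0) (Q t s)) (Z t 0) (T t 0) +
        lm d (Z t 0) (- \<Gamma> d (Z t 0) (T t 0) (T t 0)) (Q t s) + lm d (Z t 0) (T t 0) (K t s)) (at t within {0..1})"
      unfolding Gs_def[abs_def] using t s by (intro has_curve_deriv_lm[OF dt] Z0 Z_deriv T' Q')
    \<comment> \<open>Schematically, compatibility reduces the left side to
      \<open>lm T (\<Gamma> T Q)\<close> and gives \<open>D = 2 * lm T (\<Gamma> Q T)\<close>; the
      two agree because \<Gamma> is symmetric.\<close>
    moreover have "dir_deriv (\<lambda>y. lm d y (T t 0) (Q t s)) (Z t 0) (T t 0) +
        lm d (Z t 0) (- \<Gamma> d (Z t 0) (T t 0) (T t 0)) (Q t s) = (1/2) * D t s"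
      unfolding D_def Z0 metric_compatible_lm[OF \<Gamma> dt]
      using lm_commute[OF dt] torsion_free_sym[OF \<Gamma> dt, of "T t 0" "Q t s"]
      by (simp add: bilinear_lneg[OF bil] bilinear_rneg[OF bil])
    ultimately show ?thesis by simp
  qed

  have Gs_deriv_eq: "(1/2) * D t s + lm d (Z t 0) (T t 0) (K t s) =
      mx a w + B t s - (s / 2) * lm d (Z t s) (K t s) (K t s)"
    if t: "t \<in> {0..1}" and s: "s \<noteq> 0" "good t s" "good t 0" for t s
  proof -
    have ds: "d \<in> charts_at A (ex (t *\<^sub>R (a + s *\<^sub>R w)))" using s(2) by (simp add: good_def)
    note d0 = s(3)[unfolded good0]
    note bil = bilinear_lm[OF ds, folded Z_at]
    have bil0: "bilinear (lm d (Z t 0))" using bilinear_lm[OF d0] by (simp add: Z_at)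
    have comm: "lm d (Z t s) g h = lm d (Z t s) h g" for g h using lm_commute[OF ds] by (simp add: Z_at)
    \<comment> \<open>The squared speed of the ray s, expanded around the velocity of the central
      ray; this is exact by bilinearity. Both speeds are known from their values at x, so the
      pairing of \<open>T t 0\<close> with \<open>K t s\<close> can be isolated.\<close>
    have "lm d (Z t s) (T t s) (T t s) = lm d (Z t s) (T t 0) (T t 0) + 2 * s * lm d (Z t s) (T t 0) (K t s)
        + s * s * lm d (Z t s) (K t s) (K t s)"
      unfolding TK[OF s(1)]
      by (simp add: bilinear_ladd[OF bil] bilinear_radd[OF bil] bilinear_lmul[OF bil] bilinear_rmul[OF bil]
          comm[of "K t s" "T t 0"] algebra_simps)
    moreover have "mx (a + s *\<^sub>R w) (a + s *\<^sub>R w) = mx a a + 2 * s * mx a w + s * s * mx w w"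
      by (simp add: bilinear_ladd[OF bilinear_mx] bilinear_radd[OF bilinear_mx] bilinear_lmul[OF bilinear_mx]
          bilinear_rmul[OF bilinear_mx] lm_commute[OF c0, of w a] algebra_simps)
    moreover have "mx a a = lm d (Z t 0) (T t 0) (T t 0)"
      using speed[OF t s(3)] by simp
    ultimately have 1: "2 * s * mx a w + s * s * mx w w = lm d (Z t s) (T t 0) (T t 0) - lm d (Z t 0) (T t 0) (T t 0)
        + 2 * s * lm d (Z t s) (T t 0) (K t s) + s * s * lm d (Z t s) (K t s) (K t s)"
      using speed[OF t s(2)] by simp
    have 2: "dir_quotient (\<lambda>y. lm d y (T t 0) (T t 0)) (Z t 0) (Q t s) s =
        (lm d (Z t s) (T t 0) (T t 0) - lm d (Z t 0) (T t 0) (T t 0)) / s"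
      by (simp add: dir_quotient_def flip: ZQ[OF s(1)])
    have "T t s - T t 0 = s *\<^sub>R K t s" using TK[OF s(1), of t] by simp
    then have 3: "dir_quotient (\<lambda>y. lm d y (T t 0) (T t s - T t 0)) (Z t 0) (Q t s) s =
        lm d (Z t s) (T t 0) (K t s) - lm d (Z t 0) (T t 0) (K t s)"
      using s(1) by (simp add: dir_quotient_def bilinear_rmul[OF bil] bilinear_rmul[OF bil0] algebra_simps
          flip: ZQ[OF s(1)])
    have "(lm d (Z t s) (T t 0) (T t 0) - lm d (Z t 0) (T t 0) (T t 0)) / s =
        2 * mx a w + s * mx w w - 2 * lm d (Z t s) (T t 0) (K t s) - s * lm d (Z t s) (K t s) (K t s)"
      using 1 s(1) by (simp add: field_simps)
    note 4 = 2[unfolded this]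
    show ?thesis
      unfolding B_def 4 3 by (simp add: algebra_simps)
  qed

  \<comment> \<open>The bounds must be uniform for t near t0 before s tends to 0, hence a product
    filter. It includes \<open>t = t0\<close> but excludes \<open>s = 0\<close>, where Q and K are
    no longer quotients.\<close>
  let ?N = "inf (nhds t0) (principal {0..1})"
  let ?F = "?N \<times>\<^sub>F at (0::real)"
  have ft: "(fst \<longlongrightarrow> t0) ?F" 
  proof -
    have "filterlim fst ?N ?F" by (rule filterlim_fst)
    then show ?thesis by (rule filterlim_mono) auto
  qed
  have fs: "(snd \<longlongrightarrow> 0) ?F" 
  proof -
    have "filterlim snd (at 0) ?F" by (rule filterlim_snd)
    then show ?thesis by (rule filterlim_mono) (auto simp: at_within_def)
  qed
  have fs0: "\<forall>\<^sub>F p in ?F. snd p \<noteq> 0"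
    by (rule eventually_compose_filterlim[OF _ filterlim_snd]) (simp add: eventually_at_filter)
  have fb: "((\<lambda>p. a + snd p *\<^sub>R w) \<longlongrightarrow> a) ?F"
    by (rule tendsto_eq_intros ft fs refl tendsto_scaleR_frechet | simp)+
  have fX: "((\<lambda>p. fst p *\<^sub>R (a + snd p *\<^sub>R w)) \<longlongrightarrow> t0 *\<^sub>R a) ?F"
    by (intro tendsto_intros ft fb)
  have fX0: "((\<lambda>p. fst p *\<^sub>R a) \<longlongrightarrow> t0 *\<^sub>R a) ?F"
    by (intro tendsto_intros ft)
  have ev_good: "\<forall>\<^sub>F p in ?F. good (fst p) (snd p)"
    using topological_tendstoD[OF fb open_Uc a] eventually_in_chart[OF d tendsto_ex[OF a0 fX]]
    by eventually_elim (simp add: good_def)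
  have ev_good0: "\<forall>\<^sub>F p in ?F. good (fst p) 0"
    using eventually_in_chart[OF d tendsto_ex[OF a0 fX0]] by (simp add: good0)
  note E_C1 = ex_C1_at[OF a0 d, folded E_def]
  have limZ: "((\<lambda>p. Z (fst p) 0) \<longlongrightarrow> snd d (ex (t0 *\<^sub>R a))) ?F"
    using tendsto_C1[OF E_C1 fX0] by (simp add: Z_def E_def)
  have T_eq: "T t s = dir_deriv E (t *\<^sub>R (a + s *\<^sub>R w)) (a + s *\<^sub>R w)" if "good t s" for t s
    using that by (simp add: T_def Tex_chart good_def E_def[abs_def])
  have limT: "((\<lambda>p. T (fst p) (snd p)) \<longlongrightarrow> dir_deriv E (t0 *\<^sub>R a) a) ?F"
  proof -
    have "\<forall>\<^sub>F p in ?F. dir_deriv E (fst p *\<^sub>R (a + snd p *\<^sub>R w)) (a + snd p *\<^sub>R w) = T (fst p) (snd p)"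
      using ev_good by eventually_elim (simp add: T_eq)
    then show ?thesis
      using tendsto_C1_dir_deriv[OF E_C1 fX fb] tendsto_cong by fast
  qed
  have limT0: "((\<lambda>p. T (fst p) 0) \<longlongrightarrow> dir_deriv E (t0 *\<^sub>R a) a) ?F"
  proof -
    have "\<forall>\<^sub>F p in ?F. dir_deriv E (fst p *\<^sub>R a) a = T (fst p) 0"
      using ev_good0 by eventually_elim (simp add: T_eq)
    then show ?thesis
      using tendsto_C1_dir_deriv[OF E_C1 fX0 tendsto_const] tendsto_cong by fast
  qed
  have limQ: "((\<lambda>p. Q (fst p) (snd p)) \<longlongrightarrow> dir_deriv E (t0 *\<^sub>R a) (t0 *\<^sub>R w)) ?F"
    unfolding Q_def by (intro tendsto_dir_quotient_strict[OF E_C1 fX0 _ fs fs0] tendsto_intros ft)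
  have "((\<lambda>p. B (fst p) (snd p)) \<longlongrightarrow> 0) ?F"
  proof -
    let ?T = "dir_deriv E (t0 *\<^sub>R a) a" and ?Q = "dir_deriv E (t0 *\<^sub>R a) (t0 *\<^sub>R w)"
    let ?D = "dir_deriv (\<lambda>y. lm d y ?T ?T) (snd d (ex (t0 *\<^sub>R a))) ?Q"
    have limTT: "((\<lambda>p. T (fst p) (snd p) - T (fst p) 0) \<longlongrightarrow> 0) ?F"
      using tendsto_diff[OF limT limT0] by simp
    have "((\<lambda>p. D (fst p) (snd p)) \<longlongrightarrow> ?D) ?F"
      unfolding D_def by (intro tendsto_lm_dir_deriv[OF d] limZ limT0 limQ)
    moreover have "((\<lambda>p. dir_quotient (\<lambda>y. lm d y (T (fst p) 0) (T (fst p) 0)) (Z (fst p) 0) (Q (fst p) (snd p)) (snd p))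
        \<longlongrightarrow> ?D) ?F"
      by (intro tendsto_lm_dir_quotient[OF d] limZ limT0 limQ fs fs0)
    moreover have "((\<lambda>p. dir_quotient (\<lambda>y. lm d y (T (fst p) 0) (T (fst p) (snd p) - T (fst p) 0))
        (Z (fst p) 0) (Q (fst p) (snd p)) (snd p)) \<longlongrightarrow> dir_deriv (\<lambda>y. lm d y ?T 0) (snd d (ex (t0 *\<^sub>R a))) ?Q) ?F"
      by (intro tendsto_lm_dir_quotient[OF d] limZ limT0 limQ fs fs0 limTT)
    ultimately have "((\<lambda>p. B (fst p) (snd p)) \<longlongrightarrow> (1/2) * (?D - ?D) -
        dir_deriv (\<lambda>y. lm d y ?T 0) (snd d (ex (t0 *\<^sub>R a))) ?Q + (0 / 2) * mx w w) ?F"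
      unfolding B_def by (intro tendsto_intros fs) auto
    then show ?thesis by (simp add: lm_dir_deriv_zero_direction[OF d])
  qed
  then have "\<forall>\<^sub>F p in ?F. \<bar>B (fst p) (snd p)\<bar> < e"
    using e by (auto simp: dist_real_def dest: tendstoD)
  then have "\<forall>\<^sub>F p in ?F. good (fst p) (snd p) \<and> good (fst p) 0 \<and> \<bar>B (fst p) (snd p)\<bar> < e"
    using ev_good ev_good0 by eventually_elim simp
  then obtain P R where P: "eventually P ?N" and R: "eventually R (at 0)"
    and PR: "\<And>t s. P t \<Longrightarrow> R s \<Longrightarrow> good t s \<and> good t 0 \<and> \<bar>B t s\<bar> < e"
    unfolding eventually_prod_filter by auto
  obtain \<delta> where \<delta>: "0 < \<delta>" "\<And>t. \<bar>t - t0\<bar> < \<delta> \<Longrightarrow> t \<in> {0..1} \<Longrightarrow> P t"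
    using P unfolding eventually_inf_principal eventually_nhds_metric by (auto simp: dist_real_def)

  have Gs_lim: "((\<lambda>s. Gs s t) \<longlongrightarrow> G t) (at 0)" if t: "t \<in> {0..1}" "good t 0" for t
  proof -
    note dt = t(2)[unfolded good0] and at = scaleR_in_Uc[OF a t(1)]
    have "((\<lambda>s. lm d (Z t 0) (T t 0) (Q t s)) \<longlongrightarrow>
        lm d (snd d (ex (t *\<^sub>R a))) (T t 0) (dir_deriv E (t *\<^sub>R a) (t *\<^sub>R w))) (at 0)"
      unfolding Q_def using C1_dir_quotient[OF ex_C1_at(1,3)[OF at dt], folded E_def]
      by (intro tendsto_lm[OF dt] tendsto_const) (simp_all add: Z_at)
    moreover have "G t = lm d (snd d (ex (t *\<^sub>R a))) (T t 0) (dir_deriv E (t *\<^sub>R a) (t *\<^sub>R w))"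
      using metric_eq_lm[OF dt] Tex_in_tangent_space[OF at] dt
      by (simp add: G_def T_def Tex_chart E_def[abs_def])
    ultimately show ?thesis by (simp add: Gs_def)
  qed

  have "\<bar>G t2 - G t1 - (t2 - t1) * mx a w\<bar> \<le> e * (t2 - t1)"
    if t: "t1 \<in> {0..1}" "t2 \<in> {0..1}" "\<bar>t1 - t0\<bar> < \<delta>" "\<bar>t2 - t0\<bar> < \<delta>" "t1 \<le> t2" for t1 t2
  proof -
    have Pt: "P t \<and> t \<in> {0..1}" if "t \<in> {t1..t2}" for t
      using t that by (intro conjI \<delta>(2)) auto
    have deriv: "(Gs s has_real_derivative mx a w + B t s - (s / 2) * lm d (Z t s) (K t s) (K t s)) (at t within {t1..t2})"
      if "t \<in> {t1..t2}" "R s" "s \<noteq> 0" for t s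
    proof -
      have "{t1..t2} \<subseteq> {0..1}" using t by auto
      then show ?thesis
        using Gs_deriv[of t s] Gs_deriv_eq[of t s] PR[of t s] Pt[OF that(1)] that
        by (auto intro: has_field_derivative_subset)
    qed
    have KK: "0 \<le> lm d (Z t s) (K t s) (K t s)" if "t \<in> {t1..t2}" "R s" for t s
      using lm_nonneg[of d "ex (t *\<^sub>R (a + s *\<^sub>R w))"] PR[of t s] Pt[OF that(1)] that
      by (simp add: good_def Z_at)
    have cont: "continuous_on {t1..t2} (Gs s)" if "R s" "s \<noteq> 0" for s
      using deriv that by (meson DERIV_continuous continuous_on_eq_continuous_within)
    \<comment> \<open>The limit in s is two-sided, so the upper bound from s > 0 and the lower bound
      from s < 0 pass to the same increment of G.\<close>
    have lim: "((\<lambda>s. Gs s t2 - Gs s t1) \<longlongrightarrow> G t2 - G t1) (at 0)"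
    proof -
      have "\<forall>\<^sub>F s in at 0. R s" by (rule R)
      then obtain s where "R s" using eventually_happens by fastforce
      then show ?thesis
        using Pt[of t1] Pt[of t2] PR[of t1 s] PR[of t2 s] t(5) by (intro tendsto_diff Gs_lim) auto
    qed
    have upper: "Gs s t2 - Gs s t1 \<le> (mx a w + e) * (t2 - t1)" if s: "R s" "0 < s" for s
    proof -
      have "Gs s t2 - (mx a w + e) * t2 \<le> Gs s t1 - (mx a w + e) * t1"
      proof (rule DERIV_nonpos_imp_decreasing_open[OF t(5)])
        fix t assume "t1 < t" "t < t2"
        then have tt: "t \<in> {t1..t2}" "at t within {t1..t2} = at t" by (auto simp: at_within_Icc_at)
        have "((\<lambda>t. Gs s t - (mx a w + e) * t) has_real_derivative
            mx a w + B t s - (s / 2) * lm d (Z t s) (K t s) (K t s) - (mx a w + e)) (at t)"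
          using deriv[OF tt(1) s(1)] s(2) tt(2) by (auto intro!: derivative_eq_intros)
        moreover have "mx a w + B t s - (s / 2) * lm d (Z t s) (K t s) (K t s) - (mx a w + e) \<le> 0"
          using PR[of t s] Pt[OF tt(1)] s mult_nonneg_nonneg[OF _ KK[OF tt(1) s(1)], of "s / 2"] by auto
        ultimately show "\<exists>y. ((\<lambda>t. Gs s t - (mx a w + e) * t) has_real_derivative y) (at t) \<and> y \<le> 0"
          by blast
      qed (use cont s in \<open>auto intro!: continuous_intros\<close>)
      then show ?thesis by (simp add: algebra_simps)
    qed
    have lower: "(mx a w - e) * (t2 - t1) \<le> Gs s t2 - Gs s t1" if s: "R s" "s < 0" for s
    proof -
      have "Gs s t1 - (mx a w - e) * t1 \<le> Gs s t2 - (mx a w - e) * t2"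
      proof (rule DERIV_nonneg_imp_increasing_open[OF t(5)])
        fix t assume "t1 < t" "t < t2"
        then have tt: "t \<in> {t1..t2}" "at t within {t1..t2} = at t" by (auto simp: at_within_Icc_at)
        have "((\<lambda>t. Gs s t - (mx a w - e) * t) has_real_derivative
            mx a w + B t s - (s / 2) * lm d (Z t s) (K t s) (K t s) - (mx a w - e)) (at t)"
          using deriv[OF tt(1) s(1)] s(2) tt(2) by (auto intro!: derivative_eq_intros)
        moreover have "mx a w + B t s - (s / 2) * lm d (Z t s) (K t s) (K t s) - (mx a w - e) \<ge> 0"
          using PR[of t s] Pt[OF tt(1)] s mult_nonneg_nonneg[OF _ KK[OF tt(1) s(1)], of "- s / 2"] by auto
        ultimately show "\<exists>y. ((\<lambda>t. Gs s t - (mx a w - e) * t) has_real_derivative y) (at t) \<and> 0 \<le> y"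
          by blast
      qed (use cont s in \<open>auto intro!: continuous_intros\<close>)
      then show ?thesis by (simp add: algebra_simps)
    qed
    have "G t2 - G t1 \<le> (mx a w + e) * (t2 - t1)"
    proof (rule tendsto_upperbound)
      show "((\<lambda>s. Gs s t2 - Gs s t1) \<longlongrightarrow> G t2 - G t1) (at_right 0)"
        using lim by (rule tendsto_within_subset) simp
      show "\<forall>\<^sub>F s in at_right 0. Gs s t2 - Gs s t1 \<le> (mx a w + e) * (t2 - t1)"
        using R unfolding eventually_at_filter by eventually_elim (auto intro: upper)
    qed simp
    moreover have "(mx a w - e) * (t2 - t1) \<le> G t2 - G t1"
    proof (rule tendsto_lowerbound)
      show "((\<lambda>s. Gs s t2 - Gs s t1) \<longlongrightarrow> G t2 - G t1) (at_left 0)"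
        using lim by (rule tendsto_within_subset) simp
      show "\<forall>\<^sub>F s in at_left 0. (mx a w - e) * (t2 - t1) \<le> Gs s t2 - Gs s t1"
        using R unfolding eventually_at_filter by eventually_elim (auto intro: lower)
    qed simp
    ultimately show ?thesis by (auto simp: abs_le_iff algebra_simps)
  qed
  then show ?thesis using \<delta>(1) by blast
qed

text \<open>The estimates of \<open>gauss_local\<close> add up over adjacent intervals, so by
  compactness they hold on all of \<open>{0..1}\<close> with error e, for every e > 0. Since all
  rays start at x, the variation \<open>t *\<^sub>R w\<close> vanishes at t = 0 and so does G
  there.\<close>

theorem gauss_lemma:
  assumes a: "a \<in> Uc"
  shows "\<gamma> (ex a) (Tex a a) (Tex a w) = mx a w"
proof -
  define G where "G t = \<gamma> (ex (t *\<^sub>R a)) (Tex (t *\<^sub>R a) a) (Tex (t *\<^sub>R a) (t *\<^sub>R w))" for t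
  have "\<bar>G 1 - G 0 - mx a w\<bar> \<le> 0"
  proof (rule field_le_epsilon)
    fix e :: real assume "0 < e"
    define P where "P t1 t2 \<longleftrightarrow> (0 \<le> t1 \<and> t1 \<le> t2 \<and> t2 \<le> 1 \<longrightarrow>
        \<bar>G t2 - G t1 - (t2 - t1) * mx a w\<bar> \<le> e * (t2 - t1))" for t1 t2
    have "P 0 1"
    proof (rule Bolzano[where P = P])
      fix t1 t2 t3 assume "P t1 t2" "P t2 t3" "t1 \<le> t2" "t2 \<le> t3"
      then show "P t1 t3"
        unfolding P_def abs_le_iff by (auto simp: algebra_simps)
    next
      fix t :: real assume "0 \<le> t" "t \<le> 1"
      then obtain \<delta> where "\<delta> > 0" and \<delta>: "\<forall>t1\<in>{0..1}. \<forall>t2\<in>{0..1}. \<bar>t1 - t\<bar> < \<delta> \<and> \<bar>t2 - t\<bar> < \<delta> \<and> t1 \<le> t2 \<longrightarrow>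
          \<bar>G t2 - G t1 - (t2 - t1) * mx a w\<bar> \<le> e * (t2 - t1)"
        using gauss_local[OF a _ \<open>0 < e\<close>, of t w] unfolding G_def by auto
      have "P t1 t2" if "t1 \<le> t" "t \<le> t2" "t2 - t1 < \<delta>" for t1 t2
        unfolding P_def
      proof
        assume "0 \<le> t1 \<and> t1 \<le> t2 \<and> t2 \<le> 1"
        then show "\<bar>G t2 - G t1 - (t2 - t1) * mx a w\<bar> \<le> e * (t2 - t1)"
          using that by (intro \<delta>[rule_format]) auto
      qed
      then show "\<exists>d>0. \<forall>t1 t2. t1 \<le> t \<and> t \<le> t2 \<and> t2 - t1 < d \<longrightarrow> P t1 t2"
        using \<open>\<delta> > 0\<close> by blast
    qed simp
    then show "\<bar>G 1 - G 0 - mx a w\<bar> \<le> 0 + e" by (simp add: P_def)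
  qed
  moreover have "G 0 = 0"
  proof -
    have "\<gamma> (ex 0) (Tex 0 a) (Tex 0 0) = 0"
    proof -
      obtain d where d: "d \<in> charts_at A (ex 0)" by (rule chart_exists)
      then show ?thesis
        using metric_eq_lm[OF d] Tex_in_tangent_space[OF zero_in_Uc] linear_0[OF linear_Tex_chart[OF zero_in_Uc d]]
          bilinear_rzero[OF bilinear_lm[OF d]] by simp
    qed
    then show ?thesis by (simp add: G_def)
  qed
  ultimately show ?thesis by (simp add: G_def)
qed

end

section \<open>Lengths of piecewise smooth paths\<close>

lemma partition_cases:
  fixes \<tau> :: "nat \<Rightarrow> real"
  assumes "\<tau> 0 \<le> t" "t \<le> \<tau> n"
  shows "t \<in> \<tau> ` {..n} \<or> (\<exists>i<n. \<tau> i < t \<and> t < \<tau> (Suc i))"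
  using assms
proof (induction n)
  case (Suc n)
  then show ?case
    by (cases "t \<le> \<tau> n") (auto simp: less_Suc_eq le_less atMost_Suc)
qed auto

lemma partition_mono:
  fixes \<tau> :: "nat \<Rightarrow> real"
  assumes "\<And>i. i < n \<Longrightarrow> \<tau> i < \<tau> (Suc i)" "i \<le> j" "j \<le> n"
  shows "\<tau> i \<le> \<tau> j"
  using assms(2,3)
proof (induction j rule: dec_induct)
  case (step j)
  then show ?case using assms(1)[of j] by simp
qed simp

lemma integrable_on_partition:
  fixes \<tau> :: "nat \<Rightarrow> real" and f :: "real \<Rightarrow> real"
  assumes "\<And>i. i < n \<Longrightarrow> \<tau> i < \<tau> (Suc i)" "\<And>i. i < n \<Longrightarrow> f integrable_on {\<tau> i..\<tau> (Suc i)}"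
  shows "f integrable_on {\<tau> 0..\<tau> n}"
  using assms
proof (induction n)
  case (Suc n)
  have "f integrable_on {\<tau> 0..\<tau> n}"
    by (rule Suc.IH) (use Suc.prems in auto)
  moreover have "\<tau> 0 \<le> \<tau> n"
    by (rule partition_mono[of "Suc n"]) (use Suc.prems in auto)
  moreover have "\<tau> n \<le> \<tau> (Suc n)" "f integrable_on {\<tau> n..\<tau> (Suc n)}"
    using Suc.prems(1)[of n] Suc.prems(2)[of n] by (simp_all add: less_imp_le)
  ultimately show ?case
    using Henstock_Kurzweil_Integration.integrable_combine by blast
qed (use integrable_on_refl[of f "\<tau> 0"] in simp)

context weak_riemannian
begin

text \<open>Each chart supplies a derivative that is continuous on the preimage of its domain only.
  This preimage is relatively open, so continuity of the speed at t can be checked in a single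
  chart.\<close>

lemma C1_curve_velocity:
  assumes C1: "C1_curve A a b \<eta>" and cont: "continuous_on {a..b} \<eta>" and "a < b"
  obtains v where "\<And>t. t \<in> {a..b} \<Longrightarrow> has_velocity A \<eta> (v t) t {a..b}"
    and "continuous_on {a..b} (\<lambda>t. metric_norm \<gamma> (\<eta> t) (v t))"
proof -
  have lim: "(\<eta> \<longlongrightarrow> \<eta> t) (at t within {a..b})" if "t \<in> {a..b}" for t
    using cont that by (simp add: continuous_on_def)
  have "\<exists>v. has_velocity A \<eta> v t {a..b}" if t: "t \<in> {a..b}" for t
  proof -
    obtain d where d: "d \<in> charts_at A (\<eta> t)" by (rule chart_exists)
    then obtain u' where "has_curve_deriv (snd d \<circ> \<eta>) (u' t) t {a..b}"
      using C1 t unfolding C1_curve_def charts_at_def by blast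
    then show ?thesis using has_velocityI[OF d _ lim[OF t]] by blast
  qed
  then obtain v where v: "\<And>t. t \<in> {a..b} \<Longrightarrow> has_velocity A \<eta> (v t) t {a..b}"
    by metis
  have "continuous_on {a..b} (\<lambda>t. metric_norm \<gamma> (\<eta> t) (v t))"
    unfolding continuous_on_def
  proof
    fix t assume t: "t \<in> {a..b}"
    obtain d where d: "d \<in> charts_at A (\<eta> t)" by (rule chart_exists)
    let ?W = "{t \<in> {a..b}. \<eta> t \<in> fst d}"
    obtain u' where u'_cont: "continuous_on ?W u'"
      and u': "\<And>t. t \<in> {a..b} \<Longrightarrow> \<eta> t \<in> fst d \<Longrightarrow> has_curve_deriv (snd d \<circ> \<eta>) (u' t) t {a..b}"
      using C1 d unfolding C1_curve_def charts_at_def by blast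
    have ev: "\<forall>\<^sub>F s in at t within {a..b}. d \<in> charts_at A (\<eta> s)"
      by (rule eventually_in_chart[OF d lim[OF t]])
    have "(u' \<longlongrightarrow> u' t) (at t within ?W)"
      using u'_cont t d by (simp add: continuous_on_def charts_at_def)
    moreover have "\<forall>\<^sub>F s in at t. s \<in> ?W \<longleftrightarrow> s \<in> {a..b}"
      using ev unfolding eventually_at_filter by eventually_elim (auto simp: charts_at_def)
    ultimately have u'_lim: "(u' \<longlongrightarrow> u' t) (at t within {a..b})"
      by (rule Lim_transform_within_set)
    have norm_eq: "metric_norm \<gamma> (\<eta> s) (v s) = sqrt (lm d (snd d (\<eta> s)) (u' s) (u' s))"
      if "s \<in> {a..b}" "d \<in> charts_at A (\<eta> s)" for s
    proof -
      have "v s d = u' s"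
        using v[OF that(1)] u'[OF that(1)] that at_within_Icc_not_bot[OF \<open>a < b\<close> that(1)] has_curve_deriv_unique
        unfolding has_velocity_def charts_at_def by blast
      then show ?thesis
        using metric_eq_lm[OF that(2), of "v s" "v s"] v[OF that(1)] by (simp add: metric_norm_def has_velocity_def)
    qed
    have "((\<lambda>s. sqrt (lm d (snd d (\<eta> s)) (u' s) (u' s))) \<longlongrightarrow> sqrt (lm d (snd d (\<eta> t)) (u' t) (u' t))) (at t within {a..b})"
      by (intro tendsto_real_sqrt tendsto_lm[OF d] chart_tendsto[OF d] lim t u'_lim)
    moreover have "\<forall>\<^sub>F s in at t within {a..b}. sqrt (lm d (snd d (\<eta> s)) (u' s) (u' s)) = metric_norm \<gamma> (\<eta> s) (v s)"
      using ev unfolding eventually_at_filter by eventually_elim (simp add: norm_eq)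
    ultimately show "((\<lambda>t. metric_norm \<gamma> (\<eta> t) (v t)) \<longlongrightarrow> metric_norm \<gamma> (\<eta> t) (v t)) (at t within {a..b})"
      unfolding norm_eq[OF t d] using tendsto_cong by fast
  qed
  then show ?thesis using v that by blast
qed

text \<open>In the interior of a piece, the derivative within the closed piece agrees with the one
  within \<open>{0..1}\<close> that defines \<open>velocity\<close>. S is the set of break points;
  the speed of a piece extends continuously to its end points, which makes l integrable.\<close>

lemma piecewise_C1_speed:
  assumes "piecewise_C1_path A \<eta>"
  defines "l \<equiv> \<lambda>t. metric_norm \<gamma> (\<eta> t) (velocity A \<eta> t)"
  obtains S where "finite S" "{0, 1} \<subseteq> S" "l integrable_on {0..1}"
    and "\<And>t. t \<in> {0..1} - S \<Longrightarrow> has_velocity A \<eta> (velocity A \<eta> t) t {0..1}"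
    and "\<And>t. t \<in> {0..1} - S \<Longrightarrow> isCont l t"
proof -
  obtain n \<tau> where \<tau>: "\<tau> 0 = 0" "\<tau> n = 1" "\<And>i. i < n \<Longrightarrow> \<tau> i < \<tau> (Suc i)"
    "\<And>i. i < n \<Longrightarrow> C1_curve A (\<tau> i) (\<tau> (Suc i)) \<eta>"
    using assms(1) unfolding piecewise_C1_path_def by blast
  have sub: "{\<tau> i..\<tau> (Suc i)} \<subseteq> {0..1}" if "i < n" for i
    using partition_mono[of n \<tau> 0 i] partition_mono[of n \<tau> "Suc i" n] that \<tau>(1-3) by auto
  have cont: "continuous_on {0..1} \<eta>"
    using assms(1) by (simp add: piecewise_C1_path_def path_def)
  have piece: "\<exists>v. (\<forall>t\<in>{\<tau> i<..<\<tau> (Suc i)}. has_velocity A \<eta> (velocity A \<eta> t) t {0..1} \<and> v t = velocity A \<eta> t) \<and>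
      continuous_on {\<tau> i..\<tau> (Suc i)} (\<lambda>t. metric_norm \<gamma> (\<eta> t) (v t))" if i: "i < n" for i
  proof -
    obtain v where v: "\<And>t. t \<in> {\<tau> i..\<tau> (Suc i)} \<Longrightarrow> has_velocity A \<eta> (v t) t {\<tau> i..\<tau> (Suc i)}"
      "continuous_on {\<tau> i..\<tau> (Suc i)} (\<lambda>t. metric_norm \<gamma> (\<eta> t) (v t))"
      using C1_curve_velocity[OF \<tau>(4)[OF i] continuous_on_subset[OF cont sub[OF i]] \<tau>(3)[OF i]] by blast
    have "has_velocity A \<eta> (v t) t {0..1} \<and> t \<in> {0..1}" if t: "t \<in> {\<tau> i<..<\<tau> (Suc i)}" for t
    proof -
      have "0 < t" "t < 1" using t sub[OF i] \<tau>(3)[OF i] by auto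
      then have "at t within {\<tau> i..\<tau> (Suc i)} = at t within {0..1}"
        using t by (simp add: at_within_Icc_at)
      then show ?thesis
        using v(1)[of t] t \<open>0 < t\<close> \<open>t < 1\<close> by (simp add: has_velocity_def has_curve_deriv_def)
    qed
    then show ?thesis using velocity_eq v(2) by metis
  qed
  have l_integrable: "l integrable_on {\<tau> i..\<tau> (Suc i)}" if i: "i < n" for i
  proof -
    obtain v where v: "\<And>t. t \<in> {\<tau> i<..<\<tau> (Suc i)} \<Longrightarrow> v t = velocity A \<eta> t"
      "continuous_on {\<tau> i..\<tau> (Suc i)} (\<lambda>t. metric_norm \<gamma> (\<eta> t) (v t))"
      using piece[OF i] by blast
    show ?thesis
    proof (rule integrable_spike_finite)
      show "finite {\<tau> i, \<tau> (Suc i)}" by simp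
      show "(\<lambda>t. metric_norm \<gamma> (\<eta> t) (v t)) integrable_on {\<tau> i..\<tau> (Suc i)}"
        using v(2) by (rule integrable_continuous_real)
      show "l t = metric_norm \<gamma> (\<eta> t) (v t)" if "t \<in> {\<tau> i..\<tau> (Suc i)} - {\<tau> i, \<tau> (Suc i)}" for t
        using v(1)[of t] that by (simp add: l_def)
    qed
  qed
  show ?thesis
  proof (rule that)
    show "finite (\<tau> ` {..n})" by simp
    show "{0, 1} \<subseteq> \<tau> ` {..n}" using \<tau>(1,2) by (metis atMost_iff empty_subsetI imageI insert_subset le0 order_refl)
    show "l integrable_on {0..1}"
      using integrable_on_partition[of n \<tau> l] \<tau>(1-3) l_integrable by simp
  next
    fix t assume t: "t \<in> {0..1} - \<tau> ` {..n}"
    then obtain i where i: "i < n" "t \<in> {\<tau> i<..<\<tau> (Suc i)}"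
      using partition_cases[of \<tau> t n] \<tau>(1,2) by auto
    then obtain v where v: "\<And>t. t \<in> {\<tau> i<..<\<tau> (Suc i)} \<Longrightarrow> has_velocity A \<eta> (velocity A \<eta> t) t {0..1} \<and> v t = velocity A \<eta> t"
      "continuous_on {\<tau> i..\<tau> (Suc i)} (\<lambda>t. metric_norm \<gamma> (\<eta> t) (v t))"
      using piece by blast
    show "has_velocity A \<eta> (velocity A \<eta> t) t {0..1}" using v(1) i(2) by blast
    have "continuous_on {\<tau> i<..<\<tau> (Suc i)} (\<lambda>t. metric_norm \<gamma> (\<eta> t) (v t))"
      using v(2) by (rule continuous_on_subset) auto
    then have "continuous_on {\<tau> i<..<\<tau> (Suc i)} l"
      by (rule continuous_on_eq) (use v(1) in \<open>simp add: l_def\<close>)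
    then show "isCont l t"
      using i(2) by (simp add: continuous_on_eq_continuous_at[OF open_greaterThanLessThan])
  qed
qed

text \<open>The remainder of \<open>b\<close> after projection to \<open>a\<close>: its sign is the Cauchy-Schwarz inequality.\<close>

lemma lm_residual:
  assumes p: "p \<in> charts_at A q" and a: "lm p (snd p q) a a \<noteq> 0"
  defines "g \<equiv> lm p (snd p q)"
  shows "g (b - (g a b / g a a) *\<^sub>R a) (b - (g a b / g a a) *\<^sub>R a) = g b b - (g a b)\<^sup>2 / g a a"
proof -
  have bil: "bilinear g" unfolding g_def by (rule bilinear_lm[OF p])
  have "g b a = g a b" unfolding g_def by (rule lm_commute[OF p])
  then show ?thesis
    using a unfolding g_def[symmetric]
    by (simp add: bilinear_lsub[OF bil] bilinear_rsub[OF bil] bilinear_lmul[OF bil] bilinear_rmul[OF bil]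
        power2_eq_square)
qed

lemma lm_Cauchy_Schwarz:
  assumes "p \<in> charts_at A q"
  shows "\<bar>lm p (snd p q) a b\<bar> \<le> sqrt (lm p (snd p q) a a) * sqrt (lm p (snd p q) b b)"
proof -
  let ?g = "lm p (snd p q)"
  have "(?g a b)\<^sup>2 \<le> ?g a a * ?g b b"
  proof (cases "a = 0")
    case True
    then show ?thesis by (simp add: bilinear_lzero[OF bilinear_lm[OF assms]])
  next
    case False
    then have pos: "0 < ?g a a" by (rule lm_pos[OF assms])
    have "0 \<le> ?g b b - (?g a b)\<^sup>2 / ?g a a"
      using lm_residual[OF assms, of a b] lm_nonneg[OF assms] pos by (metis less_irrefl)
    then show ?thesis using pos by (simp add: field_simps)
  qed
  then show ?thesis
    using real_sqrt_le_mono[of "(?g a b)\<^sup>2" "?g a a * ?g b b"] by (simp add: real_sqrt_mult)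
qed

end

section \<open>Minimality of radial geodesics\<close>

context normal_neighborhood
begin

text \<open>Differentiability of the inverse exponential mapping enters here: it carries the
  velocity of a path over to normal coordinates.\<close>

lemma has_curve_deriv_lg:
  assumes \<eta>: "has_velocity A \<eta> v t S" "\<eta> t \<in> V" "(\<eta> \<longlongrightarrow> \<eta> t) (at t within S)"
  obtains k where "has_curve_deriv (\<lambda>s. lg (\<eta> s)) k t S"
proof -
  obtain d where d: "d \<in> charts_at A (\<eta> t)" by (rule chart_exists)
  have dA: "d \<in> A" "\<eta> t \<in> fst d" using d by (auto simp: charts_at_def)
  let ?k = "dir_deriv (\<lambda>z. lg (chart_inv d z)) ((snd d \<circ> \<eta>) t) (v d)"
  have "has_curve_deriv ((\<lambda>z. lg (chart_inv d z)) \<circ> (snd d \<circ> \<eta>)) ?k t S"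
    using \<eta> d dA by (intro has_curve_deriv_compose[OF lg_C1[OF dA(1)]]) (auto simp: has_velocity_def)
  moreover have "\<forall>\<^sub>F s in at t within S. ((\<lambda>z. lg (chart_inv d z)) \<circ> (snd d \<circ> \<eta>)) s = lg (\<eta> s)"
    using eventually_in_chart[OF d \<eta>(3)] by eventually_elim (simp add: charts_at_def)
  moreover have "((\<lambda>z. lg (chart_inv d z)) \<circ> (snd d \<circ> \<eta>)) t = lg (\<eta> t)"
    using dA by simp
  ultimately have "has_curve_deriv (\<lambda>s. lg (\<eta> s)) ?k t S"
    by (simp only: has_curve_deriv_cong)
  then show ?thesis by (rule that)
qed

lemma has_real_derivative_mx:
  assumes "has_curve_deriv a a' t S" "has_curve_deriv b b' t S"
  shows "((\<lambda>t. mx (a t) (b t)) has_real_derivative mx a' (b t) + mx (a t) b') (at t within S)"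
proof -
  have "has_curve_deriv (\<lambda>t. snd c0 x) 0 t S"
    by (simp add: has_curve_deriv_def curve_quotient_def[abs_def])
  moreover have "dir_deriv (\<lambda>y. lm c0 y (a t) (b t)) (snd c0 x) 0 = 0"
    by (rule dir_deriv_eqI) (simp add: dir_quotient_def[abs_def])
  ultimately show ?thesis
    using has_curve_deriv_lm[OF c0, of "\<lambda>t. snd c0 x"] assms by fastforce
qed

end

section \<open>Paths in normal coordinates\<close>

locale normal_path = normal_neighborhood A \<gamma> x U V c0
  for A :: "('m::t2_space, 'e::frechet_space) chart set" and \<gamma> :: "('m, 'e) tensor2" and x U V c0 +
  fixes \<eta> :: "real \<Rightarrow> 'm" and y :: 'm
  assumes \<eta>: "\<eta> \<in> paths_in A V x y"
begin

definition w :: "real \<Rightarrow> 'e"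
  where "w t = lg (\<eta> t)"

definition r :: "real \<Rightarrow> real"
  where "r t = sqrt (mx (w t) (w t))"

definition l :: "real \<Rightarrow> real"
  where "l t = metric_norm \<gamma> (\<eta> t) (velocity A \<eta> t)"

lemma \<eta>_in_V: "t \<in> {0..1} \<Longrightarrow> \<eta> t \<in> V"
  using \<eta> by (auto simp: paths_in_def path_image_def)

lemma continuous_on_\<eta>: "continuous_on {0..1} \<eta>"
  using \<eta> by (simp add: paths_in_def piecewise_C1_path_def path_def)

lemma w_in_Uc: "t \<in> {0..1} \<Longrightarrow> w t \<in> Uc"
  by (simp add: w_def lg_in_Uc \<eta>_in_V)

lemma ex_w: "t \<in> {0..1} \<Longrightarrow> ex (w t) = \<eta> t"
  by (simp add: w_def ex_lg \<eta>_in_V)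

lemma w_0: "w 0 = 0"
  using \<eta> lg_ex[OF zero_in_Uc] by (simp add: w_def paths_in_def pathstart_def ex_0)

lemma w_1: "w 1 = lg y"
  using \<eta> by (simp add: w_def paths_in_def pathfinish_def)

lemma mx_nonneg: "0 \<le> mx a a"
  by (rule lm_nonneg[OF c0])

lemma r_nonneg: "0 \<le> r t"
  by (simp add: r_def mx_nonneg)

lemma r_square: "r t * r t = mx (w t) (w t)"
  by (simp add: r_def mx_nonneg)

lemma speed_regular:
  obtains S where "finite S" "{0, 1} \<subseteq> S" "l integrable_on {0..1}"
    and "\<And>t. t \<in> {0..1} - S \<Longrightarrow> has_velocity A \<eta> (velocity A \<eta> t) t {0..1}"
    and "\<And>t. t \<in> {0..1} - S \<Longrightarrow> isCont l t"
proof (rule piecewise_C1_speed[of \<eta>])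
  show "piecewise_C1_path A \<eta>" using \<eta> by (simp add: paths_in_def)
qed (rule that, (assumption | simp add: l_def[abs_def])+)

lemma l_nonneg: "t \<in> {0..1} \<Longrightarrow> has_velocity A \<eta> (velocity A \<eta> t) t {0..1} \<Longrightarrow> 0 \<le> l t"
proof -
  obtain d where d: "d \<in> charts_at A (\<eta> t)" by (rule chart_exists)
  assume "has_velocity A \<eta> (velocity A \<eta> t) t {0..1}"
  then show ?thesis
    using metric_eq_lm[OF d] lm_nonneg[OF d] by (simp add: l_def metric_norm_def has_velocity_def)
qed

lemma continuous_on_w: "continuous_on {0..1} w"
  unfolding w_def
  by (rule continuous_on_compose2[OF continuous_on_lg continuous_on_\<eta>]) (use \<eta>_in_V in auto)

lemma continuous_on_mx_w:
  assumes "continuous_on S b" "S \<subseteq> {0..1}"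
  shows "continuous_on S (\<lambda>t. mx (w t) (b t))"
  unfolding continuous_on_def
proof
  fix t assume "t \<in> S"
  then show "((\<lambda>t. mx (w t) (b t)) \<longlongrightarrow> mx (w t) (b t)) (at t within S)"
    using assms continuous_on_subset[OF continuous_on_w assms(2)]
    by (intro tendsto_lm[OF c0] tendsto_const) (auto simp: continuous_on_def)
qed

text \<open>The path is \<open>ex\<close> after w, and a velocity is unique; hence the differential
  of \<open>ex\<close> sends the derivative of w to the velocity of the path.\<close>

lemma w_velocity:
  assumes "t \<in> {0..1}" "has_velocity A \<eta> (velocity A \<eta> t) t {0..1}"
  obtains k where "has_curve_deriv w k t {0..1}" "Tex (w t) k = velocity A \<eta> t"
proof -
  have "(\<eta> \<longlongrightarrow> \<eta> t) (at t within {0..1})"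
    using continuous_on_\<eta> assms(1) by (simp add: continuous_on_def)
  from has_curve_deriv_lg[OF assms(2) \<eta>_in_V[OF assms(1)] this]
  obtain k where k: "has_curve_deriv w k t {0..1}"
    unfolding w_def .
  have "has_velocity A (\<lambda>s. ex (w s)) (Tex (w t) k) t {0..1}"
    by (rule has_velocity_ex[OF k w_in_Uc[OF assms(1)]])
  from velocity_eq[OF this assms(1)] have "velocity A (\<lambda>s. ex (w s)) t = Tex (w t) k" .
  moreover have "velocity A (\<lambda>s. ex (w s)) t = velocity A \<eta> t"
    by (rule velocity_transform[OF ex_w assms(1)])
  ultimately show ?thesis using k that by simp
qed

text \<open>Two instances of \<open>gauss_lemma\<close> at \<open>w t\<close>, with the radial
  vector paired with itself and with the velocity. They convert Cauchy-Schwarz at the point of the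
  path into a bound on the growth of \<open>mx (w t) (w t)\<close>.\<close>

lemma gauss_coordinates:
  assumes t: "t \<in> {0..1}" and k: "Tex (w t) k = velocity A \<eta> t" and d: "d \<in> charts_at A (\<eta> t)"
  shows "lm d (snd d (\<eta> t)) (Tex (w t) (w t) d) (Tex (w t) (w t) d) = mx (w t) (w t)"
    "lm d (snd d (\<eta> t)) (Tex (w t) (w t) d) (Tex (w t) k d) = mx (w t) k"
    "l t = sqrt (lm d (snd d (\<eta> t)) (Tex (w t) k d) (Tex (w t) k d))"
  using gauss_lemma[OF w_in_Uc[OF t]] metric_eq_lm[OF d] Tex_in_tangent_space[OF w_in_Uc[OF t]]
  by (simp_all add: ex_w[OF t] l_def metric_norm_def flip: k)

lemma mx_w_le:
  assumes "t \<in> {0..1}" "Tex (w t) k = velocity A \<eta> t"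
  shows "mx (w t) k \<le> r t * l t"
proof -
  obtain d where d: "d \<in> charts_at A (\<eta> t)" by (rule chart_exists)
  show ?thesis
    using lm_Cauchy_Schwarz[OF d, of "Tex (w t) (w t) d" "Tex (w t) k d"]
    by (simp add: gauss_coordinates[OF assms d] r_def)
qed

lemma has_real_derivative_mx_w:
  assumes "has_curve_deriv w k t {0..1}"
  shows "((\<lambda>t. mx (w t) (w t)) has_real_derivative 2 * mx (w t) k) (at t within {0..1})"
  using has_real_derivative_mx[OF assms assms] lm_commute[OF c0, of k "w t"] by simp

text \<open>Adding e > 0 under the root makes the radius differentiable even where it vanishes, and
  the bound of its derivative by the speed survives because \<open>r t\<close> is at most the
  regularized radius. At the end e tends to 0.\<close>

lemma radius_increment_le:
  assumes t: "0 \<le> t1" "t1 \<le> t2" "t2 \<le> 1"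
  shows "r t2 - r t1 \<le> integral {t1..t2} l"
proof -
  obtain S where S: "finite S" "{0, 1} \<subseteq> S" "l integrable_on {0..1}"
    "\<And>t. t \<in> {0..1} - S \<Longrightarrow> has_velocity A \<eta> (velocity A \<eta> t) t {0..1}"
    "\<And>t. t \<in> {0..1} - S \<Longrightarrow> isCont l t"
    by (rule speed_regular) (rule that)
  have sub: "{t1..t2} \<subseteq> {0..1}" using t by auto
  have l_int: "l integrable_on {t1..t2}"
    using S(3) sub by (rule integrable_on_subinterval)
  have le: "sqrt (mx (w t2) (w t2) + e) - sqrt (mx (w t1) (w t1) + e) \<le> integral {t1..t2} l" if e: "0 < e" for e
  proof -
    define f where "f t = sqrt (mx (w t) (w t) + e)" for t
    have pos: "0 < mx (w t) (w t) + e" for t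
      using e mx_nonneg[of "w t"] by simp
    have "\<exists>D. (t \<in> {t1<..<t2} - S \<longrightarrow> (f has_vector_derivative D) (at t)) \<and> (t \<in> {t1..t2} - S \<longrightarrow> D \<le> l t)" for t
    proof (cases "t \<in> {t1..t2} - S")
      case True
      then have t01: "t \<in> {0..1}" "0 < t" "t < 1" using sub S(2) by (auto simp: less_le)
      then have at: "at t within {0..1} = at t" by (simp add: at_within_Icc_at)
      note vel = S(4)[of t]
      obtain k where k: "has_curve_deriv w k t {0..1}" "Tex (w t) k = velocity A \<eta> t"
        using w_velocity[OF t01(1)] vel True t01 by blast
      have "(f has_real_derivative 2 * mx (w t) k * (inverse (sqrt (mx (w t) (w t) + e)) / 2)) (at t)"
        unfolding f_def[abs_def] using has_real_derivative_mx_w[OF k(1)] pos[of t]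
        by (auto intro!: derivative_eq_intros simp: at)
      moreover have "2 * mx (w t) k * (inverse (sqrt (mx (w t) (w t) + e)) / 2) \<le> l t"
      proof -
        have "0 \<le> l t" using l_nonneg vel True t01 by blast
        moreover have "r t \<le> sqrt (mx (w t) (w t) + e)" using e by (simp add: r_def)
        ultimately have "r t * l t \<le> sqrt (mx (w t) (w t) + e) * l t"
          by (rule mult_right_mono[rotated])
        then have "mx (w t) k \<le> sqrt (mx (w t) (w t) + e) * l t"
          using mx_w_le[OF t01(1) k(2)] by simp
        then show ?thesis using pos[of t] by (simp add: field_simps)
      qed
      ultimately show ?thesis
        by (auto simp: has_real_derivative_iff_has_vector_derivative)
    qed (auto intro!: exI[of _ 0])
    then obtain D where D: "\<And>t. t \<in> {t1<..<t2} - S \<Longrightarrow> (f has_vector_derivative D t) (at t)"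
      "\<And>t. t \<in> {t1..t2} - S \<Longrightarrow> D t \<le> l t"
      by metis
    have "continuous_on {t1..t2} f"
      unfolding f_def[abs_def] using continuous_on_subset[OF continuous_on_w sub]
      by (intro continuous_intros continuous_on_mx_w sub)
    then have "(D has_integral f t2 - f t1) {t1..t2}"
      using fundamental_theorem_of_calculus_interior_strong[OF S(1) t(2) D(1)] by blast
    \<comment> \<open>\<open>D \<le> l\<close> is known outside S only; D is replaced by l on this
      finite set, which leaves the integral unchanged.\<close>
    then have "((\<lambda>t. if t \<in> S then l t else D t) has_integral f t2 - f t1) {t1..t2}"
      by (rule has_integral_spike_finite[OF S(1), rotated]) simp
    then have "f t2 - f t1 \<le> integral {t1..t2} l"
      using integrable_integral[OF l_int] by (rule has_integral_le) (use D(2) in auto)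
    then show ?thesis by (simp add: f_def)
  qed
  show ?thesis
  proof (rule tendsto_upperbound)
    have "((\<lambda>e. sqrt (mx (w t2) (w t2) + e) - sqrt (mx (w t1) (w t1) + e)) \<longlongrightarrow>
        sqrt (mx (w t2) (w t2) + 0) - sqrt (mx (w t1) (w t1) + 0)) (at_right 0)"
      by (intro tendsto_intros)
    then show "((\<lambda>e. sqrt (mx (w t2) (w t2) + e) - sqrt (mx (w t1) (w t1) + e)) \<longlongrightarrow> r t2 - r t1) (at_right 0)"
      by (simp add: r_def)
    show "\<forall>\<^sub>F e in at_right 0. sqrt (mx (w t2) (w t2) + e) - sqrt (mx (w t1) (w t1) + e) \<le> integral {t1..t2} l"
      using le by (simp add: eventually_at_filter)
  qed simp
qed

lemma radius_le_length: "sqrt (mx (lg y) (lg y)) \<le> path_length A \<gamma> \<eta>"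
  using radius_increment_le[of 0 1] bilinear_lzero[OF bilinear_mx]
  by (simp add: path_length_def l_def[abs_def] r_def w_0 w_1)

text \<open>
  If the length is minimal, then \<open>r\<close> is the arc length.  Equality in the Cauchy-Schwarz inequality
  makes \<open>w'\<close> a multiple of \<open>w\<close>, so \<open>w / r\<close> is constant where \<open>r > 0\<close>.  Constancy is tested
  against the functionals \<open>mx _ z\<close>, so that only real functions have to be integrated.
\<close>

lemma minimal_length_imp_radial:
  assumes len: "path_length A \<gamma> \<eta> = sqrt (mx (lg y) (lg y))"
  shows "mono_on {0..1} r" and "\<And>t. t \<in> {0..1} \<Longrightarrow> 0 < r t \<Longrightarrow> w t = (r t / r 1) *\<^sub>R lg y"
proof -
  obtain S where S: "finite S" "{0, 1} \<subseteq> S" "l integrable_on {0..1}"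
    "\<And>t. t \<in> {0..1} - S \<Longrightarrow> has_velocity A \<eta> (velocity A \<eta> t) t {0..1}"
    "\<And>t. t \<in> {0..1} - S \<Longrightarrow> isCont l t"
    by (rule speed_regular) (rule that)
  have total: "r 1 = integral {0..1} l"
    using len by (simp add: path_length_def l_def[abs_def] r_def w_1)
  have r0: "r 0 = 0" by (simp add: r_def w_0 bilinear_lzero[OF bilinear_mx])
  \<comment> \<open>Splitting at t gives two increment bounds whose sum is the equality
    \<open>total\<close>; hence both are equalities.\<close>
  have arc_length: "r t = integral {0..t} l" if "t \<in> {0..1}" for t
  proof (rule antisym)
    show "r t \<le> integral {0..t} l"
      using radius_increment_le[of 0 t] that r0 by simp
    have "r 1 - r t \<le> integral {t..1} l"
      using radius_increment_le[of t 1] that by simp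
    moreover have "integral {0..t} l + integral {t..1} l = integral {0..1} l"
      using that S(3) by (intro Henstock_Kurzweil_Integration.integral_combine) auto
    ultimately show "integral {0..t} l \<le> r t"
      using total by simp
  qed
  have l_pos: "0 \<le> l t" if "t \<in> {0..1} - S" for t
    using l_nonneg S(4) that by blast
  show mono: "mono_on {0..1} r"
  proof (rule mono_onI)
    fix t1 t2 :: real assume t: "t1 \<in> {0..1}" "t2 \<in> {0..1}" "t1 \<le> t2"
    have "l integrable_on {0..t2}" "l integrable_on {t1..t2}"
      using S(3) t by (auto intro: integrable_on_subinterval)
    then have "integral {0..t1} l + integral {t1..t2} l = integral {0..t2} l"
      using t by (intro Henstock_Kurzweil_Integration.integral_combine) auto
    moreover have "0 \<le> integral {t1..t2} l"
    proof -
      have "((\<lambda>t. if t \<in> S then 0 else l t) has_integral integral {t1..t2} l) {t1..t2}"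
        by (rule has_integral_spike_finite[OF S(1) _ integrable_integral[OF \<open>l integrable_on {t1..t2}\<close>]]) simp
      then show ?thesis
        by (rule has_integral_nonneg) (use l_pos t in auto)
    qed
    ultimately show "r t1 \<le> r t2" using arc_length t by simp
  qed
  \<comment> \<open>By \<open>arc_length\<close> the radius is an indefinite integral of the speed,
    so it is differentiable wherever the speed is continuous, even if r vanishes.\<close>
  have r_deriv: "(r has_real_derivative l t) (at t)" if t: "t \<in> {0..1} - S" for t
  proof -
    have t01: "0 < t" "t < 1" using t S(2) by (auto simp: less_le)
    then have at: "at t within {0..1} = at t" by (simp add: at_within_Icc_at)
    have "((\<lambda>u. integral {0..u} l) has_vector_derivative l t) (at t within ({0..1} - {}))"
      using S(3,5) t by (intro integral_has_vector_derivative_continuous_at) (auto intro: continuous_at_imp_continuous_within)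
    then have "((\<lambda>u. integral {0..u} l) has_real_derivative l t) (at t within {0..1})"
      by (simp add: has_real_derivative_iff_has_vector_derivative)
    then have "(r has_real_derivative l t) (at t within {0..1})"
      by (rule has_field_derivative_transform_within[where d = 1]) (use arc_length t in auto)
    then show ?thesis by (simp add: at)
  qed
  have w_deriv: "has_curve_deriv w ((l t / r t) *\<^sub>R w t) t {0..1}"
    if t: "t \<in> {0..1} - S" and pos: "0 < r t" for t
  proof -
    have t01: "t \<in> {0..1}" "0 < t" "t < 1" using t S(2) by (auto simp: less_le)
    then have at: "at t within {0..1} = at t" by (simp add: at_within_Icc_at)
    obtain k where k: "has_curve_deriv w k t {0..1}" "Tex (w t) k = velocity A \<eta> t"
      using w_velocity[OF t01(1)] S(4)[OF t] by blast
    \<comment> \<open>Differentiating the square of r in two ways shows that w and its derivative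
      pair to \<open>l t * r t\<close>, the case of equality in Cauchy-Schwarz.\<close>
    have "((\<lambda>t. r t * r t) has_real_derivative l t * r t + l t * r t) (at t)"
      using r_deriv[OF t] by (auto intro!: derivative_eq_intros)
    then have "((\<lambda>t. mx (w t) (w t)) has_real_derivative l t * r t + l t * r t) (at t)"
      by (simp add: r_square)
    then have eq: "mx (w t) k = l t * r t"
      using has_real_derivative_mx_w[OF k(1)] DERIV_unique unfolding at by fastforce
    obtain d where d: "d \<in> charts_at A (\<eta> t)" by (rule chart_exists)
    let ?a = "Tex (w t) (w t) d" and ?b = "Tex (w t) k d" and ?g = "lm d (snd d (\<eta> t))"
    note gc = gauss_coordinates[OF t01(1) k(2) d]
    have aa: "?g ?a ?a = r t * r t" using gc(1) by (simp add: r_square)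
    have ab: "?g ?a ?b = l t * r t" using gc(2) eq by simp
    have bb: "?g ?b ?b = l t * l t"
      using gc(3) lm_nonneg[OF d, of ?b] by simp
    have q: "?g ?a ?b / ?g ?a ?a = l t / r t" using aa ab pos by simp
    \<comment> \<open>The part of \<open>?b\<close> orthogonal to \<open>?a\<close> has squared
      length \<open>l\<^sup>2 - (l * r)\<^sup>2 / r\<^sup>2 = 0\<close>, so it vanishes by
      definiteness; injectivity of \<open>Tex\<close> carries the proportionality back to w.\<close>
    have "?g (?b - (l t / r t) *\<^sub>R ?a) (?b - (l t / r t) *\<^sub>R ?a) = ?g ?b ?b - (?g ?a ?b)\<^sup>2 / ?g ?a ?a"
      using lm_residual[OF d, of ?a ?b] aa pos unfolding q by simp
    also have "\<dots> = 0"
      using pos by (simp add: aa ab bb power2_eq_square)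
    finally have "?b - (l t / r t) *\<^sub>R ?a = 0"
      using lm_pos[OF d, of "?b - (l t / r t) *\<^sub>R ?a"] by force
    then have "Tex (w t) k d = Tex (w t) ((l t / r t) *\<^sub>R w t) d"
      using linear_scale[OF linear_Tex[OF w_in_Uc[OF t01(1)]]] by (simp add: scaleR_fun_def)
    then have "Tex (w t) k = Tex (w t) ((l t / r t) *\<^sub>R w t)"
      using tangent_space_eqI[OF d] Tex_in_tangent_space[OF w_in_Uc[OF t01(1)]] ex_w[OF t01(1)] by metis
    then have "k = (l t / r t) *\<^sub>R w t"
      by (rule inj_Tex[OF w_in_Uc[OF t01(1)]])
    then show ?thesis using k(1) by simp
  qed
  show "w t = (r t / r 1) *\<^sub>R lg y" if t: "t \<in> {0..1}" and pos: "0 < r t" for t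
  proof -
    have pos': "0 < r s" if "s \<in> {t..1}" for s
      using mono_onD[OF mono t, of s] pos that t by auto
    \<comment> \<open>With w' = (l / r) w and r' = l the quotient rule gives derivative 0 outside S;
      monotonicity keeps r positive on all of \<open>{t..1}\<close>.\<close>
    have const: "mx (w t) z / r t = mx (w 1) z / r 1" for z
    proof -
      have "((\<lambda>s. 0) has_integral mx (w 1) z / r 1 - mx (w t) z / r t) {t..1}"
      proof (rule fundamental_theorem_of_calculus_interior_strong[OF S(1)])
        show "t \<le> 1" using t by simp
        have sub: "{t..1} \<subseteq> {0..1}" using t by auto
        show "continuous_on {t..1} (\<lambda>s. mx (w s) z / r s)"
        proof (rule continuous_on_divide)
          show "continuous_on {t..1} (\<lambda>s. mx (w s) z)"
            by (intro continuous_on_mx_w continuous_on_const sub)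
          show "continuous_on {t..1} r"
            unfolding r_def
            by (intro continuous_on_real_sqrt continuous_on_mx_w continuous_on_subset[OF continuous_on_w] sub)
          show "\<forall>s\<in>{t..1}. r s \<noteq> 0"
            using pos' by force
        qed
        fix s assume s: "s \<in> {t<..<1} - S"
        then have s': "s \<in> {0..1} - S" "0 < r s" using t pos'[of s] by auto
        have at: "at s within {0..1} = at s" using s t by (simp add: at_within_Icc_at)
        have "has_curve_deriv (\<lambda>t. z) 0 s {0..1}"
          by (simp add: has_curve_deriv_def curve_quotient_def[abs_def])
        from has_real_derivative_mx[OF w_deriv[OF s'] this]
        have "((\<lambda>s. mx (w s) z) has_real_derivative (l s / r s) * mx (w s) z) (at s)"
          by (simp add: at bilinear_lmul[OF bilinear_mx] bilinear_rzero[OF bilinear_mx])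
        then have "((\<lambda>s. mx (w s) z / r s) has_real_derivative
            ((l s / r s) * mx (w s) z * r s - mx (w s) z * l s) / (r s * r s)) (at s)"
          using r_deriv[OF s'(1)] s'(2) by (intro DERIV_divide) auto
        then show "((\<lambda>s. mx (w s) z / r s) has_vector_derivative 0) (at s)"
          using s'(2) by (simp add: has_real_derivative_iff_has_vector_derivative)
      qed
      moreover have "((\<lambda>s. 0) has_integral (0::real)) {t..1}" by simp
      ultimately show ?thesis using has_integral_unique by fastforce
    qed
    \<comment> \<open>The test vector is the difference itself: \<open>const\<close> makes it
      orthogonal to itself, hence 0.\<close>
    let ?z = "w t - (r t / r 1) *\<^sub>R w 1"
    have "0 < r 1" using pos'[of 1] t by simp
    have "mx ?z ?z = mx (w t) ?z - (r t / r 1) * mx (w 1) ?z"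
      by (simp only: bilinear_lsub[OF bilinear_mx] bilinear_lmul[OF bilinear_mx] real_scaleR_def)
    also have "\<dots> = 0"
    proof -
      have "mx (w t) z = (r t / r 1) * mx (w 1) z" for z
        using const[of z] pos \<open>0 < r 1\<close> by (simp add: field_simps)
      then show ?thesis by (simp only: diff_self)
    qed
    finally have "?z = 0" using lm_pos[OF c0] by (metis less_irrefl)
    then show ?thesis by (simp add: w_1)
  qed
qed

text \<open>The parameter change is the normalized radius \<open>r / r 1\<close>, onto by the
  intermediate value theorem. For \<open>lg y = 0\<close> this quotient degenerates, but then
  monotonicity forces the radius to vanish throughout and the path is constant.\<close>

lemma minimal_length_imp_reparametrization:
  assumes len: "path_length A \<gamma> \<eta> = sqrt (mx (lg y) (lg y))"
  shows "reparametrization \<eta> (\<lambda>t. ex (t *\<^sub>R lg y))"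
proof (cases "lg y = 0")
  case True
  have "r 1 = 0" by (simp add: r_def w_1 True bilinear_lzero[OF bilinear_mx])
  have "w t = 0" if t: "t \<in> {0..1}" for t
  proof -
    have "r t \<le> 0"
      using mono_onD[OF minimal_length_imp_radial(1)[OF len] t, of 1] t \<open>r 1 = 0\<close> by simp
    then have "mx (w t) (w t) = 0"
      using r_square[of t] r_nonneg[of t] by simp
    then show ?thesis using lm_pos[OF c0, of "w t"] by force
  qed
  then have "\<eta> t = ex (t *\<^sub>R lg y)" if "t \<in> {0..1}" for t
    using ex_w[OF that] that True by simp
  then show ?thesis
    \<comment> \<open>Both curves are constant, so the identity serves as the parameter
      change.\<close>
    unfolding reparametrization_def by (intro exI[of _ id]) (auto intro!: mono_onI)
next
  case False
  define \<phi> where "\<phi> t = r t / r 1" for t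
  have "0 < r 1"
    using lm_pos[OF c0 False] by (simp add: r_def w_1)
  have r0: "r 0 = 0" by (simp add: r_def w_0 bilinear_lzero[OF bilinear_mx])
  note mono = minimal_length_imp_radial(1)[OF len]
  have mono\<phi>: "mono_on {0..1} \<phi>"
    using mono \<open>0 < r 1\<close> by (auto simp: mono_on_def \<phi>_def divide_right_mono)
  have cont: "continuous_on {0..1} \<phi>"
    unfolding \<phi>_def r_def using \<open>0 < r 1\<close>
    by (intro continuous_intros continuous_on_mx_w continuous_on_w) (auto simp: r_def)
  have ends: "\<phi> 0 = 0" "\<phi> 1 = 1"
    using r0 \<open>0 < r 1\<close> by (auto simp: \<phi>_def)
  have "\<phi> ` {0..1} = {0..1}"
  proof
    show "\<phi> ` {0..1} \<subseteq> {0..1}"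
      using mono_onD[OF mono\<phi>, of 0] mono_onD[OF mono\<phi>, of _ 1] ends by force
    show "{0..1} \<subseteq> \<phi> ` {0..1}"
    proof
      fix s :: real assume "s \<in> {0..1}"
      then obtain t where "0 \<le> t" "t \<le> 1" "\<phi> t = s"
        using IVT'[of \<phi> 0 s 1] ends cont by auto
      then show "s \<in> \<phi> ` {0..1}" by auto
    qed
  qed
  moreover have "\<eta> t = ex (\<phi> t *\<^sub>R lg y)" if t: "t \<in> {0..1}" for t
  proof (cases "r t = 0")
    case True
    then have "mx (w t) (w t) = 0" using r_square[of t] by simp
    then have "w t = 0" using lm_pos[OF c0, of "w t"] by force
    then show ?thesis using ex_w[OF t] True by (simp add: \<phi>_def)
  next
    case False
    then have "w t = \<phi> t *\<^sub>R lg y"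
      using minimal_length_imp_radial(2)[OF len t] r_nonneg[of t] by (simp add: \<phi>_def)
    then show ?thesis using ex_w[OF t] by simp
  qed
  ultimately show ?thesis
    unfolding reparametrization_def using mono\<phi> by blast
qed

end

section \<open>Radial geodesics as minimal paths\<close>

context normal_neighborhood
begin

text \<open>The geodesic equation gives the velocity a derivative in every chart, so the velocity is
  continuous, as \<open>C1_curve\<close> demands; a single piece suffices.\<close>

lemma ray_in_paths:
  assumes a: "a \<in> Uc"
  shows "(\<lambda>t. ex (t *\<^sub>R a)) \<in> paths_in A V x (ex a)"
proof -
  let ?\<alpha> = "\<lambda>t. ex (t *\<^sub>R a)"
  have geo: "geodesic A \<gamma> ?\<alpha>"
    using ray_geodesic[OF a] by (simp add: geodesic_from_def)
  have C1: "C1_curve A 0 1 ?\<alpha>"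
    unfolding C1_curve_def
  proof
    fix d assume "d \<in> A"
    then obtain \<Gamma> u' where u': "\<And>t. t \<in> {0..1} \<Longrightarrow> ?\<alpha> t \<in> fst d \<Longrightarrow>
         has_curve_deriv (snd d \<circ> ?\<alpha>) (u' t) t {0..1} \<and>
         has_curve_deriv u' (- \<Gamma> d (snd d (?\<alpha> t)) (u' t) (u' t)) t {0..1}"
      using geo unfolding geodesic_def by metis
    have "continuous_on {t \<in> {0..1}. ?\<alpha> t \<in> fst d} u'"
      unfolding continuous_on_def
    proof
      fix t assume "t \<in> {t \<in> {0..1}. ?\<alpha> t \<in> fst d}"
      then have "(u' \<longlongrightarrow> u' t) (at t within {0..1})"
        using u'[of t] has_curve_deriv_continuous by blast
      then show "(u' \<longlongrightarrow> u' t) (at t within {t \<in> {0..1}. ?\<alpha> t \<in> fst d})"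
        by (rule tendsto_within_subset) auto
    qed
    then show "\<exists>u'. continuous_on {t \<in> {0..1}. ?\<alpha> t \<in> fst d} u' \<and>
        (\<forall>t\<in>{0..1}. ?\<alpha> t \<in> fst d \<longrightarrow> has_curve_deriv (snd d \<circ> ?\<alpha>) (u' t) t {0..1})"
      using u' by blast
  qed
  have "piecewise_C1_path A ?\<alpha>"
    unfolding piecewise_C1_path_def
  proof
    show "path ?\<alpha>" using geo by (simp add: geodesic_def path_def)
    show "\<exists>n \<tau>. \<tau> 0 = 0 \<and> \<tau> n = 1 \<and> (\<forall>i<n. \<tau> i < \<tau> (Suc i) \<and> C1_curve A (\<tau> i) (\<tau> (Suc i)) ?\<alpha>)"
      using C1 by (intro exI[of _ 1] exI[of _ real]) simp
  qed
  then show ?thesis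
    using ex_in_V scaleR_in_Uc[OF a]
    by (auto simp: paths_in_def path_image_def pathstart_def pathfinish_def ex_0)
qed

lemma ray_length:
  assumes "a \<in> Uc"
  shows "path_length A \<gamma> (\<lambda>t. ex (t *\<^sub>R a)) = sqrt (mx a a)"
proof -
  have "path_length A \<gamma> (\<lambda>t. ex (t *\<^sub>R a)) = integral {0..1} (\<lambda>t :: real. sqrt (mx a a))"
    unfolding path_length_def
    by (rule Henstock_Kurzweil_Integration.integral_cong) (simp add: metric_norm_def ray_velocity ray_speed assms)
  then show ?thesis by simp
qed

text \<open>The radius of the end point is the length of the ray and a lower bound for every
  competitor. A minimal path therefore attains this bound, which is the hypothesis of
  \<open>minimal_length_imp_reparametrization\<close>.\<close>

lemma ray_minimal:
  assumes a: "a \<in> Uc"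
  shows "minimal_path A \<gamma> V x (ex a) (\<lambda>t. ex (t *\<^sub>R a))"
    and "minimal_path A \<gamma> V x (ex a) \<eta> \<Longrightarrow> reparametrization \<eta> (\<lambda>t. ex (t *\<^sub>R a))"
proof -
  have le: "sqrt (mx a a) \<le> path_length A \<gamma> \<zeta>" if "\<zeta> \<in> paths_in A V x (ex a)" for \<zeta>
  proof -
    interpret normal_path A \<gamma> x U V c0 \<zeta> "ex a"
      by unfold_locales (rule that)
    show ?thesis using radius_le_length by (simp add: lg_ex[OF a])
  qed
  then show "minimal_path A \<gamma> V x (ex a) (\<lambda>t. ex (t *\<^sub>R a))"
    using ray_in_paths[OF a] by (simp add: minimal_path_def ray_length[OF a])
  assume min: "minimal_path A \<gamma> V x (ex a) \<eta>"
  then interpret normal_path A \<gamma> x U V c0 \<eta> "ex a"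
    by unfold_locales (simp add: minimal_path_def)
  have "path_length A \<gamma> \<eta> = sqrt (mx a a)"
    using min le[of \<eta>] ray_in_paths[OF a] ray_length[OF a] unfolding minimal_path_def by force
  then show "reparametrization \<eta> (\<lambda>t. ex (t *\<^sub>R a))"
    using minimal_length_imp_reparametrization by (simp add: lg_ex[OF a])
qed

end

theorem proposition8:
  fixes A :: "('m::t2_space, 'e::frechet_space) chart set"
    and \<gamma> :: "('m, 'e) tensor2"
    and x y :: 'm
    and U :: "('m, 'e) tvec set"
    and V :: "'m set"
    and v :: "('m, 'e) tvec"
    and \<alpha> :: "real \<Rightarrow> 'm"
  assumes "weak_riemannian_manifold A \<gamma>"
    and "normalizable_at A \<gamma> x U V"
    and "y \<in> V"
    and "v \<in> U"
    and "the_inv_into U (exp_map A \<gamma> x) y = v"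
  defines "\<alpha> \<equiv> (\<lambda>t. exp_map A \<gamma> x (t *\<^sub>R v))"
  shows "minimal_path A \<gamma> V x y \<alpha> \<and>
    (\<forall>\<eta>. minimal_path A \<gamma> V x y \<eta> \<longrightarrow> reparametrization \<eta> \<alpha>)"
proof -
  interpret weak_riemannian A \<gamma>
    by unfold_locales (rule assms(1))
  obtain c0 where "c0 \<in> charts_at A x" by (rule chart_exists)
  then interpret normal_neighborhood A \<gamma> x U V c0
    by unfold_locales (rule assms(2))
  \<comment> \<open>The results on rays are stated for coordinate vectors in the chosen chart;
    \<open>v c0\<close> represents v there.\<close>
  have v: "tan (v c0) = v"
    by (rule tan_coordinate[OF assms(4)])
  then have a: "v c0 \<in> Uc"
    using assms(4) by (simp add: Uc_def)
  have "ex (v c0) = y"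
    using homeomorphism_apply2[OF homeomorphism_exp assms(3)] by (simp add: ex_def v assms(5))
  moreover have "(\<lambda>t. ex (t *\<^sub>R v c0)) = \<alpha>"
    by (simp add: \<alpha>_def ex_def v linear_scale[OF linear_tangent_of[OF c0]])
  ultimately show ?thesis
    using ray_minimal[OF a] by simp
qed

end
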